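(* Let $\mathbb G$ be a group of Heisenberg type with homogeneous dimension $Q$, let $1<p<\infty$, $R>0$, and let $B_R=\{x\in\mathbb G\mid N(x)<R\}$. The Dirichlet problem $$\Delta_{H,p}f=-|z|^p\ \text{ in }B_R,\qquad f=0\ \text{ on }\partial B_R,$$ admits the following unique positive solution in $B_R$: $$f(x)=\frac{p-1}{2p(Q+p)^{\frac1{p-1}}}\Big(R^{\frac{2p}{p-1}}-N(x)^{\frac{2p}{p-1}}\Big),$$ and it satisfies $|\nabla_Hf|=c|z|$ on $\partial B_R$ with $$c=\left(\frac{R^2}{Q+p}\right)^{\frac1{p-1}}.$$
   Context: A group of Heisenberg type is a simply connected Lie group $\mathbb G$ whose Lie algebra is $\mathfrak g=\mathfrak h\oplus\mathfrak v$ with $[\mathfrak h,\mathfrak h]=\mathfrak v$, $[\mathfrak h,\mathfrak v]=\{0\}$, equipped with an inner product with $\mathfrak h\perp\mathfrak v$, such that the linear map $J:\mathfrak v\to\operatorname{End}(\mathfrak h)$ defined by $\langle J(\sigma)z,z'\rangle=\langle[z,z'],\sigma\rangle$ satisfies $J(\sigma)^2=-|\sigma|^2I_{\mathfrak h}$ for all $\sigma\in\mathfrak v$. Let $m=\dim\mathfrak h$, $k=\dim\mathfrak v$, $Q=m+2k$, and let $\{e_i\}_{i=1}^m$, $\{\varepsilon_\ell\}_{\ell=1}^k$ be orthonormal bases of $\mathfrak h$, $\mathfrak v$. Points are written in logarithmic coordinates $x=(z,\sigma)$, $z\in\mathfrak h$, $\sigma\in\mathfrak v$, with group law $x\circ x'=(z+z',\sigma+\sigma'+\frac12\sum_\ell\langle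 J(\varepsilon_\ell)z,z'\rangle\varepsilon_\ell)$; $dx$ is Lebesgue measure. Set $X_i=\partial_{z_i}+\frac12\sum_{\ell}\langle J(\varepsilon_\ell)z,e_i\rangle\partial_{\sigma_\ell}$, $\nabla_Hf=\sum_iX_if\,X_i$, $|\nabla_Hf|^2=\sum_i(X_if)^2$, $\Delta_{H,p}f=\sum_{i=1}^mX_i(|\nabla_Hf|^{p-2}X_if)$, and $N(z,\sigma)=(|z|^4+16|\sigma|^2)^{1/4}$. Solutions are weak solutions: $f\in\overset{\circ}{W}{}^{1,p}_H(B_R)$ (the closure of $C_0^\infty(B_R)$ in the norm $\|f\|_{L^p}+\|\nabla_Hf\|_{L^p}$) and $\int_{B_R}|\nabla_Hf|^{p-2}\langle\nabla_Hf,\nabla_H\varphi\rangle dx=\int_{B_R}|z|^p\varphi\,dx$ for every $\varphi\in\overset{\circ}{W}{}^{1,p}_H(B_R)$. *)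

theory Defs
  imports "HOL-Analysis.Analysis"
begin

section \<open>Groups of Heisenberg type in logarithmic coordinates\<close>

text \<open>
  The Lie algebra is carried by the whole type \<open>'g\<close>, whose inner product is the given one;
  \<open>hor\<close> and \<open>ver\<close> are the summands \<open>\<hh>\<close> and \<open>\<vv>\<close>. The simply connected group is identified with
  its Lie algebra through the exponential map, so that points of the group are elements of \<open>'g\<close>.
  The last two fields are the orthonormal bases \<open>{e\<^sub>i}\<close> and \<open>{\<epsilon>\<^sub>l}\<close>, used as index sets.
\<close>

record 'g htype =
  lie :: "'g \<Rightarrow> 'g \<Rightarrow> 'g"
  hor :: "'g set"
  ver :: "'g set"
  hbasis :: "'g set"
  vbasis :: "'g set"

definition orthonormal_basis :: "'g::euclidean_space set \<Rightarrow> 'g set \<Rightarrow> bool" where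
  "orthonormal_basis B S \<longleftrightarrow> pairwise orthogonal B \<and> (\<forall>b\<in>B. norm b = 1) \<and> span B = S"

definition Jmap :: "('g::euclidean_space, 'm) htype_scheme \<Rightarrow> 'g \<Rightarrow> 'g \<Rightarrow> 'g" where
  "Jmap G \<sigma> z = (THE w. w \<in> hor G \<and> (\<forall>z'\<in>hor G. w \<bullet> z' = lie G z z' \<bullet> \<sigma>))"

definition heisenberg_type :: "('g::euclidean_space, 'm) htype_scheme \<Rightarrow> bool" where
  "heisenberg_type G \<longleftrightarrow>
     bilinear (lie G) \<and> (\<forall>x. lie G x x = 0) \<and>
     (\<forall>x y w. lie G x (lie G y w) + lie G y (lie G w x) + lie G w (lie G x y) = 0) \<and>
     subspace (hor G) \<and> subspace (ver G) \<and>
     (\<forall>z\<in>hor G. \<forall>\<sigma>\<in>ver G. orthogonal z \<sigma>) \<and>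
     (\<forall>x. \<exists>z\<in>hor G. \<exists>\<sigma>\<in>ver G. x = z + \<sigma>) \<and>
     span {lie G z z' |z z'. z \<in> hor G \<and> z' \<in> hor G} = ver G \<and>
     (\<forall>z\<in>hor G. \<forall>\<sigma>\<in>ver G. lie G z \<sigma> = 0) \<and>
     (\<forall>\<sigma>\<in>ver G. \<forall>z\<in>hor G. Jmap G \<sigma> (Jmap G \<sigma> z) = - ((norm \<sigma>)\<^sup>2 *\<^sub>R z)) \<and>
     orthonormal_basis (hbasis G) (hor G) \<and> orthonormal_basis (vbasis G) (ver G)"

definition homogeneous_dim :: "('g::euclidean_space, 'm) htype_scheme \<Rightarrow> nat" where
  "homogeneous_dim G = dim (hor G) + 2 * dim (ver G)"

definition zpart :: "('g::euclidean_space, 'm) htype_scheme \<Rightarrow> 'g \<Rightarrow> 'g" where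
  "zpart G x = (THE z. z \<in> hor G \<and> x - z \<in> ver G)"

definition spart :: "('g::euclidean_space, 'm) htype_scheme \<Rightarrow> 'g \<Rightarrow> 'g" where
  "spart G x = x - zpart G x"

text \<open>
  The group law, in logarithmic coordinates. It enters the statements below only through the
  left-invariant fields \<open>X\<^sub>i\<close>; see \<open>Xfield_left_invariant\<close>.
\<close>

definition gmult :: "('g::euclidean_space, 'm) htype_scheme \<Rightarrow> 'g \<Rightarrow> 'g \<Rightarrow> 'g" where
  "gmult G x x' =
     (zpart G x + zpart G x') +
     (spart G x + spart G x' + (1/2) *\<^sub>R (\<Sum>\<epsilon>\<in>vbasis G. (Jmap G \<epsilon> (zpart G x) \<bullet> zpart G x') *\<^sub>R \<epsilon>))"

definition hom_norm :: "('g::euclidean_space, 'm) htype_scheme \<Rightarrow> 'g \<Rightarrow> real" where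
  "hom_norm G x = (norm (zpart G x) ^ 4 + 16 * (norm (spart G x))\<^sup>2) powr (1/4)"

definition hom_ball :: "('g::euclidean_space, 'm) htype_scheme \<Rightarrow> real \<Rightarrow> 'g set" where
  "hom_ball G R = {x. hom_norm G x < R}"


section \<open>Horizontal derivatives\<close>

text \<open>
  The field \<open>X\<^sub>i\<close>, indexed by the basis vector \<open>e = e\<^sub>i\<close>. The partial derivatives in \<open>z\<^sub>i\<close> and
  \<open>\<sigma>\<^sub>l\<close> are the values of the Frechet derivative at \<open>e\<^sub>i\<close> and \<open>\<epsilon>\<^sub>l\<close>; this is meaningful only where
  \<open>f\<close> is differentiable.
\<close>

definition Xfield :: "('g::euclidean_space, 'm) htype_scheme \<Rightarrow> 'g \<Rightarrow> ('g \<Rightarrow> real) \<Rightarrow> 'g \<Rightarrow> real" where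
  "Xfield G e f x =
     frechet_derivative f (at x) e +
     1/2 * (\<Sum>\<epsilon>\<in>vbasis G. (Jmap G \<epsilon> (zpart G x) \<bullet> e) * frechet_derivative f (at x) \<epsilon>)"

text \<open>
  A horizontal vector field \<open>\<Sum>\<^sub>i g\<^sub>i X\<^sub>i\<close> is represented by the \<open>hor\<close>-valued function
  \<open>\<Sum>\<^sub>i g\<^sub>i e\<^sub>i\<close>, so that its length is the ambient norm.
\<close>

definition hgrad :: "('g::euclidean_space, 'm) htype_scheme \<Rightarrow> ('g \<Rightarrow> real) \<Rightarrow> 'g \<Rightarrow> 'g" where
  "hgrad G f x = (\<Sum>e\<in>hbasis G. Xfield G e f x *\<^sub>R e)"


section \<open>Test functions and Sobolev spaces\<close>

fun Ck :: "nat \<Rightarrow> ('g::euclidean_space \<Rightarrow> real) \<Rightarrow> bool" where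
  "Ck 0 f \<longleftrightarrow> continuous_on UNIV f"
| "Ck (Suc n) f \<longleftrightarrow>
     (\<forall>x. f differentiable (at x)) \<and> (\<forall>b\<in>Basis. Ck n (\<lambda>x. frechet_derivative f (at x) b))"

definition test_functions :: "'g::euclidean_space set \<Rightarrow> ('g \<Rightarrow> real) set" where
  "test_functions \<Omega> =
     {\<phi>. (\<forall>n. Ck n \<phi>) \<and> compact (closure {x. \<phi> x \<noteq> 0}) \<and> closure {x. \<phi> x \<noteq> 0} \<subseteq> \<Omega>}"

definition Lp :: "real \<Rightarrow> 'g::euclidean_space set \<Rightarrow> ('g \<Rightarrow> 'b::euclidean_space) set" where
  "Lp p \<Omega> = {u. u \<in> borel_measurable (lebesgue_on \<Omega>) \<and>
                 integrable (lebesgue_on \<Omega>) (\<lambda>x. norm (u x) powr p)}"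

definition Lp_norm :: "real \<Rightarrow> 'g::euclidean_space set \<Rightarrow> ('g \<Rightarrow> 'b::euclidean_space) \<Rightarrow> real" where
  "Lp_norm p \<Omega> u = (\<integral>x. norm (u x) powr p \<partial>lebesgue_on \<Omega>) powr (1/p)"

text \<open>
  Each \<open>X\<^sub>i\<close> is divergence free, so its formal adjoint is \<open>- X\<^sub>i\<close>.
\<close>

definition weak_hgrad ::
  "('g::euclidean_space, 'm) htype_scheme \<Rightarrow> 'g set \<Rightarrow> ('g \<Rightarrow> real) \<Rightarrow> ('g \<Rightarrow> 'g) \<Rightarrow> bool" where
  "weak_hgrad G \<Omega> f g \<longleftrightarrow>
     (\<forall>x\<in>\<Omega>. g x \<in> hor G) \<and>
     (\<forall>\<phi>\<in>test_functions \<Omega>. \<forall>e\<in>hbasis G.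
        (\<integral>x. f x * Xfield G e \<phi> x \<partial>lebesgue_on \<Omega>) = - (\<integral>x. (g x \<bullet> e) * \<phi> x \<partial>lebesgue_on \<Omega>))"

text \<open>
  \<open>W0 G p \<Omega> f g\<close>: \<open>f\<close> belongs to the closure of the test functions in the horizontal Sobolev
  norm, and \<open>g\<close> is (a representative of) its weak horizontal gradient. The gradient is carried
  along because it is determined by \<open>f\<close> only up to null sets.
\<close>

definition W0 ::
  "('g::euclidean_space, 'm) htype_scheme \<Rightarrow> real \<Rightarrow> 'g set \<Rightarrow> ('g \<Rightarrow> real) \<Rightarrow> ('g \<Rightarrow> 'g) \<Rightarrow> bool" where
  "W0 G p \<Omega> f g \<longleftrightarrow>
     f \<in> Lp p \<Omega> \<and> g \<in> Lp p \<Omega> \<and> weak_hgrad G \<Omega> f g \<and>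
     (\<forall>\<delta>>0. \<exists>\<phi>\<in>test_functions \<Omega>.
        Lp_norm p \<Omega> (\<lambda>x. \<phi> x - f x) + Lp_norm p \<Omega> (\<lambda>x. hgrad G \<phi> x - g x) < \<delta>)"

text \<open>
  Weak solutions of \<open>\<Delta>\<^sub>H\<^sub>,\<^sub>p f = - \<rho>\<close> in \<open>\<Omega>\<close>, \<open>f = 0\<close> on the boundary. Where the gradient vanishes
  the integrand on the left is \<open>0\<close>, also for \<open>p < 2\<close>.
\<close>

definition weak_solution ::
  "('g::euclidean_space, 'm) htype_scheme \<Rightarrow> real \<Rightarrow> 'g set \<Rightarrow> ('g \<Rightarrow> real) \<Rightarrow> ('g \<Rightarrow> real) \<Rightarrow> bool" where
  "weak_solution G p \<Omega> \<rho> f \<longleftrightarrow>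
     (\<exists>g. W0 G p \<Omega> f g \<and>
       (\<forall>\<phi> \<psi>. W0 G p \<Omega> \<phi> \<psi> \<longrightarrow>
          (\<integral>x. norm (g x) powr (p - 2) * (g x \<bullet> \<psi> x) \<partial>lebesgue_on \<Omega>) =
          (\<integral>x. \<rho> x * \<phi> x \<partial>lebesgue_on \<Omega>)))"


section \<open>The descriptive definitions are well posed\<close>

lemma zpart_unique:
  assumes G: "heisenberg_type G" and z: "z \<in> hor G" and s: "s \<in> ver G"
  shows "zpart G (z + s) = z"
  unfolding zpart_def
proof (rule the_equality)
  show "z \<in> hor G \<and> z + s - z \<in> ver G" using z s by simp
next
  fix w assume w: "w \<in> hor G \<and> z + s - w \<in> ver G"
  have sub: "subspace (hor G)" "subspace (ver G)"
    and orth: "\<And>a b. a \<in> hor G \<Longrightarrow> b \<in> ver G \<Longrightarrow> a \<bullet> b = 0"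
    using G by (auto simp: heisenberg_type_def orthogonal_def)
  have "z - w \<in> hor G" using sub(1) z w by (simp add: subspace_diff)
  moreover have "z - w \<in> ver G"
    using subspace_diff[OF sub(2) conjunct2[OF w] s] by (simp add: algebra_simps)
  ultimately have "(z - w) \<bullet> (z - w) = 0" by (rule orth)
  then show "w = z" by simp
qed

lemma zpart_spart:
  assumes "heisenberg_type G"
  shows "zpart G x \<in> hor G" "spart G x \<in> ver G" "zpart G x + spart G x = x"
proof -
  obtain z s where "z \<in> hor G" "s \<in> ver G" "x = z + s"
    using assms unfolding heisenberg_type_def by blast
  with zpart_unique[OF assms]
  show "zpart G x \<in> hor G" "spart G x \<in> ver G" "zpart G x + spart G x = x"
    by (auto simp: spart_def)
qed

lemma Jmap_spec:
  assumes G: "heisenberg_type G"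
  shows "Jmap G \<sigma> z \<in> hor G" and "z' \<in> hor G \<Longrightarrow> Jmap G \<sigma> z \<bullet> z' = lie G z z' \<bullet> \<sigma>"
proof -
  have sub: "subspace (hor G)" and bil: "bilinear (lie G)"
    and po: "pairwise orthogonal (hbasis G)" and nb: "\<And>b. b \<in> hbasis G \<Longrightarrow> norm b = 1"
    and sp: "span (hbasis G) = hor G"
    using G by (auto simp: heisenberg_type_def orthonormal_basis_def)
  have fin: "finite (hbasis G)" by (rule pairwise_orthogonal_imp_finite[OF po])
  define w where "w = (\<Sum>e\<in>hbasis G. (lie G z e \<bullet> \<sigma>) *\<^sub>R e)"
  have wh: "w \<in> hor G"
    unfolding w_def sp[symmetric] by (intro span_sum span_scale span_base)
  have wb: "w \<bullet> b = lie G z b \<bullet> \<sigma>" if b: "b \<in> hbasis G" for b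
  proof -
    have "w \<bullet> b = (\<Sum>e\<in>hbasis G. (lie G z e \<bullet> \<sigma>) * (e \<bullet> b))"
      by (simp add: w_def inner_sum_left)
    also have "\<dots> = (\<Sum>e\<in>hbasis G. if e = b then lie G z e \<bullet> \<sigma> else 0)"
    proof (rule sum.cong)
      fix e assume e: "e \<in> hbasis G"
      have "b \<bullet> b = 1" using nb[OF b] by (simp add: dot_square_norm)
      moreover have "e \<bullet> b = 0" if "e \<noteq> b"
        using po e b that by (auto simp: pairwise_def orthogonal_def)
      ultimately show "(lie G z e \<bullet> \<sigma>) * (e \<bullet> b) = (if e = b then lie G z e \<bullet> \<sigma> else 0)"
        by auto
    qed simp
    also have "\<dots> = lie G z b \<bullet> \<sigma>" using fin b by simp
    finally show ?thesis .
  qed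
  have lin: "linear (lie G z)" using bil by (simp add: bilinear_def)
  have ws: "w \<bullet> y = lie G z y \<bullet> \<sigma>" if "y \<in> hor G" for y
    using that unfolding sp[symmetric]
  proof (induction rule: span_induct_alt)
    case base
    show ?case using linear_0[OF lin] by simp
  next
    case (step c a y)
    then show ?case
      by (simp add: linear_add[OF lin] linear_scale[OF lin] inner_add_left inner_add_right wb)
  qed
  have "Jmap G \<sigma> z = w"
    unfolding Jmap_def
  proof (rule the_equality)
    show "w \<in> hor G \<and> (\<forall>z'\<in>hor G. w \<bullet> z' = lie G z z' \<bullet> \<sigma>)" using wh ws by blast
  next
    fix u assume u: "u \<in> hor G \<and> (\<forall>z'\<in>hor G. u \<bullet> z' = lie G z z' \<bullet> \<sigma>)"
    have "u - w \<in> hor G" using sub u wh by (simp add: subspace_diff)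
    then have "(u - w) \<bullet> (u - w) = 0"
      using u ws by (simp add: inner_diff_left)
    then show "u = w" by simp
  qed
  then show "Jmap G \<sigma> z \<in> hor G" "z' \<in> hor G \<Longrightarrow> Jmap G \<sigma> z \<bullet> z' = lie G z z' \<bullet> \<sigma>"
    using wh ws by auto
qed

text \<open>\<open>X\<^sub>i\<close> is the left-invariant vector field on the group generated by \<open>e\<^sub>i\<close>.\<close>

lemma Xfield_left_invariant:
  assumes G: "heisenberg_type G" and e: "e \<in> hbasis G" and f: "f differentiable (at x)"
  shows "((\<lambda>t. f (gmult G x (t *\<^sub>R e))) has_real_derivative Xfield G e f x) (at 0)"
proof -
  have sub: "subspace (hor G)" "subspace (ver G)" and eh: "e \<in> hor G"
    using G e span_base[OF e] by (auto simp: heisenberg_type_def orthonormal_basis_def)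
  define u where "u = e + (1/2) *\<^sub>R (\<Sum>\<epsilon>\<in>vbasis G. (Jmap G \<epsilon> (zpart G x) \<bullet> e) *\<^sub>R \<epsilon>)"
  have z: "zpart G (t *\<^sub>R e) = t *\<^sub>R e" for t
    using zpart_unique[OF G subspace_scale[OF sub(1) eh] subspace_0[OF sub(2)]] by simp
  have line: "gmult G x (t *\<^sub>R e) = x + t *\<^sub>R u" for t
    using zpart_spart(3)[OF G, of x]
    by (simp add: gmult_def z spart_def u_def scaleR_right.sum algebra_simps)
  have D: "(f has_derivative frechet_derivative f (at x)) (at x)"
    using f by (simp add: frechet_derivative_works)
  then have lin: "linear (frechet_derivative f (at x))"
    by (rule has_derivative_linear)
  have Du: "frechet_derivative f (at x) u = Xfield G e f x"
    by (simp add: u_def Xfield_def linear_add[OF lin] linear_scale[OF lin] linear_sum[OF lin])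
  have "((\<lambda>t. x + t *\<^sub>R u) has_derivative (\<lambda>t. t *\<^sub>R u)) (at (0::real))"
    by (auto intro!: derivative_eq_intros)
  from diff_chain_at[OF this, of f "frechet_derivative f (at x)"] D
  have "((\<lambda>t. f (x + t *\<^sub>R u)) has_derivative (\<lambda>t. frechet_derivative f (at x) (t *\<^sub>R u))) (at 0)"
    by (simp add: o_def)
  then show ?thesis
    by (simp add: line has_field_derivative_def linear_scale[OF lin] Du mult.commute[of _ "Xfield G e f x"])
qed

end

(*
  With N4 = N^4 and V = |z|^2 z + 4 J(sigma) z, the J-identities give grad_H N4 = 4 V and
  |V|^2 = |z|^2 N4. Hence a function of N4 alone has an explicit horizontal gradient, and for the
  function f of the statement the powers of N4 cancel in the flux:
  |grad_H f|^(p-2) grad_H f = - |z|^(p-2) V / (Q + p). Its horizontal divergence is - |z|^p; since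
  the flux is singular on z = 0 for p < 2, the integration by parts is done with |z|^2 + delta in
  place of |z|^2, and then delta -> 0. That f is a limit of test functions follows by composing a
  shifted f with the smooth cut-off y exp(-eps/y).

  Uniqueness: testing the two equations with the difference of two solutions, strict monotonicity of
  a |-> |a|^(p-2) a makes their gradients agree, and a Poincare inequality makes the difference 0.
*)

theory Submission
  imports Defs
begin

section \<open>Calculus with \<open>Ck\<close> functions\<close>

text \<open>The constants come from two computations: the horizontal divergence of V is (Q + 2)
  |z|^2, and the inner product of V with z is |z|^4. Hence |z|^(p-2) V has divergence (Q + 2 + (p -
  2)) |z|^p, and a gradient - \<kappa> N4^(\<beta>-1) V with \<kappa>^(p-1) = 1 / (Q + p) has the
  required flux as soon as the exponents of N4 in that flux add up to 0; this forces \<beta> = p /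
  (2 (p - 1)). The obstacle is regularity: |z|^(p-2) is unbounded near z = 0 for p < 2, and
  N4^(\<beta>-1) is unbounded near the identity for p > 2. In both cases V supplies the missing
  powers, since |V| = |z| N4^(1/2), which is at most N4^(3/4). So gradient and flux are bounded on
  the ball. Bounded convergence then handles the approximations, and a bounded flux pairs
  continuously with Lp limits, so that the equation has to be checked only against smooth test
  functions.\<close>

lemma frechet_derivative_eq:
  "(f has_derivative D) (at x) \<Longrightarrow> frechet_derivative f (at x) = D"
  by (metis frechet_derivative_at)

lemma Ck_imp_continuous: "Ck n f \<Longrightarrow> continuous_on UNIV f"
  by (cases n) (auto intro!: differentiable_imp_continuous_on simp: differentiable_on_def)

lemma Ck_Suc_differentiable: "Ck (Suc n) f \<Longrightarrow> f differentiable (at x)"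
  by simp

lemma Ck_Suc_imp: "Ck (Suc n) f \<Longrightarrow> Ck n f"
proof (induction n arbitrary: f)
  case 0
  then show ?case using Ck_imp_continuous by (metis Ck.simps(1))
next
  case (Suc n)
  then show ?case by (metis Ck.simps(2))
qed

lemma Ck_const: "Ck n (\<lambda>x. c)"
  by (induction n arbitrary: c) (auto simp: frechet_derivative_const)

lemma Ck_linear:
  assumes "linear L"
  shows "Ck n L"
proof -
  have D: "(L has_derivative L) (at x)" for x
    using assms by (simp add: linear_imp_has_derivative)
  have "continuous_on UNIV L"
    using assms by (simp add: linear_continuous_on linear_conv_bounded_linear)
  then show ?thesis
    using D by (cases n) (auto simp: frechet_derivative_eq[OF D] Ck_const differentiable_def)
qed

lemma Ck_add:
  assumes "Ck n f" "Ck n g"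
  shows "Ck n (\<lambda>x. f x + g x)"
  using assms
proof (induction n arbitrary: f g)
  case 0
  then show ?case by (auto intro: continuous_on_add)
next
  case (Suc n)
  have "frechet_derivative (\<lambda>x. f x + g x) (at x) = 
     (\<lambda>h. frechet_derivative f (at x) h + frechet_derivative g (at x) h)" for x
    using Suc.prems
    by (intro frechet_derivative_eq has_derivative_add) (auto simp: frechet_derivative_works)
  then show ?case using Suc by auto
qed

lemma Ck_mult:
  assumes "Ck n f" "Ck n g"
  shows "Ck n (\<lambda>x. f x * g x)"
  using assms
proof (induction n arbitrary: f g)
  case 0
  then show ?case by (auto intro: continuous_on_mult)
next
  case (Suc n)
  have "frechet_derivative (\<lambda>x. f x * g x) (at x) = 
     (\<lambda>h. f x * frechet_derivative g (at x) h + frechet_derivative f (at x) h * g x)" for x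
    using Suc.prems
    by (intro frechet_derivative_eq has_derivative_mult) (auto simp: frechet_derivative_works)
  moreover have "Ck n f" "Ck n g" using Suc.prems Ck_Suc_imp by blast+
  ultimately show ?case using Suc by (auto intro!: Ck_add)
qed

lemma Ck_sum:
  assumes "\<And>i. i \<in> I \<Longrightarrow> Ck n (f i)"
  shows "Ck n (\<lambda>x. \<Sum>i\<in>I. f i x)"
  using assms
  by (induction I rule: infinite_finite_induct) (auto intro!: Ck_add Ck_const)

lemma Ck_cmult: "Ck n f \<Longrightarrow> Ck n (\<lambda>x. c * f x)"
  by (rule Ck_mult[OF Ck_const])

lemma Ck_diff:
  assumes "Ck n f" "Ck n g"
  shows "Ck n (\<lambda>x. f x - g x)"
  using Ck_add[OF assms(1) Ck_cmult[OF assms(2), of "-1"]] by simp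

text \<open>The outer function comes with the whole sequence of its derivatives, so that the
  induction can pass to the shifted sequence. The set \<open>S\<close> makes room for powers, which
  are smooth only on the positive half-line.\<close>

lemma Ck_compose:
  fixes H :: "nat \<Rightarrow> real \<Rightarrow> real"
  assumes "Ck n f" and S: "\<And>x. f x \<in> S"
    and "\<And>k s. k < n \<Longrightarrow> s \<in> S \<Longrightarrow> (H k has_real_derivative H (Suc k) s) (at s)"
    and "continuous_on S (H n)"
  shows "Ck n (\<lambda>x. H 0 (f x))"
  using assms(1,3,4)
proof (induction n arbitrary: H)
  case 0
  then show ?case using S by (auto intro!: continuous_on_compose2[of S "H 0"])
next
  case (Suc n)
  have D: "((\<lambda>x. H 0 (f x)) has_derivative 
     (\<lambda>h. frechet_derivative f (at x) h * H 1 (f x))) (at x)" for x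
    using Suc.prems(1) Suc.prems(2)[of 0 "f x"] S
    by (intro DERIV_compose_FDERIV) (auto simp: frechet_derivative_works)
  have "Ck n (\<lambda>x. H (Suc 0) (f x))"
    using Suc.prems Ck_Suc_imp by (intro Suc.IH[of "\<lambda>k. H (Suc k)"]) auto
  then show ?case
    using Suc.prems(1) D
    by (auto simp: frechet_derivative_eq[OF D] intro!: Ck_mult differentiableI[OF D])
qed

lemma Ck_powr:
  assumes "Ck n f" "\<And>x. 0 < f x"
  shows "Ck n (\<lambda>x. f x powr a)"
proof -
  define H where "H k s = (\<Prod>i<k. a - real i) * s powr (a - real k)" for k :: nat and s :: real
  have D: "(H k has_real_derivative H (Suc k) s) (at s)" if "0 < s" for k s
    unfolding H_def using that
    by (auto intro!: derivative_eq_intros simp: algebra_simps)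
  have "Ck n (\<lambda>x. H 0 (f x))"
  proof (rule Ck_compose[OF assms(1), of "{0<..}" H])
    show "continuous_on {0<..} (H n)"
      by (rule continuous_at_imp_continuous_on) (auto intro: DERIV_isCont D)
  qed (use assms(2) D in auto)
  then show ?thesis by (simp add: H_def)
qed

text \<open>The derivatives of \<open>exp (- 1 / t)\<close> are \<open>P (1 / t) exp (- 1 / t)\<close> with these polynomials \<open>P\<close>.\<close>

primrec flat_poly :: "nat \<Rightarrow> real poly" where
  "flat_poly 0 = 1"
| "flat_poly (Suc k) = [:0, 0, 1:] * (flat_poly k - pderiv (flat_poly k))"

definition flat :: "nat \<Rightarrow> real \<Rightarrow> real" where
  "flat k t = (if 0 < t then poly (flat_poly k) (1 / t) * exp (- (1 / t)) else 0)"

lemma poly_mult_exp_minus_tendsto_0: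
  fixes P :: "real poly"
  shows "((\<lambda>u. poly P u * exp (- u)) \<longlongrightarrow> 0) at_top"
proof -
  have "((\<lambda>u. \<Sum>i\<le>degree P. coeff P i * (u ^ i / exp u)) \<longlongrightarrow> (\<Sum>i\<le>degree P. coeff P i * 0)) at_top"
    by (intro tendsto_intros tendsto_power_div_exp_0)
  moreover have "(\<Sum>i\<le>degree P. coeff P i * (u ^ i / exp u)) = poly P u * exp (- u)" for u
    by (simp add: poly_altdef sum_distrib_right exp_minus divide_inverse mult.assoc)
  ultimately show ?thesis by simp
qed

lemma flat_has_real_derivative: "(flat k has_real_derivative flat (Suc k) t) (at t)"
proof -
  consider "0 < t" | "t < 0" | "t = 0" by linarith
  then show ?thesis
  proof cases
    case 1
    have "((\<lambda>t. poly (flat_poly k) (1 / t)) has_real_derivative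
        poly (pderiv (flat_poly k)) (1 / t) * (- 1 / t\<^sup>2)) (at t)"
      by (rule DERIV_chain2[OF poly_DERIV])
        (use 1 in \<open>auto intro!: derivative_eq_intros simp: power2_eq_square\<close>)
    moreover have "((\<lambda>t. exp (- (1 / t))) has_real_derivative exp (- (1 / t)) * (1 / t\<^sup>2)) (at t)"
      using 1 by (auto intro!: derivative_eq_intros simp: power2_eq_square)
    ultimately have "((\<lambda>t. poly (flat_poly k) (1 / t) * exp (- (1 / t))) has_real_derivative
        poly (pderiv (flat_poly k)) (1 / t) * (- 1 / t\<^sup>2) * exp (- (1 / t))
          + exp (- (1 / t)) * (1 / t\<^sup>2) * poly (flat_poly k) (1 / t)) (at t)"
      by (rule DERIV_mult)
    also have "poly (pderiv (flat_poly k)) (1 / t) * (- 1 / t\<^sup>2) * exp (- (1 / t))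
          + exp (- (1 / t)) * (1 / t\<^sup>2) * poly (flat_poly k) (1 / t) = flat (Suc k) t"
      using 1 by (simp add: flat_def power2_eq_square field_simps)
    finally have "((\<lambda>t. poly (flat_poly k) (1 / t) * exp (- (1 / t))) has_real_derivative flat (Suc k) t) (at t)" .
    then show ?thesis
      by (rule has_field_derivative_transform_within_open[where S = "{0<..}"])
        (use 1 in \<open>auto simp: flat_def\<close>)
  next
    case 2
    have "(flat k has_real_derivative 0) (at t)"
      by (rule has_field_derivative_transform_within_open[OF DERIV_const, where S = "{..<0}"])
        (use 2 in \<open>auto simp: flat_def\<close>)
    then show ?thesis using 2 by (simp add: flat_def)
  next
    case 3
    have "((\<lambda>h. flat k h / h) \<longlongrightarrow> 0) (at_right 0)"
    proof -
      \<comment> \<open>In the variable \<open>u = 1 / h\<close> the division by \<open>h\<close> is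
        one more factor \<open>u\<close>, so the difference quotient at 0 is again a polynomial
        times \<open>exp (- u)\<close>.\<close>
      have "((\<lambda>h. poly ([:0, 1:] * flat_poly k) (inverse h) * exp (- inverse h)) \<longlongrightarrow> 0) (at_right 0)"
        by (rule filterlim_compose[OF poly_mult_exp_minus_tendsto_0 filterlim_inverse_at_top_right])
      moreover have "\<forall>\<^sub>F h in at_right 0. poly ([:0, 1:] * flat_poly k) (inverse h) * exp (- inverse h) = flat k h / h"
        using eventually_at_right_less[of 0] by eventually_elim (simp add: flat_def field_simps)
      ultimately show ?thesis by (rule Lim_transform_eventually)
    qed
    moreover have "((\<lambda>h. flat k h / h) \<longlongrightarrow> 0) (at_left 0)"
    proof (rule Lim_transform_eventually[OF tendsto_const])
      show "\<forall>\<^sub>F h in at_left 0. 0 = flat k h / h"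
        unfolding eventually_at_filter by (intro always_eventually) (simp add: flat_def)
    qed
    ultimately have "((\<lambda>h. flat k h / h) \<longlongrightarrow> 0) (at 0)"
      by (simp add: filterlim_at_split)
    then show ?thesis using 3 by (simp add: has_field_derivative_iff flat_def)
  qed
qed

lemma Ck_flat: "Ck n f \<Longrightarrow> Ck n (\<lambda>x. flat 0 (f x))"
  by (rule Ck_compose[of n f UNIV flat])
    (auto intro: flat_has_real_derivative continuous_at_imp_continuous_on DERIV_isCont)

text \<open>
  For \<open>y > 0\<close> this is \<open>y exp (- \<epsilon> / y)\<close>. Composing it with the explicit solution gives test functions
  directly, so that no mollification is needed.
\<close>

definition smooth_pos :: "real \<Rightarrow> real \<Rightarrow> real" where
  "smooth_pos \<epsilon> y = y * flat 0 (y / \<epsilon>)"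

definition smooth_pos' :: "real \<Rightarrow> real \<Rightarrow> real" where
  "smooth_pos' \<epsilon> y = (if 0 < y then exp (- (\<epsilon> / y)) * (1 + \<epsilon> / y) else 0)"

lemma smooth_pos_has_real_derivative:
  assumes "0 < \<epsilon>"
  shows "(smooth_pos \<epsilon> has_real_derivative smooth_pos' \<epsilon> y) (at y)"
proof -
  have "((\<lambda>y. flat 0 (y / \<epsilon>)) has_real_derivative flat 1 (y / \<epsilon>) * (1 / \<epsilon>)) (at y)"
    using flat_has_real_derivative[of 0 "y / \<epsilon>"] assms
    by (intro DERIV_chain2[of "flat 0"]) (auto intro!: derivative_eq_intros)
  from DERIV_mult[OF DERIV_ident this]
  have "(smooth_pos \<epsilon> has_real_derivative 1 * flat 0 (y / \<epsilon>) + flat 1 (y / \<epsilon>) * (1 / \<epsilon>) * y) (at y)"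
    by (simp add: smooth_pos_def[abs_def])
  also have "1 * flat 0 (y / \<epsilon>) + flat 1 (y / \<epsilon>) * (1 / \<epsilon>) * y = smooth_pos' \<epsilon> y"
    using assms by (auto simp: flat_def smooth_pos'_def field_simps)
  finally show ?thesis .
qed

lemma Ck_smooth_pos: "Ck n f \<Longrightarrow> Ck n (\<lambda>x. smooth_pos \<epsilon> (f x))"
  unfolding smooth_pos_def using Ck_flat[OF Ck_cmult[of n f "1 / \<epsilon>"]] by (intro Ck_mult) auto

lemma smooth_pos_pos: "0 < \<epsilon> \<Longrightarrow> 0 < y \<Longrightarrow> smooth_pos \<epsilon> y = y * exp (- (\<epsilon> / y))"
  by (simp add: smooth_pos_def flat_def)

lemma smooth_pos_nonpos: "0 < \<epsilon> \<Longrightarrow> y \<le> 0 \<Longrightarrow> smooth_pos \<epsilon> y = 0"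
  by (simp add: smooth_pos_def flat_def zero_less_divide_iff)

lemma smooth_pos_bounds: "0 < \<epsilon> \<Longrightarrow> y \<le> b \<Longrightarrow> 0 \<le> b \<Longrightarrow> \<bar>smooth_pos \<epsilon> y\<bar> \<le> b"
proof (cases "0 < y")
  case True
  assume "0 < \<epsilon>" "y \<le> b"
  then have "y * exp (- (\<epsilon> / y)) \<le> y * 1" using True by (intro mult_left_mono) auto
  then have "y * exp (- (\<epsilon> / y)) \<le> b" using \<open>y \<le> b\<close> by simp
  then show ?thesis using True \<open>0 < \<epsilon>\<close> by (simp add: smooth_pos_pos)
qed (simp add: smooth_pos_nonpos)

text \<open>This is \<open>1 + t \<le> exp t\<close> with \<open>t = \<epsilon> / y\<close>. The
  bound does not depend on \<epsilon>, so it dominates the gradients of all approximants at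
  once.\<close>

lemma smooth_pos'_bounds: "0 < \<epsilon> \<Longrightarrow> \<bar>smooth_pos' \<epsilon> y\<bar> \<le> 1"
proof (cases "0 < y")
  case True
  assume "0 < \<epsilon>"
  then have "exp (- (\<epsilon> / y)) * (1 + \<epsilon> / y) \<le> exp (- (\<epsilon> / y)) * exp (\<epsilon> / y)"
    using True by (intro mult_left_mono) auto
  then show ?thesis using True \<open>0 < \<epsilon>\<close> by (simp add: smooth_pos'_def exp_minus add_pos_pos)
qed (simp add: smooth_pos'_def)

text \<open>The argument moves together with \<epsilon> because the shifted solution depends on
  \<epsilon> as well. A positive limit makes \<open>Y n\<close> eventually positive, where the
  closed formulas apply, and then \<open>\<epsilon> n / Y n\<close> tends to 0.\<close>

lemma smooth_pos_tendsto:
  assumes "\<And>n. 0 < \<epsilon> n" "\<epsilon> \<longlonglongrightarrow> 0" "Y \<longlonglongrightarrow> y" "0 < y"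
  shows "(\<lambda>n. smooth_pos (\<epsilon> n) (Y n)) \<longlonglongrightarrow> y" "(\<lambda>n. smooth_pos' (\<epsilon> n) (Y n)) \<longlonglongrightarrow> 1"
proof -
  have ev: "\<forall>\<^sub>F n in sequentially. 0 < Y n" using assms(3,4) by (rule order_tendstoD)
  have q: "(\<lambda>n. \<epsilon> n / Y n) \<longlonglongrightarrow> 0" using tendsto_divide[OF assms(2,3)] assms(4) by simp
  have "(\<lambda>n. Y n * exp (- (\<epsilon> n / Y n))) \<longlonglongrightarrow> y * exp (- 0)"
    by (intro tendsto_intros q assms(3))
  then have "(\<lambda>n. Y n * exp (- (\<epsilon> n / Y n))) \<longlonglongrightarrow> y" by simp
  moreover have "\<forall>\<^sub>F n in sequentially. Y n * exp (- (\<epsilon> n / Y n)) = smooth_pos (\<epsilon> n) (Y n)"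
    using ev by eventually_elim (simp add: smooth_pos_pos assms(1))
  ultimately show "(\<lambda>n. smooth_pos (\<epsilon> n) (Y n)) \<longlonglongrightarrow> y"
    by (rule Lim_transform_eventually)
  have "(\<lambda>n. exp (- (\<epsilon> n / Y n)) * (1 + \<epsilon> n / Y n)) \<longlonglongrightarrow> exp (- 0) * (1 + 0)"
    by (intro tendsto_intros q)
  then have "(\<lambda>n. exp (- (\<epsilon> n / Y n)) * (1 + \<epsilon> n / Y n)) \<longlonglongrightarrow> 1" by simp
  moreover have "\<forall>\<^sub>F n in sequentially. exp (- (\<epsilon> n / Y n)) * (1 + \<epsilon> n / Y n) = smooth_pos' (\<epsilon> n) (Y n)"
    using ev by eventually_elim (simp add: smooth_pos'_def)
  ultimately show "(\<lambda>n. smooth_pos' (\<epsilon> n) (Y n)) \<longlonglongrightarrow> 1"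
    by (rule Lim_transform_eventually)
qed

section \<open>Inequalities for powers and strict monotonicity of the p-flux\<close>

lemma powr_minus_1_mult:
  fixes t p :: real
  assumes "0 \<le> t"
  shows "t powr (p - 1) * t = t powr p"
  using assms powr_add[of t "p - 1" 1] by (cases "t = 0") auto

text \<open>At \<open>t = 0\<close> both sides are 0 for every exponent, since
  \<open>0 powr a = 0\<close>; this is what makes the flux vanish with the gradient even for
  \<open>p < 2\<close>.\<close>

lemma powr_minus_2_mult:
  fixes t p :: real
  assumes "0 \<le> t"
  shows "t powr (p - 2) * t = t powr (p - 1)" "t powr (p - 2) * t\<^sup>2 = t powr p"
  using assms powr_add[of t "p - 2" 1] powr_add[of t "p - 2" 2] by (cases "t = 0"; auto simp: powr_numeral)+

text \<open>According to whether \<open>b \<le> K * a\<close>, one of the two terms on the right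
  dominates alone. The weight \<open>K\<close> is kept free: it is tuned once to absorb a term and
  once to be arbitrarily small.\<close>

lemma young_powr:
  fixes a b K p :: real
  assumes "0 \<le> a" "0 \<le> b" "0 < K" "1 < p"
  shows "a powr (p - 1) * b \<le> K * a powr p + K powr (1 - p) * b powr p"
proof (cases "b \<le> K * a")
  case True
  then have "a powr (p - 1) * b \<le> a powr (p - 1) * (K * a)"
    by (intro mult_left_mono) auto
  also have "\<dots> = K * a powr p"
    using powr_minus_1_mult[of a p] assms by (simp add: mult.left_commute mult.commute)
  finally show ?thesis by (simp add: add_increasing2)
next
  case False
  then have "a \<le> b / K" using assms by (simp add: field_simps)
  then have "a powr (p - 1) * b \<le> (b / K) powr (p - 1) * b"
    using assms by (intro mult_right_mono powr_mono2) auto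
  also have "(b / K) powr (p - 1) = K powr (1 - p) * b powr (p - 1)"
    using assms by (simp add: powr_divide powr_diff)
  also have "\<dots> * b = K powr (1 - p) * b powr p"
    using powr_minus_1_mult[of b p] assms by simp
  finally show ?thesis using assms by (simp add: add_increasing)
qed

text \<open>Both norms are at most their maximum. The constant is crude, but it suffices for
  integrability and for convergence to 0.\<close>

lemma norm_diff_powr_le:
  fixes a b :: "'a::real_normed_vector"
  assumes "1 < p"
  shows "norm (a - b) powr p \<le> 2 powr p * (norm a powr p + norm b powr p)"
proof -
  define m where "m = max (norm a) (norm b)"
  have "norm (a - b) \<le> 2 * m"
    using norm_triangle_ineq4[of a b] by (auto simp: m_def)
  then have "norm (a - b) powr p \<le> (2 * m) powr p"
    using assms by (intro powr_mono2) auto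
  also have "\<dots> = 2 powr p * m powr p"
    by (intro powr_mult)
  also have "m powr p \<le> norm a powr p + norm b powr p"
    by (cases "norm a \<le> norm b") (auto simp: m_def max_def)
  finally show ?thesis by simp
qed

text \<open>By Cauchy-Schwarz the expression is at least its scalar counterpart
  \<open>(s powr (p - 1) - t powr (p - 1)) * (s - t)\<close> in the norms, which is positive unless
  \<open>s = t\<close>. For equal norms it is \<open>s powr (p - 2)\<close> times the squared
  distance of the vectors, so it vanishes only for equal vectors.\<close>

lemma powr_monotone_vector:
  fixes a b :: "'a::real_inner"
  assumes "1 < p"
  shows "0 \<le> (norm a powr (p - 2) *\<^sub>R a - norm b powr (p - 2) *\<^sub>R b) \<bullet> (a - b)" (is "0 \<le> ?m")
    and "(norm a powr (p - 2) *\<^sub>R a - norm b powr (p - 2) *\<^sub>R b) \<bullet> (a - b) = 0 \<Longrightarrow> a = b"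
proof -
  define s t where "s = norm a" and "t = norm b"
  have st: "0 \<le> s" "0 \<le> t" by (auto simp: s_def t_def)
  have m: "?m = s powr p + t powr p - (s powr (p - 2) + t powr (p - 2)) * (a \<bullet> b)"
  proof -
    have "?m = s powr (p - 2) * (a \<bullet> a) + t powr (p - 2) * (b \<bullet> b) 
        - (s powr (p - 2) + t powr (p - 2)) * (a \<bullet> b)"
      by (simp add: inner_diff_left inner_diff_right s_def t_def inner_commute algebra_simps)
    then show ?thesis
      using powr_minus_2_mult(2)[OF st(1), of p] powr_minus_2_mult(2)[OF st(2), of p]
      by (simp add: s_def t_def power2_norm_eq_inner)
  qed
  define M where "M = (s powr (p - 1) - t powr (p - 1)) * (s - t)"
  have Mst: "s powr p + t powr p - (s powr (p - 2) + t powr (p - 2)) * (s * t) = M"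
  proof -
    have "s powr (p - 2) * (s * t) = s powr (p - 1) * t" "t powr (p - 2) * (s * t) = t powr (p - 1) * s"
      using powr_minus_2_mult(1)[OF st(1), of p] powr_minus_2_mult(1)[OF st(2), of p]
      by (metis mult.assoc mult.commute)+
    moreover have "(s powr (p - 2) + t powr (p - 2)) * (s * t) 
        = s powr (p - 2) * (s * t) + t powr (p - 2) * (s * t)"
      by (rule distrib_right)
    ultimately show ?thesis
      using powr_minus_1_mult[OF st(1), of p] powr_minus_1_mult[OF st(2), of p]
      unfolding M_def by (simp only: left_diff_distrib right_diff_distrib)
  qed
  have "a \<bullet> b \<le> s * t" by (simp add: s_def t_def norm_cauchy_schwarz)
  then have "(s powr (p - 2) + t powr (p - 2)) * (a \<bullet> b) \<le> (s powr (p - 2) + t powr (p - 2)) * (s * t)"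
    by (intro mult_left_mono) auto
  then have mM: "M \<le> ?m" using m Mst by linarith
  have M0: "0 < M" if "s \<noteq> t"
  proof (cases "s < t")
    case True
    then have "s powr (p - 1) < t powr (p - 1)" using assms st by (intro powr_less_mono2) auto
    then show ?thesis using True by (simp add: M_def mult_neg_neg)
  next
    case False
    then have "t < s" using that by simp
    then have "t powr (p - 1) < s powr (p - 1)" using assms st by (intro powr_less_mono2) auto
    then show ?thesis using \<open>t < s\<close> by (simp add: M_def)
  qed
  have "0 \<le> M" using M0 by (cases "s = t") (auto simp: M_def less_imp_le)
  then show "0 \<le> ?m" using mM by simp
  assume 0: "?m = 0"
  then have eq: "s = t" using M0 mM by fastforce
  show "a = b"
  proof (cases "s = 0")
    case True
    then show ?thesis using eq by (simp add: s_def t_def)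
  next
    case False
    have "?m = s powr (p - 2) * ((a - b) \<bullet> (a - b))"
      using eq by (simp add: s_def t_def scaleR_diff_right[symmetric])
    then show ?thesis using 0 False by simp
  qed
qed

text \<open>At 0 the difference quotient has absolute value
  \<open>\<bar>h\<bar> powr (p - 1)\<close>, which tends to 0 because \<open>1 < p\<close>.\<close>

lemma abs_powr_has_real_derivative:
  fixes p t :: real
  assumes "1 < p"
  shows "((\<lambda>t. \<bar>t\<bar> powr p) has_real_derivative p * \<bar>t\<bar> powr (p - 1) * sgn t) (at t)"
proof -
  consider "0 < t" | "t < 0" | "t = 0" by linarith
  then show ?thesis
  proof cases
    case 1
    have "((\<lambda>t. t powr p) has_real_derivative p * t powr (p - 1)) (at t)"
      using 1 by (rule has_real_derivative_powr)
    then have "((\<lambda>t. \<bar>t\<bar> powr p) has_real_derivative p * t powr (p - 1)) (at t)"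
      by (rule has_field_derivative_transform_within_open[where S = "{0<..}"]) (use 1 in auto)
    then show ?thesis using 1 by simp
  next
    case 2
    have "((\<lambda>t. (- t) powr p) has_real_derivative p * (- t) powr (p - 1) * (- 1)) (at t)"
      using 2 by (auto intro!: derivative_eq_intros simp: powr_diff field_simps)
    then have "((\<lambda>t. \<bar>t\<bar> powr p) has_real_derivative p * (- t) powr (p - 1) * (- 1)) (at t)"
      by (rule has_field_derivative_transform_within_open[where S = "{..<0}"]) (use 2 in auto)
    then show ?thesis using 2 by simp
  next
    case 3
    have "((\<lambda>h::real. \<bar>h\<bar> powr (p - 1)) \<longlongrightarrow> 0 powr (p - 1)) (at 0)"
      by (rule tendsto_powr'[OF _ tendsto_const])
        (use assms in \<open>auto intro!: tendsto_rabs_zero\<close>)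
    then have "((\<lambda>h::real. \<bar>h\<bar> powr (p - 1)) \<longlongrightarrow> 0) (at 0)" by simp
    then have "((\<lambda>h::real. \<bar>h\<bar> powr p / h) \<longlongrightarrow> 0) (at 0)"
    proof (rule Lim_null_comparison[rotated])
      have "norm (\<bar>h\<bar> powr p / h) \<le> \<bar>h\<bar> powr (p - 1)" for h :: real
        using powr_minus_1_mult[of "\<bar>h\<bar>" p, symmetric] by (cases "h = 0") (auto simp: abs_mult)
      then show "\<forall>\<^sub>F h in at 0. norm (\<bar>h\<bar> powr p / h) \<le> \<bar>h\<bar> powr (p - 1)" by simp
    qed
    then show ?thesis using 3 by (simp add: has_field_derivative_iff)
  qed
qed

text \<open>For \<open>p < 2\<close> the function \<open>\<bar>t\<bar> powr p\<close> has no second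
  derivative at 0. The Poincare inequality differentiates such powers, which is why the integration
  by parts is stated for \<open>Ck (Suc 0)\<close>.\<close>

lemma Ck_1_abs_powr:
  assumes "1 < p" "Ck (Suc 0) f"
  shows "Ck (Suc 0) (\<lambda>x. \<bar>f x\<bar> powr p)"
proof -
  define H where "H k = (if k = 0 then (\<lambda>t::real. \<bar>t\<bar> powr p) else (\<lambda>t. p * \<bar>t\<bar> powr (p - 1) * sgn t))"
    for k :: nat
  have "isCont (\<lambda>t::real. p * \<bar>t\<bar> powr (p - 1) * sgn t) t" for t
  proof (cases "t = 0")
    case True
    have "((\<lambda>h::real. p * \<bar>h\<bar> powr (p - 1)) \<longlongrightarrow> p * 0 powr (p - 1)) (at 0)"
      by (intro tendsto_mult tendsto_const tendsto_powr'[OF _ tendsto_const])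
        (use assms in \<open>auto intro!: tendsto_rabs_zero\<close>)
    then have "((\<lambda>h::real. p * \<bar>h\<bar> powr (p - 1)) \<longlongrightarrow> 0) (at 0)" by simp
    then have "((\<lambda>h::real. p * \<bar>h\<bar> powr (p - 1) * sgn h) \<longlongrightarrow> 0) (at 0)"
      by (rule Lim_null_comparison[rotated]) (use assms in \<open>auto simp: abs_mult sgn_if\<close>)
    then show ?thesis using True by (simp add: isCont_def)
  next
    case False
    then show ?thesis by (intro continuous_intros) auto
  qed
  then have "continuous_on UNIV (H (Suc 0))"
    by (simp add: H_def continuous_at_imp_continuous_on)
  moreover have "(H k has_real_derivative H (Suc k) s) (at s)" if "k < Suc 0" for k s
    using that abs_powr_has_real_derivative[OF assms(1)] by (simp add: H_def)
  ultimately have "Ck (Suc 0) (\<lambda>x. H 0 (f x))"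
    by (intro Ck_compose[OF assms(2), of UNIV H]) auto
  then show ?thesis by (simp add: H_def)
qed

text \<open>\<open>Ck\<close> controls only the directions in \<open>Basis\<close>, whereas the
  orthonormal bases of the two layers may consist of other vectors; linearity in the direction
  bridges the gap.\<close>

lemma Ck_1_continuous_frechet_derivative:
  assumes "Ck (Suc 0) F"
  shows "continuous_on UNIV (\<lambda>x. frechet_derivative F (at x) b)"
proof -
  have "frechet_derivative F (at x) b = (\<Sum>i\<in>Basis. (b \<bullet> i) * frechet_derivative F (at x) i)" for x
  proof -
    have lin: "linear (frechet_derivative F (at x))"
      using assms by (simp add: linear_frechet_derivative)
    have "frechet_derivative F (at x) (\<Sum>i\<in>Basis. (b \<bullet> i) *\<^sub>R i) = 
       (\<Sum>i\<in>Basis. (b \<bullet> i) * frechet_derivative F (at x) i)"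
      by (simp add: linear_sum[OF lin] linear_scale[OF lin])
    then show ?thesis by (simp only: euclidean_representation)
  qed
  moreover have "continuous_on UNIV (\<lambda>x. \<Sum>i\<in>Basis. (b \<bullet> i) * frechet_derivative F (at x) i)"
    using assms by (intro continuous_on_sum continuous_on_mult continuous_on_const) simp
  ultimately show ?thesis by presburger
qed

section \<open>Compactly supported functions and the vanishing integrals of their
  derivatives\<close>

lemma frechet_derivative_outside_support:
  assumes "x \<notin> closure {x. F x \<noteq> 0}"
  shows "frechet_derivative F (at x) = (\<lambda>h. 0)"
proof (rule frechet_derivative_eq)
  show "(F has_derivative (\<lambda>h. 0)) (at x)"
  proof (rule has_derivative_transform_within_open[OF has_derivative_const])
    show "open (- closure {x. F x \<noteq> 0})" by (simp add: open_Compl)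
    show "x \<in> - closure {x. F x \<noteq> 0}" using assms by simp
    show "\<And>y. y \<in> - closure {x. F x \<noteq> 0} \<Longrightarrow> 0 = F y"
      using subsetD[OF closure_subset, of _ "{x. F x \<noteq> 0}"] by auto
  qed
qed

lemma continuous_compact_support_bounded:
  fixes F :: "'a::topological_space \<Rightarrow> 'b::real_normed_vector"
  assumes "continuous_on UNIV F" "compact K" "\<And>x. x \<notin> K \<Longrightarrow> F x = 0"
  obtains M where "0 < M" "\<And>x. norm (F x) \<le> M"
proof -
  have "bounded (F ` K)"
    by (intro compact_imp_bounded compact_continuous_image)
       (use assms continuous_on_subset in blast)+
  then obtain M where "\<And>x. x \<in> K \<Longrightarrow> norm (F x) \<le> M" by (auto simp: bounded_iff)
  then have "norm (F x) \<le> \<bar>M\<bar> + 1" for x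
    using assms(3)[of x] by (cases "x \<in> K") (force, simp)
  then show thesis by (intro that[of "\<bar>M\<bar> + 1"]) auto
qed

lemma continuous_compact_support_integrable:
  fixes F :: "'a::euclidean_space \<Rightarrow> 'b::{banach, second_countable_topology}"
  assumes "continuous_on UNIV F" "compact K" "\<And>x. x \<notin> K \<Longrightarrow> F x = 0"
  shows "integrable lborel F"
proof -
  have "integrable lborel (\<lambda>x. indicator K x *\<^sub>R F x)"
    using assms by (intro borel_integrable_compact) (auto intro: continuous_on_subset)
  moreover have "(\<lambda>x. indicator K x *\<^sub>R F x) = F"
    using assms(3) by (auto simp: indicator_def fun_eq_iff)
  ultimately show ?thesis by simp
qed

text \<open>The difference quotients along \<open>b\<close> have integral 0 by translation invariance.\<close>

lemma integral_frechet_derivative_eq_0: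
  assumes F: "Ck (Suc 0) F" and K: "compact (closure {x. F x \<noteq> 0})"
  shows "integrable lborel (\<lambda>x. frechet_derivative F (at x) b)"
    and "(\<integral>x. frechet_derivative F (at x) b \<partial>lborel) = 0"
proof -
  define K where "K = closure {x. F x \<noteq> 0}"
  define D where "D = (\<lambda>x. frechet_derivative F (at x) b)"
  have cD: "continuous_on UNIV D"
    unfolding D_def by (rule Ck_1_continuous_frechet_derivative[OF F])
  have D0: "D x = 0" if "x \<notin> K" for x
    using frechet_derivative_outside_support[of x F] that by (simp add: D_def K_def)
  have cK: "compact K" using K by (simp add: K_def)
  show "integrable lborel (\<lambda>x. frechet_derivative F (at x) b)"
    using continuous_compact_support_integrable[OF cD cK D0] by (simp add: D_def)
  obtain M where M: "0 < M" "\<And>x. norm (D x) \<le> M"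
    using continuous_compact_support_bounded[OF cD cK D0] by blast
  obtain r where r: "K \<subseteq> cball 0 r"
    using compact_imp_bounded[OF cK] by (force simp: bounded_iff)
  have cF: "continuous_on UNIV F" by (rule Ck_imp_continuous[OF F])
  have F0: "F x = 0" if "x \<notin> K" for x
    using that closure_subset[of "{x. F x \<noteq> 0}"] by (auto simp: K_def)
  have intF: "integrable lborel F"
    by (rule continuous_compact_support_integrable[OF cF cK F0])
  have mF[measurable]: "F \<in> borel_measurable borel"
    by (rule borel_measurable_continuous_onI[OF cF])
  have dl: "((\<lambda>t. F (x + t *\<^sub>R b)) has_real_derivative D (x + t *\<^sub>R b)) (at t)" for x t
  proof -
    have "(F has_derivative frechet_derivative F (at (x + t *\<^sub>R b))) (at (x + t *\<^sub>R b))"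
      using F by (simp add: frechet_derivative_works[symmetric])
    moreover have "((\<lambda>t. x + t *\<^sub>R b) has_derivative (\<lambda>h. h *\<^sub>R b)) (at t)"
      by (auto intro!: derivative_eq_intros)
    ultimately have "((\<lambda>t. F (x + t *\<^sub>R b)) has_derivative
        (\<lambda>h. frechet_derivative F (at (x + t *\<^sub>R b)) (h *\<^sub>R b))) (at t)"
      using diff_chain_at[of "\<lambda>t. x + t *\<^sub>R b" "\<lambda>h. h *\<^sub>R b" t F] by (simp add: o_def)
    moreover have "linear (frechet_derivative F (at (x + t *\<^sub>R b)))"
      using F by (simp add: linear_frechet_derivative)
    ultimately show ?thesis
      by (simp add: has_field_derivative_def linear_scale D_def mult.commute[of _ "frechet_derivative F _ b"])
  qed
  define s where "s = (\<lambda>n x. (F (x + (1 / real (Suc n)) *\<^sub>R b) - F x) * real (Suc n))"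
  have lim: "(\<lambda>n. s n x) \<longlonglongrightarrow> D x" for x
  proof -
    have "((\<lambda>t. (F (x + t *\<^sub>R b) - F x) / t) \<longlongrightarrow> D x) (at 0)"
      using dl[of x 0] by (simp add: has_field_derivative_iff)
    moreover have "filterlim (\<lambda>n. 1 / real (Suc n)) (at 0) sequentially"
      unfolding filterlim_at using LIMSEQ_Suc[OF lim_1_over_n] by auto
    ultimately have "(\<lambda>n. (F (x + (1 / real (Suc n)) *\<^sub>R b) - F x) / (1 / real (Suc n))) \<longlonglongrightarrow> D x"
      by (rule filterlim_compose)
    then show ?thesis by (simp add: s_def)
  qed
  \<comment> \<open>By the mean value theorem each quotient is a value of \<open>D\<close> at a
    point within \<open>norm b\<close> of \<open>x\<close>. So all quotients vanish outside this
    enlarged ball, and a constant on it is an integrable majorant.\<close>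
  define B where "B = cball (0::'a) (r + norm b)"
  have bound: "norm (s n x) \<le> M * indicator B x" for n x
  proof -
    define t where "t = 1 / real (Suc n)"
    have t: "0 < t" "t \<le> 1" by (auto simp: t_def)
    obtain \<xi> where xi: "0 < \<xi>" "\<xi> < t" "F (x + t *\<^sub>R b) - F (x + 0 *\<^sub>R b) = (t - 0) * D (x + \<xi> *\<^sub>R b)"
      using MVT2[OF t(1), of "\<lambda>t. F (x + t *\<^sub>R b)" "\<lambda>t. D (x + t *\<^sub>R b)"] dl by blast
    have "s n x = D (x + \<xi> *\<^sub>R b)"
      using xi(3) t by (simp add: s_def t_def)
    moreover have "D (x + \<xi> *\<^sub>R b) = 0" if "x \<notin> B"
    proof (rule D0, rule notI)
      assume "x + \<xi> *\<^sub>R b \<in> K"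
      then have "norm (x + \<xi> *\<^sub>R b) \<le> r" using r by auto
      moreover have "norm x \<le> norm (x + \<xi> *\<^sub>R b) + norm (\<xi> *\<^sub>R b)"
        by (metis add_diff_cancel_right' norm_triangle_ineq4)
      moreover have "norm (\<xi> *\<^sub>R b) \<le> norm b" using xi t by (simp add: mult_left_le_one_le)
      ultimately show False using that by (auto simp: B_def)
    qed
    ultimately show ?thesis using M by (auto simp: indicator_def)
  qed
  have ints: "(\<integral>x. s n x \<partial>lborel) = 0" for n
  proof -
    define h where "h = (1 / real (Suc n)) *\<^sub>R b"
    have d: "distr lborel borel ((+) h) = lborel" by (rule lborel_distr_plus)
    have "integrable (distr lborel borel ((+) h)) F" using intF d by simp
    then have i: "integrable lborel (\<lambda>x. F (h + x))"
      by (subst (asm) integrable_distr_eq) auto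
    have "(\<integral>x. F x \<partial>lborel) = (\<integral>x. F x \<partial>distr lborel borel ((+) h))" using d by simp
    also have "\<dots> = (\<integral>x. F (h + x) \<partial>lborel)" by (rule integral_distr) auto
    finally have "(\<integral>x. F (h + x) - F x \<partial>lborel) = 0" using i intF by simp
    then show ?thesis unfolding s_def h_def[symmetric] by (simp add: add.commute)
  qed
  have "(\<lambda>n. \<integral>x. s n x \<partial>lborel) \<longlonglongrightarrow> (\<integral>x. D x \<partial>lborel)"
  proof (rule integral_dominated_convergence[where w = "\<lambda>x. M * indicator B x"])
    show "D \<in> borel_measurable lborel"
      using borel_measurable_continuous_onI[OF cD] by simp
    show "s n \<in> borel_measurable lborel" for n unfolding s_def by simp
    show "integrable lborel (\<lambda>x. M * indicator B x)"
      by (auto simp: B_def intro!: integrable_mult_right emeasure_lborel_cball_finite)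
  qed (use lim bound in auto)
  then show "(\<integral>x. frechet_derivative F (at x) b \<partial>lborel) = 0"
    by (simp add: ints LIMSEQ_const_iff D_def)
qed

text \<open>Extension by zero connects the weak formulation, which uses \<open>lebesgue_on\<close>,
  with translation invariance and integration by parts, which are carried out on the whole space in
  \<open>lborel\<close>.\<close>

lemma integral_lebesgue_on_eq_lborel:
  fixes F :: "'a::euclidean_space \<Rightarrow> real"
  assumes "F \<in> borel_measurable borel" "\<Omega> \<in> sets borel" "\<And>x. x \<notin> \<Omega> \<Longrightarrow> F x = 0"
  shows "(\<integral>x. F x \<partial>lebesgue_on \<Omega>) = (\<integral>x. F x \<partial>lborel)"
proof -
  have "(\<integral>x. F x \<partial>lebesgue_on \<Omega>) = (\<integral>x. indicator \<Omega> x *\<^sub>R F x \<partial>lebesgue)"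
    using assms by (intro integral_restrict_space) auto
  also have "(\<lambda>x. indicator \<Omega> x *\<^sub>R F x) = F"
    using assms(3) by (auto simp: indicator_def fun_eq_iff)
  also have "(\<integral>x. F x \<partial>lebesgue) = (\<integral>x. F x \<partial>lborel)"
    using assms by (intro integral_completion) auto
  finally show ?thesis .
qed

section \<open>The spaces \<open>Lp\<close> on sets of finite measure\<close>

lemma borel_measurable_lebesgue_on:
  fixes u :: "'g::euclidean_space \<Rightarrow> 'b::euclidean_space"
  shows "u \<in> borel_measurable borel \<Longrightarrow> u \<in> borel_measurable (lebesgue_on \<Omega>)"
  by (intro measurable_restrict_space1 measurable_completion) simp

lemma bounded_convergence_lebesgue_on:
  fixes v :: "nat \<Rightarrow> 'g::euclidean_space \<Rightarrow> real"
  assumes "\<Omega> \<in> lmeasurable" and v: "\<And>n. v n \<in> borel_measurable (lebesgue_on \<Omega>)"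
    and u: "u \<in> borel_measurable (lebesgue_on \<Omega>)"
    and "\<And>n x. x \<in> \<Omega> \<Longrightarrow> \<bar>v n x\<bar> \<le> M" and "\<And>x. x \<in> \<Omega> \<Longrightarrow> (\<lambda>n. v n x) \<longlonglongrightarrow> u x"
  shows "(\<lambda>n. \<integral>x. v n x \<partial>lebesgue_on \<Omega>) \<longlonglongrightarrow> (\<integral>x. u x \<partial>lebesgue_on \<Omega>)"
proof -
  interpret finite_measure "lebesgue_on \<Omega>" by (rule finite_measure_lebesgue_on) fact
  show ?thesis
    by (rule integral_dominated_convergence[where w = "\<lambda>x. M"])
      (use assms in \<open>auto intro!: AE_I2\<close>)
qed

text \<open>Without the outer root this is a plain integral, open to monotonicity and dominated
  convergence; for positive exponents it tends to 0 exactly when \<open>Lp_norm\<close>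
  does.\<close>

definition Lp_pow :: "real \<Rightarrow> 'g::euclidean_space set \<Rightarrow> ('g \<Rightarrow> 'b::euclidean_space) \<Rightarrow> real" where
  "Lp_pow p \<Omega> u = (\<integral>x. norm (u x) powr p \<partial>lebesgue_on \<Omega>)"

lemma Lp_pow_nonneg: "0 \<le> Lp_pow p \<Omega> u"
  by (simp add: Lp_pow_def)

lemma Lp_norm_nonneg: "0 \<le> Lp_norm p \<Omega> u"
  by (simp add: Lp_norm_def)

lemma Lp_norm_tendsto_0_iff:
  assumes "0 < p"
  shows "(\<lambda>n. Lp_norm p \<Omega> (u n)) \<longlonglongrightarrow> 0 \<longleftrightarrow> (\<lambda>n. Lp_pow p \<Omega> (u n)) \<longlonglongrightarrow> 0"
proof
  assume "(\<lambda>n. Lp_norm p \<Omega> (u n)) \<longlonglongrightarrow> 0"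
  then have "(\<lambda>n. Lp_norm p \<Omega> (u n) powr p) \<longlonglongrightarrow> 0 powr p"
    by (rule tendsto_powr'[OF _ tendsto_const]) (use assms in \<open>simp add: Lp_norm_nonneg\<close>)
  moreover have "Lp_norm p \<Omega> (u n) powr p = Lp_pow p \<Omega> (u n)" for n
    using assms Lp_pow_nonneg[of p \<Omega> "u n"] by (simp add: Lp_norm_def Lp_pow_def powr_powr)
  ultimately show "(\<lambda>n. Lp_pow p \<Omega> (u n)) \<longlonglongrightarrow> 0" by simp
next
  assume "(\<lambda>n. Lp_pow p \<Omega> (u n)) \<longlonglongrightarrow> 0"
  then have "(\<lambda>n. Lp_pow p \<Omega> (u n) powr (1/p)) \<longlonglongrightarrow> 0 powr (1/p)"
    by (rule tendsto_powr'[OF _ tendsto_const]) (use assms in \<open>simp add: Lp_pow_nonneg\<close>)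
  then show "(\<lambda>n. Lp_norm p \<Omega> (u n)) \<longlonglongrightarrow> 0"
    by (simp add: Lp_norm_def Lp_pow_def)
qed

lemma Lp_diff:
  fixes u v :: "'g::euclidean_space \<Rightarrow> 'b::euclidean_space"
  assumes "1 < p" "u \<in> Lp p \<Omega>" "v \<in> Lp p \<Omega>"
  shows "(\<lambda>x. u x - v x) \<in> Lp p \<Omega>"
    and "Lp_pow p \<Omega> (\<lambda>x. u x - v x) \<le> 2 powr p * (Lp_pow p \<Omega> u + Lp_pow p \<Omega> v)"
proof -
  have u: "u \<in> borel_measurable (lebesgue_on \<Omega>)" "integrable (lebesgue_on \<Omega>) (\<lambda>x. norm (u x) powr p)"
    and v: "v \<in> borel_measurable (lebesgue_on \<Omega>)" "integrable (lebesgue_on \<Omega>) (\<lambda>x. norm (v x) powr p)"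
    using assms by (auto simp: Lp_def)
  note [measurable] = u(1) v(1)
  have i: "integrable (lebesgue_on \<Omega>) (\<lambda>x. 2 powr p * (norm (u x) powr p + norm (v x) powr p))"
    using u v by simp
  have j: "integrable (lebesgue_on \<Omega>) (\<lambda>x. norm (u x - v x) powr p)"
    by (rule Bochner_Integration.integrable_bound[OF i]) (auto intro!: norm_diff_powr_le assms)
  show "(\<lambda>x. u x - v x) \<in> Lp p \<Omega>" using j by (auto simp: Lp_def)
  have "Lp_pow p \<Omega> (\<lambda>x. u x - v x) \<le> (\<integral>x. 2 powr p * (norm (u x) powr p + norm (v x) powr p) \<partial>lebesgue_on \<Omega>)"
    unfolding Lp_pow_def by (intro integral_mono i j norm_diff_powr_le assms)
  also have "\<dots> = 2 powr p * (Lp_pow p \<Omega> u + Lp_pow p \<Omega> v)"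
    using u v by (simp add: Lp_pow_def)
  finally show "Lp_pow p \<Omega> (\<lambda>x. u x - v x) \<le> 2 powr p * (Lp_pow p \<Omega> u + Lp_pow p \<Omega> v)" .
qed

lemma integrable_bounded_lebesgue_on:
  fixes u :: "'g::euclidean_space \<Rightarrow> 'b::{banach, second_countable_topology}"
  assumes "\<Omega> \<in> lmeasurable" "u \<in> borel_measurable (lebesgue_on \<Omega>)" "\<And>x. x \<in> \<Omega> \<Longrightarrow> norm (u x) \<le> M"
  shows "integrable (lebesgue_on \<Omega>) u"
proof -
  interpret finite_measure "lebesgue_on \<Omega>" by (rule finite_measure_lebesgue_on) fact
  show ?thesis
    using assms by (intro integrable_const_bound[where B = M] AE_I2) auto
qed

lemma Lp_bounded:
  assumes "\<Omega> \<in> lmeasurable" "u \<in> borel_measurable (lebesgue_on \<Omega>)" "\<And>x. x \<in> \<Omega> \<Longrightarrow> norm (u x) \<le> M" "0 < p"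
  shows "u \<in> Lp p \<Omega>"
proof -
  note [measurable] = assms(2)
  have "integrable (lebesgue_on \<Omega>) (\<lambda>x. norm (u x) powr p)"
    using assms by (intro integrable_bounded_lebesgue_on[where M = "M powr p"]) (auto intro!: powr_mono2)
  then show ?thesis by (simp add: Lp_def)
qed

lemma Lp_integrable:
  assumes "\<Omega> \<in> lmeasurable" "u \<in> Lp p \<Omega>" "1 < p"
  shows "integrable (lebesgue_on \<Omega>) u"
proof -
  interpret finite_measure "lebesgue_on \<Omega>" by (rule finite_measure_lebesgue_on) fact
  have "integrable (lebesgue_on \<Omega>) (\<lambda>x. 1 + norm (u x) powr p)"
    using assms by (auto simp: Lp_def)
  then show ?thesis
  proof (rule Bochner_Integration.integrable_bound)
    \<comment> \<open>Young's inequality with \<open>a = K = 1\<close> reads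
      \<open>b \<le> 1 + b powr p\<close>.\<close>
    show "AE x in lebesgue_on \<Omega>. norm (u x) \<le> norm (1 + norm (u x) powr p)"
      using young_powr[of 1 _ 1 p] assms(3) by (auto intro!: AE_I2)
  qed (use assms in \<open>auto simp: Lp_def\<close>)
qed

lemma Lp_pow_bounded_convergence:
  fixes u :: "'g::euclidean_space \<Rightarrow> 'b::euclidean_space"
  assumes "\<Omega> \<in> lmeasurable" "0 < p" 
    and v: "\<And>n. v n \<in> borel_measurable (lebesgue_on \<Omega>)" and u: "u \<in> borel_measurable (lebesgue_on \<Omega>)"
    and "\<And>n x. x \<in> \<Omega> \<Longrightarrow> norm (v n x) \<le> M"
    and lim: "\<And>x. x \<in> \<Omega> \<Longrightarrow> (\<lambda>n. v n x) \<longlonglongrightarrow> u x"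
  shows "(\<lambda>n. Lp_pow p \<Omega> (\<lambda>x. v n x - u x)) \<longlonglongrightarrow> 0"
proof -
  interpret finite_measure "lebesgue_on \<Omega>" by (rule finite_measure_lebesgue_on) fact
  note [measurable] = v u
  have uM: "norm (u x) \<le> M" if "x \<in> \<Omega>" for x
    using LIMSEQ_le_const2[OF tendsto_norm[OF lim[OF that]]] assms(5)[OF that] by blast
  have "(\<lambda>n. \<integral>x. norm (v n x - u x) powr p \<partial>lebesgue_on \<Omega>) \<longlonglongrightarrow> (\<integral>x. 0 \<partial>lebesgue_on \<Omega>)"
  proof (rule integral_dominated_convergence[where w = "\<lambda>x. (2 * M) powr p"])
    show "AE x in lebesgue_on \<Omega>. (\<lambda>n. norm (v n x - u x) powr p) \<longlonglongrightarrow> 0"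
    proof (rule AE_I2)
      fix x assume "x \<in> space (lebesgue_on \<Omega>)"
      then have "(\<lambda>n. norm (v n x - u x)) \<longlonglongrightarrow> 0"
        using lim[of x] by (auto intro!: tendsto_norm_zero simp: LIM_zero_iff)
      then have "(\<lambda>n. norm (v n x - u x) powr p) \<longlonglongrightarrow> 0 powr p"
        by (rule tendsto_powr'[OF _ tendsto_const]) (use assms(2) in auto)
      then show "(\<lambda>n. norm (v n x - u x) powr p) \<longlonglongrightarrow> 0" by simp
    qed
    show "AE x in lebesgue_on \<Omega>. norm (norm (v n x - u x) powr p) \<le> (2 * M) powr p" for n
    proof (rule AE_I2)
      fix x assume "x \<in> space (lebesgue_on \<Omega>)"
      then have "norm (v n x - u x) \<le> 2 * M"
        using norm_triangle_ineq4[of "v n x" "u x"] uM[of x] assms(5)[of x n] by auto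
      then show "norm (norm (v n x - u x) powr p) \<le> (2 * M) powr p"
        using assms(2) by (auto intro!: powr_mono2)
    qed
  qed auto
  then show ?thesis by (simp add: Lp_pow_def)
qed

text \<open>Young's inequality gives \<open>norm w \<le> K + K powr (1 - p) * norm w powr p\<close>
  for the error \<open>w\<close>. Integrated over a set of finite measure, the first term is small
  for small \<open>K\<close>, and for this fixed \<open>K\<close> the second one tends to 0. This is
  the device that carries integral identities from test functions to their limits.\<close>

lemma Lp_tendsto_integral_inner:
  fixes u :: "'g::euclidean_space \<Rightarrow> 'b::euclidean_space"
  assumes O: "\<Omega> \<in> lmeasurable" and p: "1 < p"
    and a: "a \<in> borel_measurable (lebesgue_on \<Omega>)" "\<And>x. x \<in> \<Omega> \<Longrightarrow> norm (a x) \<le> A"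
    and v: "\<And>n. v n \<in> Lp p \<Omega>" and u: "u \<in> Lp p \<Omega>"
    and lim: "(\<lambda>n. Lp_pow p \<Omega> (\<lambda>x. v n x - u x)) \<longlonglongrightarrow> 0"
  shows "(\<lambda>n. \<integral>x. a x \<bullet> v n x \<partial>lebesgue_on \<Omega>) \<longlonglongrightarrow> (\<integral>x. a x \<bullet> u x \<partial>lebesgue_on \<Omega>)"
proof -
  interpret finite_measure "lebesgue_on \<Omega>" by (rule finite_measure_lebesgue_on) fact
  note [measurable] = a(1)
  define c where "c = measure (lebesgue_on \<Omega>) (space (lebesgue_on \<Omega>))"
  have c: "0 \<le> c" by (simp add: c_def)
  have ia: "integrable (lebesgue_on \<Omega>) (\<lambda>x. a x \<bullet> w x)" if "w \<in> Lp p \<Omega>" for w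
  proof -
    have [measurable]: "w \<in> borel_measurable (lebesgue_on \<Omega>)" using that by (auto simp: Lp_def)
    have "integrable (lebesgue_on \<Omega>) (\<lambda>x. A * norm (w x))"
      using Lp_integrable[OF O that p] by auto
    then show ?thesis
    proof (rule Bochner_Integration.integrable_bound)
      show "AE x in lebesgue_on \<Omega>. norm (a x \<bullet> w x) \<le> norm (A * norm (w x))"
      proof (rule AE_I2)
        fix x assume "x \<in> space (lebesgue_on \<Omega>)"
        then have "norm (a x) * norm (w x) \<le> \<bar>A\<bar> * norm (w x)"
          using a(2)[of x] by (intro mult_right_mono) auto
        then show "norm (a x \<bullet> w x) \<le> norm (A * norm (w x))"
          using Cauchy_Schwarz_ineq2[of "a x" "w x"] by (simp add: abs_mult)
      qed
    qed auto
  qed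
  define A' where "A' = \<bar>A\<bar> + 1"
  have bound: "norm ((\<integral>x. a x \<bullet> v n x \<partial>lebesgue_on \<Omega>) - (\<integral>x. a x \<bullet> u x \<partial>lebesgue_on \<Omega>))
     \<le> A' * (K * c + K powr (1 - p) * Lp_pow p \<Omega> (\<lambda>x. v n x - u x))" if K: "0 < K" for n K
  proof -
    define w where "w = (\<lambda>x. v n x - u x)"
    have w: "w \<in> Lp p \<Omega>" unfolding w_def by (rule Lp_diff(1)[OF p v u])
    have iw: "integrable (lebesgue_on \<Omega>) (\<lambda>x. norm (w x) powr p)" using w by (simp add: Lp_def)
    have "(\<integral>x. a x \<bullet> v n x \<partial>lebesgue_on \<Omega>) - (\<integral>x. a x \<bullet> u x \<partial>lebesgue_on \<Omega>) = (\<integral>x. a x \<bullet> w x \<partial>lebesgue_on \<Omega>)"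
      using ia[OF v] ia[OF u] by (simp add: w_def inner_diff_right)
    also have "norm \<dots> \<le> (\<integral>x. norm (a x \<bullet> w x) \<partial>lebesgue_on \<Omega>)"
      by (rule integral_norm_bound)
    also have "\<dots> \<le> (\<integral>x. A' * (K + K powr (1 - p) * norm (w x) powr p) \<partial>lebesgue_on \<Omega>)"
    proof (rule integral_mono)
      fix x assume x: "x \<in> space (lebesgue_on \<Omega>)"
      have "norm (a x \<bullet> w x) \<le> norm (a x) * norm (w x)"
        using Cauchy_Schwarz_ineq2[of "a x" "w x"] by simp
      also have "\<dots> \<le> A' * (K + K powr (1 - p) * norm (w x) powr p)"
        using a(2)[of x] x young_powr[of 1 "norm (w x)" K p] p K
        by (intro mult_mono) (auto simp: A'_def)
      finally show "norm (a x \<bullet> w x) \<le> A' * (K + K powr (1 - p) * norm (w x) powr p)" .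
    qed (use ia[OF w] iw in auto)
    also have "\<dots> = A' * (K * c + K powr (1 - p) * Lp_pow p \<Omega> w)"
      using iw by (simp add: c_def Lp_pow_def mult.commute)
    finally show ?thesis by (simp add: w_def)
  qed
  show ?thesis
  proof (rule tendstoI)
    fix e :: real assume e: "0 < e"
    \<comment> \<open>This keeps the first term at most \<open>e / 2\<close>. The increments by 1 in
      \<open>A'\<close> and in \<open>c + 1\<close> keep the denominator positive when the bound or
      the measure is 0.\<close>
    define K where "K = e / (2 * A' * (c + 1))"
    have A': "0 < A'" by (simp add: A'_def)
    have K: "0 < K" using e A' c by (simp add: K_def)
    have "A' * (K * c) = e / 2 * (c / (c + 1))"
      using e A' c by (simp add: K_def)
    also have "\<dots> \<le> e / 2 * 1"
      using e c by (intro mult_left_mono) auto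
    finally have "A' * (K * c) < e" using e by simp
    moreover have "(\<lambda>n. A' * (K * c + K powr (1 - p) * Lp_pow p \<Omega> (\<lambda>x. v n x - u x))) 
       \<longlonglongrightarrow> A' * (K * c + K powr (1 - p) * 0)"
      by (intro tendsto_intros lim)
    ultimately have "\<forall>\<^sub>F n in sequentially. A' * (K * c + K powr (1 - p) * Lp_pow p \<Omega> (\<lambda>x. v n x - u x)) < e"
      using e by (intro order_tendstoD(2)) auto
    then show "\<forall>\<^sub>F n in sequentially. dist (\<integral>x. a x \<bullet> v n x \<partial>lebesgue_on \<Omega>) (\<integral>x. a x \<bullet> u x \<partial>lebesgue_on \<Omega>) < e"
      by eventually_elim (use bound[OF K] in \<open>auto simp: dist_norm intro: le_less_trans\<close>)
  qed
qed

lemma Lp_pow_eq_0_AE: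
  assumes "u \<in> Lp p \<Omega>" "Lp_pow p \<Omega> u = 0"
  shows "AE x in lebesgue_on \<Omega>. u x = 0"
proof -
  have "AE x in lebesgue_on \<Omega>. norm (u x) powr p = 0"
    using assms by (subst integral_nonneg_eq_0_iff_AE[symmetric]) (auto simp: Lp_def Lp_pow_def)
  then show ?thesis by simp
qed

section \<open>Algebra and horizontal derivatives on a group of Heisenberg type\<close>

lemma orthonormal_basis_finite: "orthonormal_basis B S \<Longrightarrow> finite B"
  by (auto simp: orthonormal_basis_def intro: pairwise_orthogonal_imp_finite)

lemma orthonormal_basis_mem: "orthonormal_basis B S \<Longrightarrow> b \<in> B \<Longrightarrow> b \<in> S"
  by (auto simp: orthonormal_basis_def intro: span_base)

lemma orthonormal_basis_inner:
  assumes "orthonormal_basis B S" "a \<in> B" "b \<in> B"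
  shows "a \<bullet> b = (if a = b then 1 else 0)"
  using assms by (auto simp: orthonormal_basis_def pairwise_def orthogonal_def dot_square_norm)

lemma orthonormal_basis_sum_inner:
  assumes "orthonormal_basis B S" "b \<in> B"
  shows "(\<Sum>a\<in>B. c a *\<^sub>R a) \<bullet> b = c b"
proof -
  have "(\<Sum>a\<in>B. c a *\<^sub>R a) \<bullet> b = (\<Sum>a\<in>B. if a = b then c a else 0)"
    unfolding inner_sum_left
    by (intro sum.cong) (auto simp: orthonormal_basis_inner[OF assms(1) _ assms(2)])
  then show ?thesis using orthonormal_basis_finite[OF assms(1)] assms(2) by simp
qed

text \<open>The residual lies in the span and is orthogonal to every basis vector, hence to
  itself.\<close>

lemma orthonormal_basis_expand:
  assumes B: "orthonormal_basis B S" and x: "x \<in> S"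
  shows "(\<Sum>b\<in>B. (x \<bullet> b) *\<^sub>R b) = x"
proof -
  define y where "y = x - (\<Sum>b\<in>B. (x \<bullet> b) *\<^sub>R b)"
  have S: "span B = S" using B by (simp add: orthonormal_basis_def)
  have y: "y \<in> span B"
    unfolding y_def using x S by (intro span_diff span_sum span_scale) (auto intro: span_base)
  have "orthogonal y y"
  proof (rule orthogonal_to_span[OF y])
    fix b assume "b \<in> B"
    then show "orthogonal y b"
      by (simp add: orthogonal_def y_def inner_diff_left orthonormal_basis_sum_inner[OF B])
  qed
  then show ?thesis by (simp add: y_def orthogonal_self)
qed

lemma orthonormal_basis_parseval:
  assumes B: "orthonormal_basis B S" and x: "x \<in> S"
  shows "(\<Sum>b\<in>B. (x \<bullet> b) * (y \<bullet> b)) = x \<bullet> y"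
proof -
  have "x \<bullet> y = (\<Sum>b\<in>B. (x \<bullet> b) *\<^sub>R b) \<bullet> y"
    by (simp only: orthonormal_basis_expand[OF B x])
  then show ?thesis by (simp add: inner_sum_left inner_commute[of y])
qed

lemma orthonormal_basis_card:
  assumes B: "orthonormal_basis B S"
  shows "card B = dim S"
proof -
  have "independent B"
    using B by (intro pairwise_orthogonal_independent) (auto simp: orthonormal_basis_def)
  then have "dim (span B) = card B" by (simp add: dim_eq_card_independent)
  then show ?thesis using B by (metis orthonormal_basis_def dim_span)
qed

section \<open>Algebra of the horizontal and the vertical layer\<close>

locale heisenberg_group =
  fixes G :: "'g::euclidean_space htype"
  assumes G: "heisenberg_type G"
begin

lemma hbasis: "orthonormal_basis (hbasis G) (hor G)"
  and vbasis: "orthonormal_basis (vbasis G) (ver G)"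
  and subspace_hor: "subspace (hor G)"
  and subspace_ver: "subspace (ver G)"
  and bilinear_lie: "bilinear (lie G)"
  and lie_self: "lie G x x = 0"
  and hor_inner_ver: "z \<in> hor G \<Longrightarrow> s \<in> ver G \<Longrightarrow> z \<bullet> s = 0"
  using G by (auto simp: heisenberg_type_def orthogonal_def)

lemma span_lie: "span {lie G z z' |z z'. z \<in> hor G \<and> z' \<in> hor G} = ver G"
  and Jmap_Jmap: "s \<in> ver G \<Longrightarrow> z \<in> hor G \<Longrightarrow> Jmap G s (Jmap G s z) = - ((norm s)\<^sup>2 *\<^sub>R z)"
  using G unfolding heisenberg_type_def by (elim conjE; simp)+

lemmas zpart_hor = zpart_spart(1)[OF G] and spart_ver = zpart_spart(2)[OF G]
  and zpart_plus_spart = zpart_spart(3)[OF G]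

lemma hbasis_hor: "e \<in> hbasis G \<Longrightarrow> e \<in> hor G"
  and vbasis_ver: "s \<in> vbasis G \<Longrightarrow> s \<in> ver G"
  using orthonormal_basis_mem hbasis vbasis by blast+

lemma lie_ver: "z \<in> hor G \<Longrightarrow> z' \<in> hor G \<Longrightarrow> lie G z z' \<in> ver G"
  unfolding span_lie[symmetric] by (rule span_base) blast

lemma lie_antisym: "lie G x y = - lie G y x"
proof -
  have "lie G (x + y) (x + y) = lie G x x + lie G y x + (lie G x y + lie G y y)"
    using bilinear_lie by (simp add: bilinear_ladd bilinear_radd)
  then show ?thesis by (simp add: lie_self eq_neg_iff_add_eq_0 add.commute)
qed

lemma linear_zpart: "linear (zpart G)"
proof
  fix x y c
  have "x + y = (zpart G x + zpart G y) + (spart G x + spart G y)"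
    using zpart_plus_spart[of x] zpart_plus_spart[of y] by (simp add: algebra_simps)
  then show "zpart G (x + y) = zpart G x + zpart G y"
    using zpart_unique[OF G subspace_add[OF subspace_hor zpart_hor zpart_hor]
        subspace_add[OF subspace_ver spart_ver spart_ver]] by metis
  have "c *\<^sub>R x = c *\<^sub>R zpart G x + c *\<^sub>R spart G x"
    using zpart_plus_spart[of x] by (metis scaleR_add_right)
  then show "zpart G (c *\<^sub>R x) = c *\<^sub>R zpart G x"
    using zpart_unique[OF G subspace_scale[OF subspace_hor zpart_hor]
        subspace_scale[OF subspace_ver spart_ver]] by metis
qed

lemma linear_spart: "linear (spart G)"
  unfolding spart_def[abs_def] by (intro linear_compose_sub linear_zpart linear_ident)

lemma bounded_linear_zpart: "bounded_linear (zpart G)"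
  and bounded_linear_spart: "bounded_linear (spart G)"
  using linear_zpart linear_spart by (simp_all add: linear_conv_bounded_linear)

lemma zpart_inner: "e \<in> hor G \<Longrightarrow> zpart G x \<bullet> e = x \<bullet> e"
  using arg_cong[OF zpart_plus_spart[of x], of "\<lambda>y. y \<bullet> e"] hor_inner_ver[OF _ spart_ver, of e x]
  by (simp add: inner_add_left inner_commute[of _ e] inner_add_right)

lemma spart_inner: "s \<in> ver G \<Longrightarrow> spart G x \<bullet> s = x \<bullet> s"
  using arg_cong[OF zpart_plus_spart[of x], of "\<lambda>y. y \<bullet> s"] hor_inner_ver[OF zpart_hor, of s x]
  by (simp add: inner_add_left)

lemma zpart_of_ver: "s \<in> ver G \<Longrightarrow> zpart G s = 0"
  using zpart_unique[OF G subspace_0[OF subspace_hor]] by simp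

text \<open>Brackets of horizontal vectors span the vertical layer, so a trivial horizontal layer
  would leave a space of dimension 0. The Poincare inequality takes its direction from here.\<close>

lemma hbasis_nonempty: "hbasis G \<noteq> {}"
proof
  assume "hbasis G = {}"
  then have h: "hor G = {0}" using hbasis by (simp add: orthonormal_basis_def)
  have "{lie G z z' |z z'. z \<in> hor G \<and> z' \<in> hor G} = {0}" by (auto simp: h lie_self)
  then have "ver G = {0}" using span_lie by simp
  then have "x = 0" for x :: 'g using zpart_plus_spart[of x] zpart_hor[of x] spart_ver[of x] h by auto
  then show False using nonempty_Basis nonzero_Basis by blast
qed

lemmas Jmap_hor = Jmap_spec(1)[OF G] and Jmap_inner = Jmap_spec(2)[OF G]

lemma Jmap_inner_self: "z \<in> hor G \<Longrightarrow> Jmap G s z \<bullet> z = 0"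
  by (simp add: Jmap_inner lie_self)

text \<open>\<open>Jmap G s\<close> is skew-symmetric because the bracket is antisymmetric; together
  with the formula for its square this makes it \<open>norm s\<close> times an isometry.\<close>

lemma norm_Jmap:
  assumes "s \<in> ver G" "z \<in> hor G"
  shows "Jmap G s z \<bullet> Jmap G s z = (s \<bullet> s) * (z \<bullet> z)"
proof -
  have "Jmap G s z \<bullet> Jmap G s z = - (Jmap G s (Jmap G s z) \<bullet> z)"
    using Jmap_inner[OF Jmap_hor, of s z s z] Jmap_inner[OF assms(2), of s "Jmap G s z"]
      lie_antisym[of z "Jmap G s z"] by (simp add: inner_minus_left)
  also have "Jmap G s (Jmap G s z) = - ((norm s)\<^sup>2 *\<^sub>R z)"
    by (rule Jmap_Jmap[OF assms])
  finally show ?thesis by (simp add: power2_norm_eq_inner)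
qed

text \<open>\<open>N4\<close> is the fourth power of the homogeneous norm and \<open>4 V\<close> its horizontal gradient.\<close>

definition N4 :: "'g \<Rightarrow> real" where
  "N4 x = (zpart G x \<bullet> zpart G x)\<^sup>2 + 16 * (spart G x \<bullet> spart G x)"

definition V :: "'g \<Rightarrow> 'g" where
  "V x = (zpart G x \<bullet> zpart G x) *\<^sub>R zpart G x + 4 *\<^sub>R Jmap G (spart G x) (zpart G x)"

lemma N4_nonneg: "0 \<le> N4 x"
  by (simp add: N4_def)

lemma hom_norm_eq: "hom_norm G x = N4 x powr (1/4)"
proof -
  have "norm (zpart G x) ^ 4 = ((norm (zpart G x))\<^sup>2)\<^sup>2" by simp
  then show ?thesis by (simp add: hom_norm_def N4_def power2_norm_eq_inner)
qed

lemma V_hor: "V x \<in> hor G"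
  unfolding V_def by (intro subspace_add subspace_hor subspace_scale zpart_hor Jmap_hor)

text \<open>The defining property of \<open>Jmap\<close> trades it for the bracket. In this form a
  component of \<open>V\<close> is a polynomial in linear functionals of \<open>x\<close>, ready to
  be differentiated.\<close>

lemma V_inner:
  assumes "e \<in> hor G"
  shows "V x \<bullet> e = (zpart G x \<bullet> zpart G x) * (x \<bullet> e) + 4 * (lie G (zpart G x) e \<bullet> x)"
  using Jmap_inner[OF assms, of "spart G x" "zpart G x"] spart_inner[OF lie_ver[OF zpart_hor assms], of x x]
  by (simp add: V_def inner_add_left zpart_inner[OF assms] inner_commute[of _ "lie G (zpart G x) e"])

lemma V_inner_zpart: "V x \<bullet> zpart G x = (zpart G x \<bullet> zpart G x)\<^sup>2"
  using Jmap_inner_self[OF zpart_hor, of "spart G x" x] by (simp add: V_def inner_add_left power2_eq_square)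

text \<open>The two summands of \<open>V\<close> are orthogonal, so their squares |z|^6 and 16
  |\<sigma>|^2 |z|^2 add up.\<close>

lemma norm_V_sq: "(norm (V x))\<^sup>2 = (norm (zpart G x))\<^sup>2 * N4 x"
proof -
  have "Jmap G (spart G x) (zpart G x) \<bullet> zpart G x = 0" "zpart G x \<bullet> Jmap G (spart G x) (zpart G x) = 0"
    using Jmap_inner_self[OF zpart_hor] by (auto simp: inner_commute)
  moreover note norm_Jmap[OF spart_ver zpart_hor, of x x]
  ultimately have "V x \<bullet> V x = (zpart G x \<bullet> zpart G x) * N4 x"
    by (simp add: V_def N4_def inner_add_left inner_add_right power2_eq_square algebra_simps)
  then show ?thesis by (simp add: power2_norm_eq_inner)
qed

lemma norm_V: "norm (V x) = norm (zpart G x) * sqrt (N4 x)"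
  using norm_V_sq[of x] by (metis norm_ge_zero real_sqrt_abs real_sqrt_mult abs_of_nonneg)

lemma zpart_le_N4: "norm (zpart G x) ^ 4 \<le> N4 x"
proof -
  have "norm (zpart G x) ^ 4 = ((norm (zpart G x))\<^sup>2)\<^sup>2" by simp
  then show ?thesis by (simp add: N4_def power2_norm_eq_inner)
qed

text \<open>The vector that the left-invariant field of \<open>e\<close> attaches to the point
  \<open>x\<close>. Viewing \<open>Xfield\<close> as a directional derivative along it reduces
  product and chain rules to those for Frechet derivatives.\<close>

definition udir :: "'g \<Rightarrow> 'g \<Rightarrow> 'g" where
  "udir e x = e + (1/2) *\<^sub>R (\<Sum>s\<in>vbasis G. (Jmap G s (zpart G x) \<bullet> e) *\<^sub>R s)"

lemma Xfield_eq:
  assumes "(f has_derivative D) (at x)"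
  shows "Xfield G e f x = D (udir e x)"
proof -
  have lin: "linear D" using assms by (rule has_derivative_linear)
  show ?thesis
    by (simp add: Xfield_def udir_def frechet_derivative_eq[OF assms] linear_add[OF lin]
        linear_scale[OF lin] linear_sum[OF lin])
qed

lemma zpart_udir:
  assumes "e \<in> hor G"
  shows "zpart G (udir e x) = e"
proof -
  have "(1/2) *\<^sub>R (\<Sum>s\<in>vbasis G. (Jmap G s (zpart G x) \<bullet> e) *\<^sub>R s) \<in> ver G"
    by (intro subspace_scale subspace_sum subspace_ver) (auto intro: vbasis_ver)
  then show ?thesis unfolding udir_def by (intro zpart_unique[OF G assms])
qed

lemma udir_inner_ver:
  assumes "e \<in> hor G" "s \<in> ver G"
  shows "udir e x \<bullet> s = 1/2 * (lie G (zpart G x) e \<bullet> s)"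
proof -
  have "udir e x \<bullet> s = 1/2 * (\<Sum>t\<in>vbasis G. (lie G (zpart G x) e \<bullet> t) * (s \<bullet> t))"
    using hor_inner_ver[OF assms]
    by (simp add: udir_def inner_add_left inner_sum_left Jmap_inner[OF assms(1)] inner_commute[of s])
  also have "\<dots> = 1/2 * (lie G (zpart G x) e \<bullet> s)"
    by (simp only: orthonormal_basis_parseval[OF vbasis lie_ver[OF zpart_hor assms(1)]])
  finally show ?thesis .
qed

lemma udir_inner_hor: "e \<in> hor G \<Longrightarrow> e' \<in> hor G \<Longrightarrow> udir e x \<bullet> e' = e \<bullet> e'"
  by (metis zpart_inner zpart_udir)

lemma Xfield_mult:
  assumes "f differentiable (at x)" "g differentiable (at x)"
  shows "Xfield G e (\<lambda>x. f x * g x) x = f x * Xfield G e g x + g x * Xfield G e f x"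
proof -
  obtain D E where DE: "(f has_derivative D) (at x)" "(g has_derivative E) (at x)"
    using assms by (auto simp: differentiable_def)
  show ?thesis
    by (simp add: Xfield_eq[OF has_derivative_mult[OF DE]] Xfield_eq[OF DE(1)] Xfield_eq[OF DE(2)])
qed

lemma Xfield_compose:
  assumes "f differentiable (at x)" "(h has_real_derivative h') (at (f x))"
  shows "Xfield G e (\<lambda>x. h (f x)) x = h' * Xfield G e f x"
proof -
  obtain D where D: "(f has_derivative D) (at x)"
    using assms by (auto simp: differentiable_def)
  show ?thesis
    by (simp add: Xfield_eq[OF DERIV_compose_FDERIV[OF assms(2) D]] Xfield_eq[OF D])
qed

lemma hgrad_inner: "e \<in> hbasis G \<Longrightarrow> hgrad G f x \<bullet> e = Xfield G e f x"
  unfolding hgrad_def by (rule orthonormal_basis_sum_inner[OF hbasis])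

lemma hgrad_hor: "hgrad G f x \<in> hor G"
  unfolding hgrad_def
  by (intro subspace_sum subspace_hor subspace_scale hbasis_hor)

lemma hgrad_eqI:
  assumes "v \<in> hor G" "\<And>e. e \<in> hbasis G \<Longrightarrow> Xfield G e f x = v \<bullet> e"
  shows "hgrad G f x = v"
  unfolding hgrad_def using assms(2) orthonormal_basis_expand[OF hbasis assms(1)] by simp

lemma Xfield_le_hgrad: "e \<in> hbasis G \<Longrightarrow> \<bar>Xfield G e f x\<bar> \<le> norm (hgrad G f x)"
  using Cauchy_Schwarz_ineq2[of "hgrad G f x" e] orthonormal_basis_inner[OF hbasis, of e e]
  by (simp add: hgrad_inner norm_eq_sqrt_inner)

lemma inner_hgrad_sum:
  assumes "v \<in> hor G"
  shows "v \<bullet> hgrad G f x = (\<Sum>e\<in>hbasis G. (v \<bullet> e) * Xfield G e f x)"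
  by (simp add: hgrad_def inner_sum_right mult.commute)

lemma N4_has_derivative:
  "(N4 has_derivative (\<lambda>h. 4 * (zpart G x \<bullet> zpart G x) * (zpart G x \<bullet> zpart G h)
      + 32 * (spart G x \<bullet> spart G h))) (at x)"
  unfolding N4_def[abs_def]
  by (rule derivative_eq_intros bounded_linear.has_derivative[OF bounded_linear_zpart]
      bounded_linear.has_derivative[OF bounded_linear_spart] refl)+
    (auto simp: fun_eq_iff inner_commute algebra_simps)

text \<open>The vertical part of \<open>udir e x\<close> contributes half a bracket term, so 32
  becomes 16 = 4 * 4. The constant 16 in the homogeneous norm is thus what produces the factor 4
  inside \<open>V\<close>.\<close>

lemma Xfield_N4:
  assumes "e \<in> hor G"
  shows "Xfield G e N4 x = 4 * (V x \<bullet> e)"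
proof -
  have "spart G x \<bullet> spart G (udir e x) = udir e x \<bullet> spart G x"
    using spart_inner[OF spart_ver, of "udir e x" x] by (simp add: inner_commute)
  also have "\<dots> = 1/2 * (lie G (zpart G x) e \<bullet> x)"
    using udir_inner_ver[OF assms spart_ver] spart_inner[OF lie_ver[OF zpart_hor assms], of x x]
    by (simp add: inner_commute)
  finally show ?thesis
    by (simp add: Xfield_eq[OF N4_has_derivative] zpart_udir[OF assms] V_inner[OF assms]
        zpart_inner[OF assms] algebra_simps)
qed

section \<open>Smoothness of the basic functions and divergence-free fields\<close>

lemma Ck_inner: "Ck n (\<lambda>x::'g. x \<bullet> a)"
  by (intro Ck_linear linearI) (auto simp: inner_add_left)

lemma Ck_zpart_sq: "Ck n (\<lambda>x. zpart G x \<bullet> zpart G x)"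
proof -
  have "(\<lambda>x. zpart G x \<bullet> zpart G x) = (\<lambda>x. \<Sum>e\<in>hbasis G. (x \<bullet> e) * (x \<bullet> e))"
    using orthonormal_basis_parseval[OF hbasis zpart_hor, symmetric] zpart_inner[OF hbasis_hor]
    by (auto intro!: sum.cong)
  then show ?thesis by (simp only:) (intro Ck_sum Ck_mult Ck_inner)
qed

lemma Ck_spart_sq: "Ck n (\<lambda>x. spart G x \<bullet> spart G x)"
proof -
  have "(\<lambda>x. spart G x \<bullet> spart G x) = (\<lambda>x. \<Sum>e\<in>vbasis G. (x \<bullet> e) * (x \<bullet> e))"
    using orthonormal_basis_parseval[OF vbasis spart_ver, symmetric] spart_inner[OF vbasis_ver]
    by (auto intro!: sum.cong)
  then show ?thesis by (simp only:) (intro Ck_sum Ck_mult Ck_inner)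
qed

lemma Ck_N4: "Ck n N4"
  unfolding N4_def[abs_def] power2_eq_square
  by (intro Ck_add Ck_mult Ck_zpart_sq Ck_cmult Ck_spart_sq)

text \<open>For horizontal \<open>e\<close> and \<open>s\<close> in \<open>vbasis G\<close>, this is
  twice the coefficient of the derivative along \<open>s\<close> in the field of \<open>e\<close>.
  Its linearity gives both the continuity of the fields and their vanishing divergence.\<close>

lemma linear_lie_inner: "linear (\<lambda>x. lie G (zpart G x) e \<bullet> s)"
  by (intro linearI)
    (auto simp: linear_add[OF linear_zpart] linear_scale[OF linear_zpart]
      bilinear_ladd[OF bilinear_lie] bilinear_lmul[OF bilinear_lie] inner_add_left)

lemma Ck_V_inner:
  assumes "e \<in> hor G"
  shows "Ck n (\<lambda>x. V x \<bullet> e)"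
proof -
  have "lie G (zpart G x) e \<bullet> x = (\<Sum>s\<in>vbasis G. (lie G (zpart G x) e \<bullet> s) * (x \<bullet> s))" for x
    by (simp only: orthonormal_basis_parseval[OF vbasis lie_ver[OF zpart_hor assms]])
  then show ?thesis
    by (simp only: V_inner[OF assms])
      (intro Ck_add Ck_mult Ck_zpart_sq Ck_inner Ck_cmult Ck_sum Ck_linear linear_lie_inner)
qed

lemma continuous_Xfield:
  assumes "Ck (Suc 0) F" "e \<in> hor G"
  shows "continuous_on UNIV (Xfield G e F)"
proof -
  have "continuous_on UNIV (\<lambda>x. Jmap G s (zpart G x) \<bullet> e)" for s
    using Ck_imp_continuous[OF Ck_linear[OF linear_lie_inner], of e s]
    by (simp add: Jmap_inner[OF assms(2)])
  then show ?thesis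
    unfolding Xfield_def[abs_def]
    by (intro continuous_on_add continuous_on_mult continuous_on_sum continuous_on_const
        Ck_1_continuous_frechet_derivative[OF assms(1)])
qed

lemma continuous_hgrad:
  assumes "Ck (Suc 0) F"
  shows "continuous_on UNIV (hgrad G F)"
  unfolding hgrad_def[abs_def]
  by (intro continuous_on_sum continuous_on_scaleR continuous_on_const continuous_Xfield assms hbasis_hor)

lemma Xfield_outside_support: "x \<notin> closure {x. F x \<noteq> 0} \<Longrightarrow> Xfield G e F x = 0"
  by (simp add: Xfield_def frechet_derivative_outside_support)

lemma hgrad_outside_support: "x \<notin> closure {x. F x \<noteq> 0} \<Longrightarrow> hgrad G F x = 0"
  by (simp add: hgrad_def Xfield_outside_support)

text \<open>The coefficient of the derivative along a vertical \<open>s\<close> depends on the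
  horizontal part of \<open>x\<close> alone, so it is constant along \<open>s\<close> and may be
  moved under that derivative. Every term is then a directional derivative of a compactly supported
  function.\<close>

lemma integral_Xfield_eq_0:
  assumes F: "Ck (Suc 0) F" "compact (closure {x. F x \<noteq> 0})" and e: "e \<in> hor G"
  shows "(\<integral>x. Xfield G e F x \<partial>lborel) = 0"
proof -
  define a where "a = (\<lambda>s x. lie G (zpart G x) e \<bullet> s)"
  have lin: "linear (a s)" for s unfolding a_def by (rule linear_lie_inner)
  have a0: "a s s = 0" if "s \<in> vbasis G" for s
    using zpart_of_ver[OF vbasis_ver[OF that]] bilinear_lzero[OF bilinear_lie] by (simp add: a_def)
  have C: "Ck (Suc 0) (\<lambda>x. a s x * F x)" for s
    by (rule Ck_mult[OF Ck_linear[OF lin] F(1)])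
  have K: "compact (closure {x. a s x * F x \<noteq> 0})" for s
    using F(2) unfolding compact_closure by (rule bounded_subset) auto
  have D: "frechet_derivative (\<lambda>x. a s x * F x) (at x) s = a s x * frechet_derivative F (at x) s"
    if "s \<in> vbasis G" for s x
  proof -
    have "(F has_derivative frechet_derivative F (at x)) (at x)"
      using F(1) by (simp add: frechet_derivative_works[symmetric])
    from has_derivative_mult[OF linear_imp_has_derivative[OF lin[of s]] this] 
    show ?thesis using a0[OF that] by (simp add: frechet_derivative_eq)
  qed
  have X: "Xfield G e F x = frechet_derivative F (at x) e + 
      1/2 * (\<Sum>s\<in>vbasis G. frechet_derivative (\<lambda>x. a s x * F x) (at x) s)" for x
    by (simp add: Xfield_def D Jmap_inner[OF e]) (simp add: a_def)
  show ?thesis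
    unfolding X
    using integral_frechet_derivative_eq_0[OF F] integral_frechet_derivative_eq_0[OF C K]
    by (simp add: Bochner_Integration.integral_add Bochner_Integration.integral_sum)
qed

end

section \<open>Weak solutions on bounded open sets\<close>

locale heisenberg_domain = heisenberg_group G for G :: "'g::euclidean_space htype" +
  fixes \<Omega> :: "'g set" and p :: real
  assumes open_domain: "open \<Omega>" and bounded_domain: "bounded \<Omega>" and p: "1 < p"
begin

lemma lmeasurable_domain: "\<Omega> \<in> lmeasurable"
  using bounded_domain open_domain by (rule lmeasurable_open)

lemma borel_domain: "\<Omega> \<in> sets borel"
  using open_domain by (rule borel_open)

lemma lebesgue_domain: "\<Omega> \<in> sets lebesgue"
  using lmeasurable_domain by (rule fmeasurableD)

lemma continuous_imp_measurable_domain: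
  fixes u :: "'g \<Rightarrow> 'b::euclidean_space"
  shows "continuous_on UNIV u \<Longrightarrow> u \<in> borel_measurable (lebesgue_on \<Omega>)"
  by (rule continuous_imp_measurable_on_sets_lebesgue[OF continuous_on_subset lebesgue_domain]) auto

lemma continuous_imp_integrable_domain:
  fixes u :: "'g \<Rightarrow> real"
  assumes "continuous_on UNIV u"
  shows "integrable (lebesgue_on \<Omega>) u"
proof -
  have "bounded (u ` closure \<Omega>)"
    using bounded_domain continuous_on_subset[OF assms]
    by (intro compact_imp_bounded compact_continuous_image) auto
  then obtain M where "\<And>x. x \<in> closure \<Omega> \<Longrightarrow> norm (u x) \<le> M" by (auto simp: bounded_iff)
  then show ?thesis
    using closure_subset
    by (intro integrable_bounded_lebesgue_on[where M = M] lmeasurable_domain continuous_imp_measurable_domain assms) auto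
qed

lemma test_function_outside:
  assumes "\<phi> \<in> test_functions \<Omega>" "x \<notin> closure {x. \<phi> x \<noteq> 0}"
  shows "\<phi> x = 0" "Xfield G e \<phi> x = 0" "hgrad G \<phi> x = 0"
  using assms Xfield_outside_support hgrad_outside_support closure_subset[of "{x. \<phi> x \<noteq> 0}"] by auto

lemma test_functionD:
  assumes "\<phi> \<in> test_functions \<Omega>"
  shows "Ck n \<phi>" "compact (closure {x. \<phi> x \<noteq> 0})" "closure {x. \<phi> x \<noteq> 0} \<subseteq> \<Omega>"
  using assms by (auto simp: test_functions_def)

lemma test_function_outside_domain:
  assumes "\<phi> \<in> test_functions \<Omega>" "x \<notin> \<Omega>"
  shows "\<phi> x = 0" "Xfield G e \<phi> x = 0" "hgrad G \<phi> x = 0"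
  using test_function_outside[OF assms(1)] test_functionD(3)[OF assms(1)] assms(2) by blast+

lemma test_function_bounded:
  assumes "\<phi> \<in> test_functions \<Omega>"
  obtains M where "\<And>x. \<bar>\<phi> x\<bar> \<le> M" "\<And>x. norm (hgrad G \<phi> x) \<le> M"
proof -
  note t = test_functionD[OF assms] test_function_outside[OF assms]
  obtain M where M: "\<And>x. norm (\<phi> x) \<le> M"
    using continuous_compact_support_bounded[OF Ck_imp_continuous[OF t(1)] t(2) t(4)] by blast
  obtain M' where M': "\<And>x. norm (hgrad G \<phi> x) \<le> M'"
    using continuous_compact_support_bounded[OF continuous_hgrad[OF t(1)] t(2) t(6)] by blast
  have "\<bar>\<phi> x\<bar> \<le> max M M'" "norm (hgrad G \<phi> x) \<le> max M M'" for x
    using M[of x] M'[of x] by auto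
  then show thesis by (rule that)
qed

lemma test_function_Lp:
  assumes "\<phi> \<in> test_functions \<Omega>"
  shows "\<phi> \<in> Lp p \<Omega>" "hgrad G \<phi> \<in> Lp p \<Omega>"
proof -
  obtain M where M: "\<And>x. \<bar>\<phi> x\<bar> \<le> M" "\<And>x. norm (hgrad G \<phi> x) \<le> M"
    using test_function_bounded[OF assms] by blast
  show "\<phi> \<in> Lp p \<Omega>"
    using p M by (intro Lp_bounded[where M = M] lmeasurable_domain continuous_imp_measurable_domain
        Ck_imp_continuous[OF test_functionD(1)[OF assms]]) auto
  show "hgrad G \<phi> \<in> Lp p \<Omega>"
    using p M by (intro Lp_bounded[where M = M] lmeasurable_domain continuous_imp_measurable_domain
        continuous_hgrad test_functionD(1)[OF assms]) auto
qed

text \<open>The field applied to \<open>F * \<phi>\<close> has integral 0. The support condition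
  sits on \<phi> because \<open>F\<close> will also be a component of the regularized flux, which
  need not vanish near the boundary.\<close>

lemma Xfield_integral_by_parts:
  assumes F: "Ck (Suc 0) F" and \<phi>: "\<phi> \<in> test_functions \<Omega>" and e: "e \<in> hor G"
  shows "(\<integral>x. F x * Xfield G e \<phi> x \<partial>lebesgue_on \<Omega>) = - (\<integral>x. \<phi> x * Xfield G e F x \<partial>lebesgue_on \<Omega>)"
proof -
  note t = test_functionD[OF \<phi>] test_function_outside[OF \<phi>]
  have X: "Xfield G e (\<lambda>x. F x * \<phi> x) x = F x * Xfield G e \<phi> x + \<phi> x * Xfield G e F x" for x
    using Ck_Suc_differentiable[OF F] Ck_Suc_differentiable[OF t(1)] by (rule Xfield_mult)
  have "compact (closure {x. F x * \<phi> x \<noteq> 0})"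
    using t(2) unfolding compact_closure by (rule bounded_subset) auto
  then have "(\<integral>x. Xfield G e (\<lambda>x. F x * \<phi> x) x \<partial>lborel) = 0"
    by (intro integral_Xfield_eq_0 Ck_mult F t(1) e)
  moreover have c: "continuous_on UNIV (\<lambda>x. F x * Xfield G e \<phi> x)" "continuous_on UNIV (\<lambda>x. \<phi> x * Xfield G e F x)"
    using Ck_imp_continuous[OF F] Ck_imp_continuous[OF t(1)] continuous_Xfield[OF F e] continuous_Xfield[OF t(1) e]
    by (auto intro: continuous_on_mult)
  moreover have "integrable lborel (\<lambda>x. F x * Xfield G e \<phi> x)" "integrable lborel (\<lambda>x. \<phi> x * Xfield G e F x)"
    by (rule continuous_compact_support_integrable[OF c(1) t(2)], drule t(5)[of _ e], simp)
      (rule continuous_compact_support_integrable[OF c(2) t(2)], drule t(4), simp)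
  ultimately have "(\<integral>x. F x * Xfield G e \<phi> x \<partial>lborel) = - (\<integral>x. \<phi> x * Xfield G e F x \<partial>lborel)"
    by (simp add: X)
  moreover have "(\<integral>x. F x * Xfield G e \<phi> x \<partial>lebesgue_on \<Omega>) = (\<integral>x. F x * Xfield G e \<phi> x \<partial>lborel)"
    by (intro integral_lebesgue_on_eq_lborel borel_measurable_continuous_onI c borel_domain)
      (simp add: test_function_outside_domain[OF \<phi>])
  moreover have "(\<integral>x. \<phi> x * Xfield G e F x \<partial>lebesgue_on \<Omega>) = (\<integral>x. \<phi> x * Xfield G e F x \<partial>lborel)"
    by (intro integral_lebesgue_on_eq_lborel borel_measurable_continuous_onI c borel_domain)
      (simp add: test_function_outside_domain[OF \<phi>])
  ultimately show ?thesis by simp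
qed

section \<open>The Sobolev space through sequences of test functions\<close>

lemma W0E:
  assumes "W0 G p \<Omega> f g"
  obtains \<phi> where "\<And>n. \<phi> n \<in> test_functions \<Omega>"
    "(\<lambda>n. Lp_pow p \<Omega> (\<lambda>x. \<phi> n x - f x)) \<longlonglongrightarrow> 0" "(\<lambda>n. Lp_pow p \<Omega> (\<lambda>x. hgrad G (\<phi> n) x - g x)) \<longlonglongrightarrow> 0"
proof -
  have "\<exists>\<phi>\<in>test_functions \<Omega>.
      Lp_norm p \<Omega> (\<lambda>x. \<phi> x - f x) + Lp_norm p \<Omega> (\<lambda>x. hgrad G \<phi> x - g x) < 1 / real (Suc n)" for n
    using assms by (auto simp: W0_def)
  then obtain \<phi> where \<phi>: "\<And>n. \<phi> n \<in> test_functions \<Omega>"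
    "\<And>n. Lp_norm p \<Omega> (\<lambda>x. \<phi> n x - f x) + Lp_norm p \<Omega> (\<lambda>x. hgrad G (\<phi> n) x - g x) < 1 / real (Suc n)"
    by metis
  have lim: "(\<lambda>n. 1 / real (Suc n)) \<longlonglongrightarrow> 0" by (rule LIMSEQ_Suc[OF lim_1_over_n])
  have "(\<lambda>n. Lp_norm p \<Omega> (\<lambda>x. \<phi> n x - f x)) \<longlonglongrightarrow> 0"
  proof (rule Lim_null_comparison[OF always_eventually lim], rule allI)
    fix n show "norm (Lp_norm p \<Omega> (\<lambda>x. \<phi> n x - f x)) \<le> 1 / real (Suc n)"
      using \<phi>(2)[of n] Lp_norm_nonneg[of p \<Omega> "\<lambda>x. \<phi> n x - f x"] Lp_norm_nonneg[of p \<Omega> "\<lambda>x. hgrad G (\<phi> n) x - g x"]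
      by simp
  qed
  moreover have "(\<lambda>n. Lp_norm p \<Omega> (\<lambda>x. hgrad G (\<phi> n) x - g x)) \<longlonglongrightarrow> 0"
  proof (rule Lim_null_comparison[OF always_eventually lim], rule allI)
    fix n show "norm (Lp_norm p \<Omega> (\<lambda>x. hgrad G (\<phi> n) x - g x)) \<le> 1 / real (Suc n)"
      using \<phi>(2)[of n] Lp_norm_nonneg[of p \<Omega> "\<lambda>x. \<phi> n x - f x"] Lp_norm_nonneg[of p \<Omega> "\<lambda>x. hgrad G (\<phi> n) x - g x"]
      by simp
  qed
  ultimately show thesis
    using p by (intro that[OF \<phi>(1)] Lp_norm_tendsto_0_iff[THEN iffD1]) auto
qed

lemma W0_D:
  assumes "W0 G p \<Omega> f g"
  shows "f \<in> Lp p \<Omega>" "g \<in> Lp p \<Omega>" "x \<in> \<Omega> \<Longrightarrow> g x \<in> hor G"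
  using assms by (auto simp: W0_def weak_hgrad_def)

text \<open>The weak-gradient clause of \<open>W0\<close> follows from the convergence: it holds for
  each \<open>\<phi> n\<close> by integration by parts, and both of its sides are pairings with
  bounded functions, hence pass to the limit.\<close>

lemma W0I:
  assumes f: "f \<in> Lp p \<Omega>" and g: "g \<in> Lp p \<Omega>" and hor: "\<And>x. x \<in> \<Omega> \<Longrightarrow> g x \<in> hor G"
    and \<phi>: "\<And>n. \<phi> n \<in> test_functions \<Omega>"
    and lim: "(\<lambda>n. Lp_pow p \<Omega> (\<lambda>x. \<phi> n x - f x)) \<longlonglongrightarrow> 0"
      "(\<lambda>n. Lp_pow p \<Omega> (\<lambda>x. hgrad G (\<phi> n) x - g x)) \<longlonglongrightarrow> 0"
  shows "W0 G p \<Omega> f g"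
proof -
  have "(\<integral>x. f x * Xfield G e \<psi> x \<partial>lebesgue_on \<Omega>) = - (\<integral>x. (g x \<bullet> e) * \<psi> x \<partial>lebesgue_on \<Omega>)"
    if \<psi>: "\<psi> \<in> test_functions \<Omega>" and e: "e \<in> hbasis G" for \<psi> e
  proof -
    obtain M where M: "\<And>x. \<bar>\<psi> x\<bar> \<le> M" "\<And>x. norm (hgrad G \<psi> x) \<le> M"
      using test_function_bounded[OF \<psi>] by blast
    have ne: "norm e = 1" using hbasis e by (auto simp: orthonormal_basis_def)
    have l1: "(\<lambda>n. \<integral>x. Xfield G e \<psi> x \<bullet> \<phi> n x \<partial>lebesgue_on \<Omega>) \<longlonglongrightarrow> (\<integral>x. Xfield G e \<psi> x \<bullet> f x \<partial>lebesgue_on \<Omega>)"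
    proof (rule Lp_tendsto_integral_inner[OF lmeasurable_domain p _ _ test_function_Lp(1)[OF \<phi>] f lim(1)])
      show "Xfield G e \<psi> \<in> borel_measurable (lebesgue_on \<Omega>)"
        by (intro continuous_imp_measurable_domain continuous_Xfield test_functionD(1)[OF \<psi>] hbasis_hor e)
      show "norm (Xfield G e \<psi> x) \<le> M" for x
        using Xfield_le_hgrad[OF e, of \<psi> x] M(2)[of x] by simp
    qed
    have l2: "(\<lambda>n. \<integral>x. (\<psi> x *\<^sub>R e) \<bullet> hgrad G (\<phi> n) x \<partial>lebesgue_on \<Omega>) \<longlonglongrightarrow> (\<integral>x. (\<psi> x *\<^sub>R e) \<bullet> g x \<partial>lebesgue_on \<Omega>)"
    proof (rule Lp_tendsto_integral_inner[OF lmeasurable_domain p _ _ test_function_Lp(2)[OF \<phi>] g lim(2)])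
      show "(\<lambda>x. \<psi> x *\<^sub>R e) \<in> borel_measurable (lebesgue_on \<Omega>)"
        by (intro continuous_imp_measurable_domain continuous_on_scaleR continuous_on_const
            Ck_imp_continuous[OF test_functionD(1)[OF \<psi>]])
      show "norm (\<psi> x *\<^sub>R e) \<le> M" for x
        using M(1)[of x] ne by simp
    qed
    have eq: "(\<integral>x. Xfield G e \<psi> x \<bullet> \<phi> n x \<partial>lebesgue_on \<Omega>)
        = - (\<integral>x. (\<psi> x *\<^sub>R e) \<bullet> hgrad G (\<phi> n) x \<partial>lebesgue_on \<Omega>)" for n
      using Xfield_integral_by_parts[OF test_functionD(1)[OF \<phi>[of n]] \<psi> hbasis_hor[OF e]]
      by (simp add: hgrad_inner[OF e] inner_commute[of e] mult.commute)
    have "(\<integral>x. Xfield G e \<psi> x \<bullet> f x \<partial>lebesgue_on \<Omega>) = - (\<integral>x. (\<psi> x *\<^sub>R e) \<bullet> g x \<partial>lebesgue_on \<Omega>)"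
      using l1 tendsto_minus[OF l2] unfolding eq by (rule LIMSEQ_unique)
    then show ?thesis by (simp add: inner_commute[of e] mult.commute)
  qed
  then have "weak_hgrad G \<Omega> f g" using hor by (auto simp: weak_hgrad_def)
  moreover have "\<exists>\<phi>\<in>test_functions \<Omega>.
      Lp_norm p \<Omega> (\<lambda>x. \<phi> x - f x) + Lp_norm p \<Omega> (\<lambda>x. hgrad G \<phi> x - g x) < \<delta>" if "0 < \<delta>" for \<delta>
  proof -
    have "(\<lambda>n. Lp_norm p \<Omega> (\<lambda>x. \<phi> n x - f x) + Lp_norm p \<Omega> (\<lambda>x. hgrad G (\<phi> n) x - g x)) \<longlonglongrightarrow> 0 + 0"
      using p lim by (intro tendsto_add Lp_norm_tendsto_0_iff[THEN iffD2]) auto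
    then have "\<forall>\<^sub>F n in sequentially. Lp_norm p \<Omega> (\<lambda>x. \<phi> n x - f x) + Lp_norm p \<Omega> (\<lambda>x. hgrad G (\<phi> n) x - g x) < \<delta>"
      using that by (intro order_tendstoD(2)) auto
    then show ?thesis using \<phi> by (auto dest!: eventually_happens)
  qed
  ultimately show ?thesis using f g by (simp add: W0_def)
qed

text \<open>On a bounded domain, uniform bounds and pointwise limits give Lp convergence. In this
  form membership of the explicit solution becomes a pointwise computation.\<close>

lemma W0_bounded_limit:
  assumes \<phi>: "\<And>n. \<phi> n \<in> test_functions \<Omega>"
    and M: "\<And>n x. x \<in> \<Omega> \<Longrightarrow> \<bar>\<phi> n x\<bar> \<le> M" "\<And>n x. x \<in> \<Omega> \<Longrightarrow> norm (hgrad G (\<phi> n) x) \<le> M"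
    and lim: "\<And>x. x \<in> \<Omega> \<Longrightarrow> (\<lambda>n. \<phi> n x) \<longlonglongrightarrow> f x" "\<And>x. x \<in> \<Omega> \<Longrightarrow> (\<lambda>n. hgrad G (\<phi> n) x) \<longlonglongrightarrow> g x"
  shows "W0 G p \<Omega> f g"
proof -
  have m\<phi>: "\<phi> n \<in> borel_measurable (lebesgue_on \<Omega>)" "hgrad G (\<phi> n) \<in> borel_measurable (lebesgue_on \<Omega>)" for n
    using test_function_Lp[OF \<phi>] by (auto simp: Lp_def)
  have mf: "f \<in> borel_measurable (lebesgue_on \<Omega>)"
    by (rule borel_measurable_LIMSEQ_metric[where f = \<phi>, OF m\<phi>(1)]) (use lim(1) in simp)
  have mg: "g \<in> borel_measurable (lebesgue_on \<Omega>)"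
    by (rule borel_measurable_LIMSEQ_metric[where f = "\<lambda>n. hgrad G (\<phi> n)", OF m\<phi>(2)]) (use lim(2) in simp)
  have p0: "0 < p" using p by simp
  show ?thesis
  proof (rule W0I[OF _ _ _ \<phi>])
    show "f \<in> Lp p \<Omega>"
    proof (rule Lp_bounded[OF lmeasurable_domain mf _ p0])
      show "norm (f x) \<le> M" if "x \<in> \<Omega>" for x
        by (rule LIMSEQ_le_const2[OF tendsto_norm[OF lim(1)[OF that]]]) (auto simp: M that)
    qed
    show "g \<in> Lp p \<Omega>"
    proof (rule Lp_bounded[OF lmeasurable_domain mg _ p0])
      show "norm (g x) \<le> M" if "x \<in> \<Omega>" for x
        by (rule LIMSEQ_le_const2[OF tendsto_norm[OF lim(2)[OF that]]]) (auto simp: M that)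
    qed
    show "g x \<in> hor G" if "x \<in> \<Omega>" for x
      using closed_sequentially[OF closed_subspace[OF subspace_hor] _ lim(2)[OF that]] hgrad_hor by blast
    show "(\<lambda>n. Lp_pow p \<Omega> (\<lambda>x. \<phi> n x - f x)) \<longlonglongrightarrow> 0"
      using M lim by (intro Lp_pow_bounded_convergence[where M = M] lmeasurable_domain p0 m\<phi> mf) auto
    show "(\<lambda>n. Lp_pow p \<Omega> (\<lambda>x. hgrad G (\<phi> n) x - g x)) \<longlonglongrightarrow> 0"
      using M lim by (intro Lp_pow_bounded_convergence[where M = M] lmeasurable_domain p0 m\<phi> mg) auto
  qed
qed

lemma hgrad_diff:
  assumes "f differentiable (at x)" "g differentiable (at x)"
  shows "hgrad G (\<lambda>x. f x - g x) x = hgrad G f x - hgrad G g x"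
proof -
  obtain D E where DE: "(f has_derivative D) (at x)" "(g has_derivative E) (at x)"
    using assms by (auto simp: differentiable_def)
  show ?thesis
    by (simp add: hgrad_def Xfield_eq[OF has_derivative_diff[OF DE]] Xfield_eq[OF DE(1)] Xfield_eq[OF DE(2)]
        scaleR_diff_left sum_subtractf)
qed

lemma test_functions_diff:
  assumes "\<phi> \<in> test_functions \<Omega>" "\<psi> \<in> test_functions \<Omega>"
  shows "(\<lambda>x. \<phi> x - \<psi> x) \<in> test_functions \<Omega>"
proof -
  note t = test_functionD[OF assms(1)] test_functionD[OF assms(2)]
  have sub: "closure {x. \<phi> x - \<psi> x \<noteq> 0} \<subseteq> closure {x. \<phi> x \<noteq> 0} \<union> closure {x. \<psi> x \<noteq> 0}"
    unfolding closure_Un[symmetric] by (intro closure_mono) auto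
  moreover have "compact (closure {x. \<phi> x - \<psi> x \<noteq> 0})"
    unfolding compact_closure
    using bounded_subset[OF _ order_trans[OF closure_subset sub]] t compact_imp_bounded by blast
  ultimately show ?thesis
    using t by (auto simp: test_functions_def intro!: Ck_diff)
qed

lemma Lp_pow_diff_tendsto_0:
  fixes u v :: "'g \<Rightarrow> 'b::euclidean_space"
  assumes "u \<in> Lp p \<Omega>" "v \<in> Lp p \<Omega>" "\<And>n. s n \<in> Lp p \<Omega>" "\<And>n. t n \<in> Lp p \<Omega>"
    and lim: "(\<lambda>n. Lp_pow p \<Omega> (\<lambda>x. s n x - u x)) \<longlonglongrightarrow> 0" "(\<lambda>n. Lp_pow p \<Omega> (\<lambda>x. t n x - v x)) \<longlonglongrightarrow> 0"
  shows "(\<lambda>n. Lp_pow p \<Omega> (\<lambda>x. (s n x - t n x) - (u x - v x))) \<longlonglongrightarrow> 0"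
proof (rule Lim_null_comparison[OF always_eventually], rule allI)
  fix n
  have "(\<lambda>x. (s n x - t n x) - (u x - v x)) = (\<lambda>x. (s n x - u x) - (t n x - v x))"
    by (simp add: algebra_simps)
  then show "norm (Lp_pow p \<Omega> (\<lambda>x. (s n x - t n x) - (u x - v x)))
      \<le> 2 powr p * (Lp_pow p \<Omega> (\<lambda>x. s n x - u x) + Lp_pow p \<Omega> (\<lambda>x. t n x - v x))"
    using Lp_diff(2)[OF p Lp_diff(1)[OF p assms(3)[of n] assms(1)] Lp_diff(1)[OF p assms(4)[of n] assms(2)]]
    by (simp add: Lp_pow_nonneg)
next
  show "(\<lambda>n. 2 powr p * (Lp_pow p \<Omega> (\<lambda>x. s n x - u x) + Lp_pow p \<Omega> (\<lambda>x. t n x - v x))) \<longlonglongrightarrow> 0"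
    by (auto intro!: tendsto_eq_intros lim)
qed

lemma W0_diff:
  assumes "W0 G p \<Omega> u g" "W0 G p \<Omega> v h"
  shows "W0 G p \<Omega> (\<lambda>x. u x - v x) (\<lambda>x. g x - h x)"
proof -
  note d = W0_D[OF assms(1)] W0_D[OF assms(2)]
  obtain \<phi> where \<phi>: "\<And>n. \<phi> n \<in> test_functions \<Omega>"
    "(\<lambda>n. Lp_pow p \<Omega> (\<lambda>x. \<phi> n x - u x)) \<longlonglongrightarrow> 0" "(\<lambda>n. Lp_pow p \<Omega> (\<lambda>x. hgrad G (\<phi> n) x - g x)) \<longlonglongrightarrow> 0"
    using W0E[OF assms(1)] by blast
  obtain \<psi> where \<psi>: "\<And>n. \<psi> n \<in> test_functions \<Omega>"
    "(\<lambda>n. Lp_pow p \<Omega> (\<lambda>x. \<psi> n x - v x)) \<longlonglongrightarrow> 0" "(\<lambda>n. Lp_pow p \<Omega> (\<lambda>x. hgrad G (\<psi> n) x - h x)) \<longlonglongrightarrow> 0"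
    using W0E[OF assms(2)] by blast
  have hg: "hgrad G (\<lambda>x. \<phi> n x - \<psi> n x) x = hgrad G (\<phi> n) x - hgrad G (\<psi> n) x" for n x
    using test_functionD(1)[OF \<phi>(1), THEN Ck_Suc_differentiable] test_functionD(1)[OF \<psi>(1), THEN Ck_Suc_differentiable]
    by (rule hgrad_diff)
  show ?thesis
  proof (rule W0I[where \<phi> = "\<lambda>n x. \<phi> n x - \<psi> n x"])
    show "(\<lambda>x. u x - v x) \<in> Lp p \<Omega>" "(\<lambda>x. g x - h x) \<in> Lp p \<Omega>"
      using d by (auto intro: Lp_diff(1)[OF p])
    show "g x - h x \<in> hor G" if "x \<in> \<Omega>" for x
      using d that by (auto intro: subspace_diff subspace_hor)
    show "(\<lambda>x. \<phi> n x - \<psi> n x) \<in> test_functions \<Omega>" for n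
      using \<phi>(1) \<psi>(1) by (rule test_functions_diff)
    show "(\<lambda>n. Lp_pow p \<Omega> (\<lambda>x. \<phi> n x - \<psi> n x - (u x - v x))) \<longlonglongrightarrow> 0"
      by (rule Lp_pow_diff_tendsto_0) (use d \<phi> \<psi> test_function_Lp in auto)
    show "(\<lambda>n. Lp_pow p \<Omega> (\<lambda>x. hgrad G (\<lambda>x. \<phi> n x - \<psi> n x) x - (g x - h x))) \<longlonglongrightarrow> 0"
      unfolding hg by (rule Lp_pow_diff_tendsto_0) (use d \<phi> \<psi> test_function_Lp in auto)
  qed
qed

text \<open>Since \<open>a\<close> and \<open>b\<close> are bounded, both sides are continuous under
  the convergence that defines \<open>W0\<close>, where test functions are dense.\<close>

lemma W0_integral_eq:
  assumes w: "W0 G p \<Omega> f g"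
    and a: "a \<in> borel_measurable (lebesgue_on \<Omega>)" "\<And>x. x \<in> \<Omega> \<Longrightarrow> norm (a x) \<le> A"
    and b: "b \<in> borel_measurable (lebesgue_on \<Omega>)" "\<And>x. x \<in> \<Omega> \<Longrightarrow> \<bar>b x\<bar> \<le> B"
    and eq: "\<And>\<phi>. \<phi> \<in> test_functions \<Omega> \<Longrightarrow>
      (\<integral>x. a x \<bullet> hgrad G \<phi> x \<partial>lebesgue_on \<Omega>) = (\<integral>x. b x * \<phi> x \<partial>lebesgue_on \<Omega>)"
  shows "(\<integral>x. a x \<bullet> g x \<partial>lebesgue_on \<Omega>) = (\<integral>x. b x * f x \<partial>lebesgue_on \<Omega>)"
proof -
  obtain \<phi> where \<phi>: "\<And>n. \<phi> n \<in> test_functions \<Omega>"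
    "(\<lambda>n. Lp_pow p \<Omega> (\<lambda>x. \<phi> n x - f x)) \<longlonglongrightarrow> 0" "(\<lambda>n. Lp_pow p \<Omega> (\<lambda>x. hgrad G (\<phi> n) x - g x)) \<longlonglongrightarrow> 0"
    using W0E[OF w] by blast
  have "(\<lambda>n. \<integral>x. a x \<bullet> hgrad G (\<phi> n) x \<partial>lebesgue_on \<Omega>) \<longlonglongrightarrow> (\<integral>x. a x \<bullet> g x \<partial>lebesgue_on \<Omega>)"
    using a by (rule Lp_tendsto_integral_inner[OF lmeasurable_domain p _ _ test_function_Lp(2)[OF \<phi>(1)] W0_D(2)[OF w] \<phi>(3)])
  moreover have "(\<lambda>n. \<integral>x. b x \<bullet> \<phi> n x \<partial>lebesgue_on \<Omega>) \<longlonglongrightarrow> (\<integral>x. b x \<bullet> f x \<partial>lebesgue_on \<Omega>)"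
    using b by (intro Lp_tendsto_integral_inner[where A = B, OF lmeasurable_domain p _ _ test_function_Lp(1)[OF \<phi>(1)] W0_D(1)[OF w] \<phi>(2)]) auto
  ultimately show ?thesis
    unfolding eq[OF \<phi>(1)] inner_real_def by (rule LIMSEQ_unique)
qed

text \<open>Integrate \<open>X\<^sub>e ((x \<bullet> e) |\<phi>|\<^sup>p)\<close> and use \<open>X\<^sub>e (x \<bullet> e) = 1\<close>.\<close>

lemma poincare:
  obtains C where "\<And>\<phi>. \<phi> \<in> test_functions \<Omega> \<Longrightarrow> Lp_pow p \<Omega> \<phi> \<le> C * Lp_pow p \<Omega> (hgrad G \<phi>)"
proof -
  obtain e where e: "e \<in> hbasis G" using hbasis_nonempty by blast
  have eh: "e \<in> hor G" using e by (rule hbasis_hor)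
  have ne: "norm e = 1" using hbasis e by (auto simp: orthonormal_basis_def)
  obtain r where r: "0 < r" "\<And>x. x \<in> \<Omega> \<Longrightarrow> norm x \<le> r"
    using bounded_domain by (auto simp: bounded_pos)
  \<comment> \<open>Chosen so that \<open>r * p * K = 1/2\<close>: half of the integral of
    \<open>F\<close> then appears on the right and is absorbed on the left.\<close>
  define K where "K = 1 / (2 * r * p)"
  have K: "0 < K" using r p by (simp add: K_def)
  show thesis
  proof (rule that)
    fix \<phi> assume \<phi>: "\<phi> \<in> test_functions \<Omega>"
    note t = test_functionD[OF \<phi>] test_function_outside[OF \<phi>]
    define F where "F x = \<bar>\<phi> x\<bar> powr p" for x
    define D where "D x = p * \<bar>\<phi> x\<bar> powr (p - 1) * sgn (\<phi> x) * Xfield G e \<phi> x" for x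
    have CF: "Ck (Suc 0) F" unfolding F_def[abs_def] by (intro Ck_1_abs_powr p t(1))
    have XF: "Xfield G e F x = D x" for x
      using Xfield_compose[OF Ck_Suc_differentiable[OF t(1)] abs_powr_has_real_derivative[OF p]]
      by (simp add: F_def[abs_def] D_def)
    have Xe: "Xfield G e (\<lambda>x. x \<bullet> e) x = 1" for x
      using Xfield_eq[OF bounded_linear.has_derivative[OF bounded_linear_inner_left[of e] has_derivative_ident], of e x]
        udir_inner_hor[OF eh eh] orthonormal_basis_inner[OF hbasis e e] by simp
    have "Xfield G e (\<lambda>x. (x \<bullet> e) * F x) x = (x \<bullet> e) * D x + F x" for x
      using Xfield_mult[OF Ck_Suc_differentiable[OF Ck_inner[where a = e]] Ck_Suc_differentiable[OF CF], of e x]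
      by (simp add: XF Xe)
    moreover have "compact (closure {x. (x \<bullet> e) * F x \<noteq> 0})"
      using t(2) unfolding compact_closure by (rule bounded_subset) (auto simp: F_def)
    then have "(\<integral>x. Xfield G e (\<lambda>x. (x \<bullet> e) * F x) x \<partial>lborel) = 0"
      by (intro integral_Xfield_eq_0 Ck_mult Ck_inner CF eh)
    moreover have cD: "continuous_on UNIV D" using continuous_Xfield[OF CF eh] by (simp add: XF[abs_def])
    have cxD: "continuous_on UNIV (\<lambda>x. (x \<bullet> e) * D x)" by (intro continuous_intros cD)
    have iD: "integrable lborel (\<lambda>x. (x \<bullet> e) * D x)"
      by (rule continuous_compact_support_integrable[OF cxD t(2)], drule t(5)[of _ e]) (simp add: D_def)
    have iF: "integrable lborel F"
      by (rule continuous_compact_support_integrable[OF Ck_imp_continuous[OF CF] t(2)], drule t(4)) (simp add: F_def)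
    have ch: "continuous_on UNIV (\<lambda>x. norm (hgrad G \<phi> x) powr p)"
      using p by (intro continuous_on_powr' continuous_on_norm continuous_hgrad t(1) continuous_on_const) auto
    have ih: "integrable lborel (\<lambda>x. norm (hgrad G \<phi> x) powr p)"
      by (rule continuous_compact_support_integrable[OF ch t(2)], drule t(6)) simp
    ultimately have "(\<integral>x. F x \<partial>lborel) = (\<integral>x. - ((x \<bullet> e) * D x) \<partial>lborel)"
      using iD iF by simp
    also have "\<dots> \<le> (\<integral>x. 1/2 * F x + r * p * K powr (1 - p) * norm (hgrad G \<phi> x) powr p \<partial>lborel)"
    proof (rule integral_mono)
      fix x
      show "- ((x \<bullet> e) * D x) \<le> 1/2 * F x + r * p * K powr (1 - p) * norm (hgrad G \<phi> x) powr p"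
      proof (cases "x \<in> \<Omega>")
        case True
        have "\<bar>x \<bullet> e\<bar> \<le> r" using Cauchy_Schwarz_ineq2[of x e] r(2)[OF True] ne by simp
        have sg: "\<bar>sgn (\<phi> x)\<bar> \<le> 1" by (simp add: sgn_if)
        have "- ((x \<bullet> e) * D x) \<le> \<bar>x \<bullet> e\<bar> * \<bar>D x\<bar>" by (simp add: abs_mult[symmetric])
        also have "\<dots> \<le> r * (p * (\<bar>\<phi> x\<bar> powr (p - 1) * norm (hgrad G \<phi> x)))"
        proof (rule mult_mono)
          have "\<bar>D x\<bar> = p * (\<bar>\<phi> x\<bar> powr (p - 1) * (\<bar>sgn (\<phi> x)\<bar> * \<bar>Xfield G e \<phi> x\<bar>))"
            using p by (simp add: D_def abs_mult)
          also have "\<dots> \<le> p * (\<bar>\<phi> x\<bar> powr (p - 1) * (1 * norm (hgrad G \<phi> x)))"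
            using p sg Xfield_le_hgrad[OF e, of \<phi> x] by (intro mult_left_mono mult_mono) auto
          finally show "\<bar>D x\<bar> \<le> p * (\<bar>\<phi> x\<bar> powr (p - 1) * norm (hgrad G \<phi> x))" by simp
        qed (use r \<open>\<bar>x \<bullet> e\<bar> \<le> r\<close> in auto)
        also have "\<dots> \<le> r * (p * (K * \<bar>\<phi> x\<bar> powr p + K powr (1 - p) * norm (hgrad G \<phi> x) powr p))"
          using r p K by (intro mult_left_mono young_powr) auto
        also have "\<dots> = 1/2 * F x + r * p * K powr (1 - p) * norm (hgrad G \<phi> x) powr p"
          using r p by (simp add: F_def K_def algebra_simps)
        finally show ?thesis .
      next
        case False
        then have "\<phi> x = 0" by (rule test_function_outside_domain[OF \<phi>])
        then show ?thesis using r p by (simp add: D_def F_def)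
      qed
    qed (use iD iF ih in auto)
    also have "\<dots> = 1/2 * (\<integral>x. F x \<partial>lborel) + r * p * K powr (1 - p) * (\<integral>x. norm (hgrad G \<phi> x) powr p \<partial>lborel)"
      using iF ih by simp
    finally have *: "(\<integral>x. F x \<partial>lborel) \<le> (2 * r * p * K powr (1 - p)) * (\<integral>x. norm (hgrad G \<phi> x) powr p \<partial>lborel)"
      by simp
    have "Lp_pow p \<Omega> \<phi> = (\<integral>x. F x \<partial>lborel)"
      unfolding Lp_pow_def F_def real_norm_def
      using Ck_imp_continuous[OF CF]
      by (intro integral_lebesgue_on_eq_lborel borel_domain borel_measurable_continuous_onI)
        (simp_all add: F_def[abs_def] test_function_outside_domain[OF \<phi>])
    moreover have "Lp_pow p \<Omega> (hgrad G \<phi>) = (\<integral>x. norm (hgrad G \<phi> x) powr p \<partial>lborel)"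
      unfolding Lp_pow_def
      by (intro integral_lebesgue_on_eq_lborel borel_domain borel_measurable_continuous_onI ch)
        (simp add: test_function_outside_domain[OF \<phi>])
    ultimately show "Lp_pow p \<Omega> \<phi> \<le> (2 * r * p * K powr (1 - p)) * Lp_pow p \<Omega> (hgrad G \<phi>)"
      using * by simp
  qed
qed

text \<open>The gradients of the approximating test functions tend to 0, so by the Poincare
  inequality the test functions themselves tend to 0, while they also tend to
  \<open>f\<close>.\<close>

lemma W0_zero_gradient:
  assumes w: "W0 G p \<Omega> f g" and g: "AE x in lebesgue_on \<Omega>. g x = 0"
  shows "AE x in lebesgue_on \<Omega>. f x = 0"
proof -
  obtain \<phi> where \<phi>: "\<And>n. \<phi> n \<in> test_functions \<Omega>"
    "(\<lambda>n. Lp_pow p \<Omega> (\<lambda>x. \<phi> n x - f x)) \<longlonglongrightarrow> 0" "(\<lambda>n. Lp_pow p \<Omega> (\<lambda>x. hgrad G (\<phi> n) x - g x)) \<longlonglongrightarrow> 0"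
    using W0E[OF w] by blast
  obtain C where C: "\<And>\<phi>. \<phi> \<in> test_functions \<Omega> \<Longrightarrow> Lp_pow p \<Omega> \<phi> \<le> C * Lp_pow p \<Omega> (hgrad G \<phi>)"
    using poincare by blast
  note L = test_function_Lp[OF \<phi>(1)] W0_D(1,2)[OF w]
  have "Lp_pow p \<Omega> (\<lambda>x. hgrad G (\<phi> n) x - g x) = Lp_pow p \<Omega> (hgrad G (\<phi> n))" for n
    unfolding Lp_pow_def
  proof (rule integral_cong_AE)
    show "AE x in lebesgue_on \<Omega>. norm (hgrad G (\<phi> n) x - g x) powr p = norm (hgrad G (\<phi> n) x) powr p"
      using g by eventually_elim simp
    have [measurable]: "hgrad G (\<phi> n) \<in> borel_measurable (lebesgue_on \<Omega>)" "g \<in> borel_measurable (lebesgue_on \<Omega>)"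
      using L by (auto simp: Lp_def)
    show "(\<lambda>x. norm (hgrad G (\<phi> n) x - g x) powr p) \<in> borel_measurable (lebesgue_on \<Omega>)"
      "(\<lambda>x. norm (hgrad G (\<phi> n) x) powr p) \<in> borel_measurable (lebesgue_on \<Omega>)"
      by measurable
  qed
  then have lim: "(\<lambda>n. Lp_pow p \<Omega> (hgrad G (\<phi> n))) \<longlonglongrightarrow> 0" using \<phi>(3) by simp
  have "Lp_pow p \<Omega> f \<le> 2 powr p * (C * Lp_pow p \<Omega> (hgrad G (\<phi> n)) + Lp_pow p \<Omega> (\<lambda>x. \<phi> n x - f x))" for n
  proof -
    have "Lp_pow p \<Omega> (\<lambda>x. \<phi> n x - (\<phi> n x - f x)) \<le> 2 powr p * (Lp_pow p \<Omega> (\<phi> n) + Lp_pow p \<Omega> (\<lambda>x. \<phi> n x - f x))"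
      by (intro Lp_diff p L)
    also have "\<dots> \<le> 2 powr p * (C * Lp_pow p \<Omega> (hgrad G (\<phi> n)) + Lp_pow p \<Omega> (\<lambda>x. \<phi> n x - f x))"
      using C[OF \<phi>(1)] by (intro mult_left_mono add_right_mono) auto
    finally show ?thesis by simp
  qed
  moreover have "(\<lambda>n. 2 powr p * (C * Lp_pow p \<Omega> (hgrad G (\<phi> n)) + Lp_pow p \<Omega> (\<lambda>x. \<phi> n x - f x))) \<longlonglongrightarrow> 2 powr p * (C * 0 + 0)"
    by (intro tendsto_intros lim \<phi>)
  ultimately have "Lp_pow p \<Omega> f \<le> 0"
    using LIMSEQ_le_const by fastforce
  then show ?thesis
    using Lp_pow_nonneg[of p \<Omega> f] by (intro Lp_pow_eq_0_AE[where p = p] L) auto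
qed

lemma weak_solution_unique:
  assumes "weak_solution G p \<Omega> \<rho> u" "weak_solution G p \<Omega> \<rho> v"
  shows "AE x in lebesgue_on \<Omega>. u x = v x"
proof -
  let ?M = "lebesgue_on \<Omega>"
  obtain g where g: "W0 G p \<Omega> u g"
    "\<And>\<phi> \<psi>. W0 G p \<Omega> \<phi> \<psi> \<Longrightarrow> (\<integral>x. norm (g x) powr (p - 2) * (g x \<bullet> \<psi> x) \<partial>?M) = (\<integral>x. \<rho> x * \<phi> x \<partial>?M)"
    using assms(1) unfolding weak_solution_def by blast
  obtain h where h: "W0 G p \<Omega> v h"
    "\<And>\<phi> \<psi>. W0 G p \<Omega> \<phi> \<psi> \<Longrightarrow> (\<integral>x. norm (h x) powr (p - 2) * (h x \<bullet> \<psi> x) \<partial>?M) = (\<integral>x. \<rho> x * \<phi> x \<partial>?M)"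
    using assms(2) unfolding weak_solution_def by blast
  define w where "w x = g x - h x" for x
  have W: "W0 G p \<Omega> (\<lambda>x. u x - v x) w"
    unfolding w_def[abs_def] by (rule W0_diff[OF g(1) h(1)])
  \<comment> \<open>A non-integrable function would have the default integral 0, so the two
    equations may be subtracted only once integrability is known; Young's inequality with
    \<open>K = 1\<close> supplies it.\<close>
  have int: "integrable ?M (\<lambda>x. norm (a x) powr (p - 2) * (a x \<bullet> b x))"
    if "a \<in> Lp p \<Omega>" "b \<in> Lp p \<Omega>" for a b :: "'g \<Rightarrow> 'g"
  proof -
    have [measurable]: "a \<in> borel_measurable ?M" "b \<in> borel_measurable ?M"
      using that by (auto simp: Lp_def)
    have "integrable ?M (\<lambda>x. norm (a x) powr p + norm (b x) powr p)"
      using that by (auto simp: Lp_def)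
    then show ?thesis
    proof (rule Bochner_Integration.integrable_bound)
      show "AE x in ?M. norm (norm (a x) powr (p - 2) * (a x \<bullet> b x)) \<le> norm (norm (a x) powr p + norm (b x) powr p)"
      proof (rule AE_I2)
        fix x
        have "norm (norm (a x) powr (p - 2) * (a x \<bullet> b x)) \<le> norm (a x) powr (p - 2) * (norm (a x) * norm (b x))"
          using Cauchy_Schwarz_ineq2[of "a x" "b x"] by (auto simp: abs_mult intro!: mult_left_mono)
        also have "\<dots> = norm (a x) powr (p - 1) * norm (b x)"
          using powr_minus_2_mult(1)[of "norm (a x)" p] by (simp add: mult.assoc[symmetric])
        also have "\<dots> \<le> norm (a x) powr p + norm (b x) powr p"
          using young_powr[of "norm (a x)" "norm (b x)" 1 p] p by simp
        finally show "norm (norm (a x) powr (p - 2) * (a x \<bullet> b x)) \<le> norm (norm (a x) powr p + norm (b x) powr p)" by simp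
      qed
    qed measurable
  qed
  define d where "d x = (norm (g x) powr (p - 2) *\<^sub>R g x - norm (h x) powr (p - 2) *\<^sub>R h x) \<bullet> (g x - h x)" for x
  have d: "d x = norm (g x) powr (p - 2) * (g x \<bullet> w x) - norm (h x) powr (p - 2) * (h x \<bullet> w x)" for x
    by (simp add: d_def w_def inner_diff_left)
  have i: "integrable ?M (\<lambda>x. norm (g x) powr (p - 2) * (g x \<bullet> w x))"
    "integrable ?M (\<lambda>x. norm (h x) powr (p - 2) * (h x \<bullet> w x))"
    using W0_D(2)[OF g(1)] W0_D(2)[OF h(1)] W0_D(2)[OF W] by (auto intro: int)
  then have "integrable ?M d" unfolding d[abs_def] by simp
  moreover have "(\<integral>x. d x \<partial>?M) = 0"
    unfolding d using i g(2)[OF W] h(2)[OF W] by simp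
  moreover have "0 \<le> d x" for x unfolding d_def by (rule powr_monotone_vector(1)[OF p])
  ultimately have "AE x in ?M. d x = 0"
    by (subst (asm) integral_nonneg_eq_0_iff_AE) auto
  then have "AE x in ?M. w x = 0"
    by eventually_elim (use powr_monotone_vector(2)[OF p] in \<open>auto simp: d_def w_def\<close>)
  from W0_zero_gradient[OF W this] show ?thesis by simp
qed

end

section \<open>The explicit solution on balls\<close>

context heisenberg_group
begin

section \<open>Homogeneous balls as sublevel sets of a polynomial\<close>

lemma mem_hom_ball_iff:
  assumes "0 < R"
  shows "x \<in> hom_ball G R \<longleftrightarrow> N4 x < R ^ 4"
proof -
  have "R = (R ^ 4) powr (1/4)"
    using assms by (simp add: powr_powr flip: powr_numeral)
  then have "x \<in> hom_ball G R \<longleftrightarrow> N4 x powr (1/4) < (R ^ 4) powr (1/4)"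
    by (simp add: hom_ball_def hom_norm_eq)
  also have "\<dots> \<longleftrightarrow> N4 x < R ^ 4"
    using powr_less_mono2[of "1/4" "N4 x" "R ^ 4"] powr_mono2[of "1/4" "R ^ 4" "N4 x"] N4_nonneg[of x] assms
    by (meson linorder_not_less powr_less_mono2 zero_less_divide_1_iff zero_less_numeral
        order_less_imp_le zero_less_power)
  finally show ?thesis .
qed

lemma continuous_N4: "continuous_on UNIV N4"
  by (rule Ck_imp_continuous[OF Ck_N4])

lemma open_hom_ball:
  assumes "0 < R"
  shows "open (hom_ball G R)"
proof -
  have "hom_ball G R = {x. N4 x < R ^ 4}" using mem_hom_ball_iff[OF assms] by blast
  then show ?thesis
    using open_Collect_less[OF continuous_N4 continuous_on_const, of "R ^ 4"] by simp
qed

lemma norm_zpart_le: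
  assumes "0 \<le> r" "N4 x \<le> r ^ 4"
  shows "norm (zpart G x) \<le> r"
  using order_trans[OF zpart_le_N4 assms(2)] assms(1) by simp

lemma bounded_hom_ball:
  assumes "0 < R"
  shows "bounded (hom_ball G R)"
proof (rule boundedI)
  fix x assume "x \<in> hom_ball G R"
  then have N: "N4 x < R ^ 4" using assms by (simp add: mem_hom_ball_iff)
  have "norm (spart G x) ^ 2 \<le> (R\<^sup>2)\<^sup>2"
    using N by (simp add: N4_def power2_norm_eq_inner flip: power_mult)
      (smt (verit) inner_ge_zero zero_le_power2)
  then have "norm (spart G x) \<le> R\<^sup>2" by (rule power2_le_imp_le) simp
  moreover have "norm (zpart G x) \<le> R" using N assms by (intro norm_zpart_le) auto
  ultimately show "norm x \<le> R + R\<^sup>2"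
    using norm_triangle_ineq[of "zpart G x" "spart G x"] by (simp add: zpart_plus_spart)
qed

lemma frontier_hom_ball:
  assumes "0 < R" "x \<in> frontier (hom_ball G R)"
  shows "N4 x = R ^ 4"
proof -
  have "x \<in> closure (hom_ball G R)" "x \<notin> hom_ball G R"
    using assms interior_open[OF open_hom_ball] by (auto simp: frontier_def)
  moreover have "closed {x. N4 x \<le> R ^ 4}"
    by (intro closed_Collect_le continuous_N4 continuous_on_const)
  then have "closure (hom_ball G R) \<subseteq> {x. N4 x \<le> R ^ 4}"
    using assms by (intro closure_minimal) (auto simp: mem_hom_ball_iff)
  ultimately show ?thesis using assms by (force simp: mem_hom_ball_iff)
qed

text \<open>\<open>V\<close> is a quarter of the horizontal gradient of the polynomial
  \<open>N4\<close>, so its continuity can be read off without touching the description that defines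
  \<open>Jmap\<close>.\<close>

lemma continuous_V: "continuous_on UNIV V"
proof -
  have "hgrad G N4 x = 4 *\<^sub>R V x" for x
    by (rule hgrad_eqI) (auto simp: Xfield_N4 hbasis_hor intro: subspace_scale subspace_hor V_hor)
  then have "V x = (1/4) *\<^sub>R hgrad G N4 x" for x by simp
  then show ?thesis
    using continuous_hgrad[OF Ck_N4] by (simp add: continuous_on_scaleR[OF continuous_on_const])
qed

text \<open>These are the points where a factor with a possibly negative exponent multiplies
  \<open>V\<close>: a power of \<open>N4\<close> in the gradient, a power of |z| in the flux. There
  the products are 0 and no limit of powers has to be taken.\<close>

lemma V_eq_0: "N4 x = 0 \<Longrightarrow> V x = 0" "zpart G x = 0 \<Longrightarrow> V x = 0"
  using norm_V[of x] by auto

lemma hgrad_compose_N4: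
  assumes "(h has_real_derivative h') (at (N4 x))"
  shows "hgrad G (\<lambda>x. h (N4 x)) x = (4 * h') *\<^sub>R V x"
proof (rule hgrad_eqI)
  show "(4 * h') *\<^sub>R V x \<in> hor G" by (intro subspace_scale subspace_hor V_hor)
  fix e assume "e \<in> hbasis G"
  then show "Xfield G e (\<lambda>x. h (N4 x)) x = (4 * h') *\<^sub>R V x \<bullet> e"
    using Xfield_compose[OF Ck_Suc_differentiable[OF Ck_N4] assms] by (simp add: Xfield_N4 hbasis_hor)
qed

section \<open>The horizontal divergence of V\<close>

lemma Xfield_zpart_sq:
  assumes "e \<in> hor G"
  shows "Xfield G e (\<lambda>x. zpart G x \<bullet> zpart G x) x = 2 * (x \<bullet> e)"
proof -
  have "((\<lambda>x. zpart G x \<bullet> zpart G x) has_derivative (\<lambda>h. 2 * (zpart G x \<bullet> zpart G h))) (at x)"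
    by (rule derivative_eq_intros bounded_linear.has_derivative[OF bounded_linear_zpart] refl)+
      (auto simp: fun_eq_iff inner_commute)
  then show ?thesis by (simp add: Xfield_eq zpart_udir[OF assms] zpart_inner[OF assms])
qed

text \<open>Differentiating the bracket term in its first argument yields
  \<open>lie G e e = 0\<close>; in its second argument it meets the vertical part of
  \<open>udir e x\<close>, half of \<open>lie G (zpart G x) e\<close>, which turns the factor 4 into
  2.\<close>

lemma Xfield_V_inner:
  assumes "e \<in> hbasis G"
  shows "Xfield G e (\<lambda>x. V x \<bullet> e) x = 2 * (x \<bullet> e)\<^sup>2 + zpart G x \<bullet> zpart G x
     + 2 * (lie G (zpart G x) e \<bullet> lie G (zpart G x) e)"
proof -
  have e: "e \<in> hor G" by (rule hbasis_hor) fact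
  have bl: "bounded_linear (\<lambda>x. lie G (zpart G x) e)"
    unfolding linear_conv_bounded_linear[symmetric]
    by (intro linearI)
      (auto simp: linear_add[OF linear_zpart] linear_scale[OF linear_zpart]
        bilinear_ladd[OF bilinear_lie] bilinear_lmul[OF bilinear_lie])
  have "((\<lambda>x. V x \<bullet> e) has_derivative (\<lambda>h. 2 * (zpart G x \<bullet> zpart G h) * (x \<bullet> e)
      + (zpart G x \<bullet> zpart G x) * (h \<bullet> e)
      + 4 * (lie G (zpart G h) e \<bullet> x + lie G (zpart G x) e \<bullet> h))) (at x)"
    unfolding V_inner[OF e]
    by (rule derivative_eq_intros bounded_linear.has_derivative[OF bounded_linear_zpart]
        bounded_linear.has_derivative[OF bl] refl)+
      (auto simp: fun_eq_iff inner_commute algebra_simps)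
  moreover have "lie G (zpart G x) e \<bullet> udir e x = 1/2 * (lie G (zpart G x) e \<bullet> lie G (zpart G x) e)"
    using udir_inner_ver[OF e lie_ver[OF zpart_hor e]] by (simp add: inner_commute)
  moreover have "udir e x \<bullet> e = 1"
    using udir_inner_hor[OF e e] orthonormal_basis_inner[OF hbasis assms assms] by simp
  ultimately show ?thesis
    by (simp add: Xfield_eq zpart_udir[OF e] zpart_inner[OF e] lie_self power2_eq_square)
qed

text \<open>Write m and k for the dimensions of the layers. The three terms sum to 2 |z|^2, m |z|^2
  and 2 k |z|^2; the last one because, after exchanging the two sums, each of the k maps
  \<open>Jmap G s\<close> preserves the length of z. Since Q = m + 2 k, the total is (Q + 2)
  |z|^2.\<close>

lemma sum_Xfield_V:
  "(\<Sum>e\<in>hbasis G. Xfield G e (\<lambda>x. V x \<bullet> e) x)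
     = (real (homogeneous_dim G) + 2) * (zpart G x \<bullet> zpart G x)"
proof -
  let ?z = "zpart G x"
  have "lie G ?z e \<bullet> lie G ?z e = (\<Sum>s\<in>vbasis G. (Jmap G s ?z \<bullet> e) * (Jmap G s ?z \<bullet> e))"
    if "e \<in> hbasis G" for e
    using orthonormal_basis_parseval[OF vbasis lie_ver[OF zpart_hor hbasis_hor[OF that]]]
    by (simp add: Jmap_inner[OF hbasis_hor[OF that]])
  then have "(\<Sum>e\<in>hbasis G. lie G ?z e \<bullet> lie G ?z e)
      = (\<Sum>e\<in>hbasis G. \<Sum>s\<in>vbasis G. (Jmap G s ?z \<bullet> e) * (Jmap G s ?z \<bullet> e))"
    by (rule sum.cong[OF refl])
  also have "\<dots> = (\<Sum>s\<in>vbasis G. \<Sum>e\<in>hbasis G. (Jmap G s ?z \<bullet> e) * (Jmap G s ?z \<bullet> e))"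
    by (rule sum.swap)
  also have "\<dots> = (\<Sum>s\<in>vbasis G. (?z \<bullet> ?z))"
    by (intro sum.cong refl)
      (simp add: orthonormal_basis_parseval[OF hbasis Jmap_hor] norm_Jmap[OF vbasis_ver zpart_hor]
        orthonormal_basis_inner[OF vbasis])
  also have "\<dots> = real (dim (ver G)) * (?z \<bullet> ?z)"
    by (simp add: orthonormal_basis_card[OF vbasis])
  finally have L: "(\<Sum>e\<in>hbasis G. lie G ?z e \<bullet> lie G ?z e) = real (dim (ver G)) * (?z \<bullet> ?z)" .
  have "(\<Sum>e\<in>hbasis G. (x \<bullet> e)\<^sup>2) = ?z \<bullet> ?z"
    using orthonormal_basis_parseval[OF hbasis zpart_hor, of x ?z]
    by (simp add: power2_eq_square zpart_inner[OF hbasis_hor])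
  then show ?thesis
    by (simp add: Xfield_V_inner sum.distrib sum_distrib_left[symmetric] L
        orthonormal_basis_card[OF hbasis] homogeneous_dim_def algebra_simps)
qed

end

locale heisenberg_ball = heisenberg_group G for G :: "'g::euclidean_space htype" +
  fixes p R :: real
  assumes p_gt_1: "1 < p" and R_pos: "0 < R"

sublocale heisenberg_ball \<subseteq> heisenberg_domain G "hom_ball G R" p
  by standard (use open_hom_ball bounded_hom_ball p_gt_1 R_pos in auto)

context heisenberg_ball
begin

abbreviation "B \<equiv> hom_ball G R"
abbreviation "Q \<equiv> real (homogeneous_dim G)"
abbreviation "q x \<equiv> zpart G x \<bullet> zpart G x"

lemma mem_B: "x \<in> B \<longleftrightarrow> N4 x < R ^ 4"
  by (rule mem_hom_ball_iff[OF R_pos])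

lemma q_le: "x \<in> B \<Longrightarrow> q x \<le> R\<^sup>2"
  using norm_zpart_le[of R x] R_pos by (simp add: mem_B dot_square_norm power_mono)

lemma norm_V_le: "x \<in> B \<Longrightarrow> norm (V x) \<le> norm (zpart G x) * R\<^sup>2"
proof -
  assume "x \<in> B"
  then have "sqrt (N4 x) \<le> R\<^sup>2" by (intro real_le_lsqrt) (auto simp: mem_B simp flip: power_mult)
  then show ?thesis unfolding norm_V by (intro mult_left_mono) auto
qed

lemma q_powr: "q x powr (a / 2) = norm (zpart G x) powr a"
  by (cases "zpart G x = 0") (simp_all add: dot_square_norm powr_powr flip: powr_numeral)

text \<open>The flux is singular on \<open>z = 0\<close> when \<open>p < 2\<close>, so \<open>|z|\<^sup>2\<close> is replaced by \<open>|z|\<^sup>2 + \<delta>\<close>.\<close>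

lemma regularized_flux:
  assumes \<phi>: "\<phi> \<in> test_functions B" and \<delta>: "0 < \<delta>"
  shows "(\<integral>x. (q x + \<delta>) powr ((p - 2) / 2) * (V x \<bullet> hgrad G \<phi> x) \<partial>lebesgue_on B)
     = - (\<integral>x. \<phi> x * (q x * (q x + \<delta>) powr ((p - 2) / 2) * (Q + 2 + (p - 2) * (q x / (q x + \<delta>)))) \<partial>lebesgue_on B)"
proof -
  define w where "w x = (q x + \<delta>) powr ((p - 2) / 2)" for x
  define w' where "w' x = (p - 2) / 2 * (q x + \<delta>) powr ((p - 2) / 2 - 1)" for x
  have pos: "0 < q x + \<delta>" for x using \<delta> by (simp add: add_nonneg_pos)
  have Cw: "Ck n w" for n
    unfolding w_def[abs_def] by (intro Ck_powr Ck_add Ck_zpart_sq Ck_const pos)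
  have Xw: "Xfield G e w x = w' x * (2 * (x \<bullet> e))" if "e \<in> hor G" for e x
  proof -
    have "((\<lambda>t. (t + \<delta>) powr ((p - 2) / 2)) has_real_derivative w' x) (at (q x))"
      using pos[of x] by (auto intro!: derivative_eq_intros simp: w'_def)
    from Xfield_compose[OF Ck_Suc_differentiable[OF Ck_zpart_sq] this]
    show ?thesis by (simp add: w_def[abs_def] Xfield_zpart_sq[OF that])
  qed
  define W where "W e x = w x * (V x \<bullet> e)" for e x
  have CW: "Ck n (W e)" if "e \<in> hor G" for n e
    unfolding W_def[abs_def] by (intro Ck_mult Cw Ck_V_inner that)
  have XW: "Xfield G e (W e) x = w x * Xfield G e (\<lambda>x. V x \<bullet> e) x + 2 * w' x * ((V x \<bullet> e) * (zpart G x \<bullet> e))"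
    if "e \<in> hbasis G" for e x
    unfolding W_def[abs_def]
    using Xfield_mult[OF Ck_Suc_differentiable[OF Cw] Ck_Suc_differentiable[OF Ck_V_inner[OF hbasis_hor[OF that]]], of e x]
    by (simp add: Xw hbasis_hor that zpart_inner)
  \<comment> \<open>The gradient of the weight meets \<open>V\<close> only through
    \<open>V x \<bullet> zpart G x = (q x)\<^sup>2\<close>, whence the last term. Where z is not 0,
    the bracket tends to Q + 2 + (p - 2) = Q + p as \<delta> tends to 0.\<close>
  have sumXW: "(\<Sum>e\<in>hbasis G. Xfield G e (W e) x)
      = q x * w x * (Q + 2 + (p - 2) * (q x / (q x + \<delta>)))" for x
  proof -
    have "(\<Sum>e\<in>hbasis G. Xfield G e (W e) x)
        = w x * ((Q + 2) * q x) + 2 * w' x * (q x)\<^sup>2"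
      by (simp add: XW sum.distrib sum_distrib_left[symmetric] sum_Xfield_V
          orthonormal_basis_parseval[OF hbasis V_hor] V_inner_zpart)
    also have "2 * w' x * (q x)\<^sup>2 = w x * q x * ((p - 2) * (q x / (q x + \<delta>)))"
    proof -
      have "w' x = (p - 2) / 2 * (w x / (q x + \<delta>))"
        using pos[of x] by (simp add: w'_def w_def powr_diff)
      moreover have "2 * ((p - 2) / 2 * t) = (p - 2) * t" for t by simp
      ultimately have "2 * w' x = (p - 2) * (w x / (q x + \<delta>))" by (simp only:)
      then show ?thesis by (simp add: power2_eq_square)
    qed
    finally show ?thesis by (simp only: ring_distribs mult_ac)
  qed
  have c1: "integrable (lebesgue_on B) (\<lambda>x. W e x * Xfield G e \<phi> x)"
    and c2: "integrable (lebesgue_on B) (\<lambda>x. \<phi> x * Xfield G e (W e) x)" if "e \<in> hbasis G" for e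
    using hbasis_hor[OF that]
    by (intro continuous_imp_integrable_domain continuous_on_mult continuous_Xfield
        Ck_imp_continuous[OF CW] Ck_imp_continuous[OF test_functionD(1)[OF \<phi>]] CW test_functionD(1)[OF \<phi>];
        simp)+
  have "(\<integral>x. w x * (V x \<bullet> hgrad G \<phi> x) \<partial>lebesgue_on B)
      = (\<integral>x. (\<Sum>e\<in>hbasis G. W e x * Xfield G e \<phi> x) \<partial>lebesgue_on B)"
    by (simp add: inner_hgrad_sum[OF V_hor] W_def sum_distrib_left mult.assoc)
  also have "\<dots> = (\<Sum>e\<in>hbasis G. \<integral>x. W e x * Xfield G e \<phi> x \<partial>lebesgue_on B)"
    by (rule Bochner_Integration.integral_sum[OF c1])
  also have "\<dots> = (\<Sum>e\<in>hbasis G. - (\<integral>x. \<phi> x * Xfield G e (W e) x \<partial>lebesgue_on B))"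
    by (intro sum.cong refl Xfield_integral_by_parts CW hbasis_hor \<phi>)
  also have "\<dots> = - (\<integral>x. (\<Sum>e\<in>hbasis G. \<phi> x * Xfield G e (W e) x) \<partial>lebesgue_on B)"
    by (simp only: sum_negf Bochner_Integration.integral_sum[OF c2])
  also have "\<dots> = - (\<integral>x. \<phi> x * (q x * w x * (Q + 2 + (p - 2) * (q x / (q x + \<delta>)))) \<partial>lebesgue_on B)"
    by (simp only: sum_distrib_left[symmetric] sumXW)
  finally show ?thesis by (simp add: w_def)
qed

text \<open>One factor |z| inside \<open>V\<close> and two in the divergence compensate the weight
  uniformly in \<delta>, so bounded convergence applies to both sides of the regularized
  identity.\<close>

lemma flux_test_function:
  assumes \<phi>: "\<phi> \<in> test_functions B"
  shows "(\<integral>x. norm (zpart G x) powr (p - 2) * (V x \<bullet> hgrad G \<phi> x) \<partial>lebesgue_on B)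
     = - (\<integral>x. \<phi> x * ((Q + p) * norm (zpart G x) powr p) \<partial>lebesgue_on B)"
proof -
  obtain M where M: "\<And>x. \<bar>\<phi> x\<bar> \<le> M" "\<And>x. norm (hgrad G \<phi> x) \<le> M"
    using test_function_bounded[OF \<phi>] by blast
  have M0: "0 \<le> M" using M(1)[of 0] by linarith
  define \<delta> where "\<delta> n = 1 / real (Suc n)" for n
  have \<delta>: "0 < \<delta> n" "\<delta> n \<le> 1" for n by (auto simp: \<delta>_def)
  have lim\<delta>: "\<delta> \<longlonglongrightarrow> 0" unfolding \<delta>_def[abs_def] by (rule LIMSEQ_Suc[OF lim_1_over_n])
  have [measurable]: "zpart G \<in> borel_measurable borel" "V \<in> borel_measurable borel"
    "\<phi> \<in> borel_measurable borel" "hgrad G \<phi> \<in> borel_measurable borel"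
    by (intro borel_measurable_continuous_onI bounded_linear.continuous_on[OF bounded_linear_zpart]
        continuous_on_id continuous_V Ck_imp_continuous[OF test_functionD(1)[OF \<phi>]]
        continuous_hgrad test_functionD(1)[OF \<phi>])+
  define w where "w n x = (q x + \<delta> n) powr ((p - 2) / 2)" for n x
  have pos: "0 < q x + \<delta> n" for n x using \<delta> by (simp add: add_nonneg_pos)
  have limq: "(\<lambda>n. q x + \<delta> n) \<longlonglongrightarrow> q x" for x
    using tendsto_add[OF tendsto_const lim\<delta>] by simp
  have limw: "(\<lambda>n. w n x) \<longlonglongrightarrow> norm (zpart G x) powr (p - 2)" if "zpart G x \<noteq> 0" for x
    unfolding w_def q_powr[symmetric] using that by (intro tendsto_powr limq tendsto_const) simp
  \<comment> \<open>Bounding |z| by \<open>(q x + \<delta> n) powr (1/2)\<close> raises the exponent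
    of the weight to \<open>(p - 1) / 2\<close>, which is positive even for \<open>p < 2\<close>;
    the larger side then increases in \<open>q x + \<delta> n \<le> R\<^sup>2 + 1\<close>.\<close>
  have wq: "w n x * q x \<le> (R\<^sup>2 + 1) powr (p / 2)" "w n x * norm (zpart G x) \<le> (R\<^sup>2 + 1) powr ((p - 1) / 2)"
    if "x \<in> B" for n x
  proof -
    have le: "q x + \<delta> n \<le> R\<^sup>2 + 1" using q_le[OF that] \<delta>(2)[of n] by linarith
    have "w n x * q x \<le> w n x * (q x + \<delta> n)"
      using \<delta>(1)[of n] by (intro mult_left_mono) (auto simp: w_def)
    also have "\<dots> = (q x + \<delta> n) powr (p / 2)"
      using powr_add[of "q x + \<delta> n" "(p - 2) / 2" 1] pos[of x n] by (simp add: w_def diff_divide_distrib)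
    also have "\<dots> \<le> (R\<^sup>2 + 1) powr (p / 2)" using le pos[of x n] p by (intro powr_mono2) auto
    finally show "w n x * q x \<le> (R\<^sup>2 + 1) powr (p / 2)" .
    have "norm (zpart G x) = q x powr (1 / 2)" using q_powr[of x 1] by simp
    then have "w n x * norm (zpart G x) \<le> w n x * (q x + \<delta> n) powr (1 / 2)"
      using \<delta>(1)[of n] by (auto simp: w_def intro!: mult_left_mono powr_mono2)
    also have "\<dots> = (q x + \<delta> n) powr ((p - 1) / 2)"
      using powr_add[of "q x + \<delta> n" "(p - 2) / 2" "1 / 2"] by (simp add: w_def diff_divide_distrib)
    also have "\<dots> \<le> (R\<^sup>2 + 1) powr ((p - 1) / 2)" using le pos[of x n] p by (intro powr_mono2) auto
    finally show "w n x * norm (zpart G x) \<le> (R\<^sup>2 + 1) powr ((p - 1) / 2)" .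
  qed
  have l1: "(\<lambda>n. \<integral>x. w n x * (V x \<bullet> hgrad G \<phi> x) \<partial>lebesgue_on B)
      \<longlonglongrightarrow> (\<integral>x. norm (zpart G x) powr (p - 2) * (V x \<bullet> hgrad G \<phi> x) \<partial>lebesgue_on B)"
  proof (rule bounded_convergence_lebesgue_on[OF lmeasurable_domain])
    show "(\<lambda>x. w n x * (V x \<bullet> hgrad G \<phi> x)) \<in> borel_measurable (lebesgue_on B)" for n
      unfolding w_def by (intro borel_measurable_lebesgue_on) measurable
    show "(\<lambda>x. norm (zpart G x) powr (p - 2) * (V x \<bullet> hgrad G \<phi> x)) \<in> borel_measurable (lebesgue_on B)"
      by (intro borel_measurable_lebesgue_on) measurable
    show "(\<lambda>n. w n x * (V x \<bullet> hgrad G \<phi> x)) \<longlonglongrightarrow> norm (zpart G x) powr (p - 2) * (V x \<bullet> hgrad G \<phi> x)" for x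
      by (cases "zpart G x = 0") (auto simp: V_eq_0 intro!: tendsto_mult limw)
    show "\<bar>w n x * (V x \<bullet> hgrad G \<phi> x)\<bar> \<le> (R\<^sup>2 + 1) powr ((p - 1) / 2) * (R\<^sup>2 * M)" if "x \<in> B" for n x
    proof -
      have w0: "0 \<le> w n x" by (simp add: w_def)
      have "\<bar>V x \<bullet> hgrad G \<phi> x\<bar> \<le> norm (V x) * norm (hgrad G \<phi> x)" by (rule Cauchy_Schwarz_ineq2)
      also have "\<dots> \<le> (norm (zpart G x) * R\<^sup>2) * M"
        using norm_V_le[OF that] M(2) by (intro mult_mono) auto
      finally have "\<bar>w n x * (V x \<bullet> hgrad G \<phi> x)\<bar> \<le> w n x * ((norm (zpart G x) * R\<^sup>2) * M)"
        using w0 by (simp add: abs_mult mult_left_mono)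
      also have "\<dots> = (w n x * norm (zpart G x)) * (R\<^sup>2 * M)" by simp
      also have "\<dots> \<le> (R\<^sup>2 + 1) powr ((p - 1) / 2) * (R\<^sup>2 * M)"
        using wq(2)[OF that] M0 by (intro mult_right_mono) auto
      finally show ?thesis .
    qed
  qed
  have l2: "(\<lambda>n. \<integral>x. \<phi> x * (q x * w n x * (Q + 2 + (p - 2) * (q x / (q x + \<delta> n)))) \<partial>lebesgue_on B)
      \<longlonglongrightarrow> (\<integral>x. \<phi> x * ((Q + p) * norm (zpart G x) powr p) \<partial>lebesgue_on B)"
  proof (rule bounded_convergence_lebesgue_on[OF lmeasurable_domain])
    show "(\<lambda>x. \<phi> x * (q x * w n x * (Q + 2 + (p - 2) * (q x / (q x + \<delta> n))))) \<in> borel_measurable (lebesgue_on B)" for n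
      unfolding w_def by (intro borel_measurable_lebesgue_on) measurable
    show "(\<lambda>x. \<phi> x * ((Q + p) * norm (zpart G x) powr p)) \<in> borel_measurable (lebesgue_on B)"
      by (intro borel_measurable_lebesgue_on) measurable
    show "(\<lambda>n. \<phi> x * (q x * w n x * (Q + 2 + (p - 2) * (q x / (q x + \<delta> n)))))
       \<longlonglongrightarrow> \<phi> x * ((Q + p) * norm (zpart G x) powr p)" for x
    \<comment> \<open>On z = 0 the weights need not converge, but every member of the sequence
      carries the factor \<open>q x = 0\<close>.\<close>
    proof (cases "zpart G x = 0")
      case False
      have "(\<lambda>n. \<phi> x * (q x * w n x * (Q + 2 + (p - 2) * (q x / (q x + \<delta> n)))))
         \<longlonglongrightarrow> \<phi> x * (q x * norm (zpart G x) powr (p - 2) * (Q + 2 + (p - 2) * (q x / q x)))"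
        using False by (intro tendsto_intros limw limq) auto
      moreover have "q x * norm (zpart G x) powr (p - 2) = norm (zpart G x) powr p"
        using powr_minus_2_mult(2)[of "norm (zpart G x)" p] by (simp add: dot_square_norm mult.commute)
      moreover have "Q + 2 + (p - 2) * (q x / q x) = Q + p" using False by simp
      ultimately show ?thesis by (simp only: mult.commute[of "Q + p"])
    qed simp
    show "\<bar>\<phi> x * (q x * w n x * (Q + 2 + (p - 2) * (q x / (q x + \<delta> n))))\<bar>
        \<le> M * ((R\<^sup>2 + 1) powr (p / 2) * (Q + 2 + \<bar>p - 2\<bar> * 1))" if "x \<in> B" for n x
    proof -
      have "\<bar>q x / (q x + \<delta> n)\<bar> \<le> 1" using \<delta>(1)[of n] pos[of x n] by simp
      then have "\<bar>(p - 2) * (q x / (q x + \<delta> n))\<bar> \<le> \<bar>p - 2\<bar> * 1"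
        unfolding abs_mult by (intro mult_left_mono) auto
      then have A: "\<bar>Q + 2 + (p - 2) * (q x / (q x + \<delta> n))\<bar> \<le> Q + 2 + \<bar>p - 2\<bar> * 1" by linarith
      have "\<bar>q x * w n x\<bar> \<le> (R\<^sup>2 + 1) powr (p / 2)"
        using wq(1)[OF that, of n] by (simp add: w_def mult.commute)
      then show ?thesis
        unfolding abs_mult[of "\<phi> x"] abs_mult[of "q x * w n x"]
        using M(1)[of x] M0 A by (intro mult_mono) auto
    qed
  qed
  have "(\<integral>x. w n x * (V x \<bullet> hgrad G \<phi> x) \<partial>lebesgue_on B)
     = - (\<integral>x. \<phi> x * (q x * w n x * (Q + 2 + (p - 2) * (q x / (q x + \<delta> n)))) \<partial>lebesgue_on B)" for n
    unfolding w_def by (rule regularized_flux[OF \<phi> \<delta>(1)])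
  then show ?thesis
    using LIMSEQ_unique[OF l1] tendsto_minus[OF l2] by simp
qed

section \<open>The explicit profile and its constants\<close>

definition \<beta> :: real where "\<beta> = p / (2 * (p - 1))"
text \<open>Normalized so that \<open>\<kappa> powr (p - 1)\<close> is the reciprocal of Q + p, the
  constant in the divergence of |z|^(p-2) V.\<close>

definition \<kappa> :: real where "\<kappa> = (Q + p) powr (- 1 / (p - 1))"
text \<open>The coefficient for which \<open>4 * C * \<beta> = \<kappa>\<close>, so that
  differentiating \<open>sol\<close> gives \<open>sol_grad\<close> where \<open>N4\<close> is
  positive.\<close>

definition C :: real where "C = (p - 1) / (2 * p * (Q + p) powr (1 / (p - 1)))"

definition sol :: "'g \<Rightarrow> real" where
  "sol x = C * ((R ^ 4) powr \<beta> - N4 x powr \<beta>)"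

definition sol_grad :: "'g \<Rightarrow> 'g" where
  "sol_grad x = - ((\<kappa> * N4 x powr (\<beta> - 1)) *\<^sub>R V x)"

lemma \<beta>_gt: "1/2 < \<beta>"
  using p by (simp add: \<beta>_def field_simps)

lemma Qp_pos: "0 < Q + p"
  using p by simp

lemma \<kappa>_pos: "0 < \<kappa>"
  using Qp_pos by (simp add: \<kappa>_def)

lemma C_pos: "0 < C"
  using p Qp_pos by (simp add: C_def)

lemma C_\<beta>: "4 * C * \<beta> = \<kappa>"
proof -
  have "4 * C * \<beta> = inverse ((Q + p) powr (1 / (p - 1)))"
    using p by (simp add: C_def \<beta>_def field_simps)
  then show ?thesis by (simp add: \<kappa>_def powr_minus)
qed

text \<open>The shift and the subtracted constant serve the smooth approximants; with both equal to
  0 this is the profile of the solution itself, away from \<open>N4 x = 0\<close>.\<close>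

lemma profile_has_real_derivative:
  assumes "0 < s + \<delta>"
  shows "((\<lambda>s. C * ((R ^ 4) powr \<beta> - (s + \<delta>) powr \<beta>) - c) has_real_derivative
      - (C * \<beta> * (s + \<delta>) powr (\<beta> - 1))) (at s)"
  using assms by (auto intro!: derivative_eq_intros)

lemma W0_sol: "W0 G p B sol sol_grad"
proof -
  define \<epsilon> where "\<epsilon> n = 1 / real (Suc n)" for n
  have \<epsilon>: "0 < \<epsilon> n" "\<epsilon> n \<le> 1" for n by (auto simp: \<epsilon>_def)
  have lim\<epsilon>: "\<epsilon> \<longlonglongrightarrow> 0" unfolding \<epsilon>_def[abs_def] by (rule LIMSEQ_Suc[OF lim_1_over_n])
  \<comment> \<open>Adding \<open>\<epsilon> n\<close> to \<open>N4\<close> removes the singularity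
    of the power at 0. With the second \<open>\<epsilon> n\<close> subtracted as well, the closed
    set where \<open>Y n\<close> is nonnegative lies inside the open ball, so the cut-off has
    compact support there.\<close>
  define Y where "Y n x = C * ((R ^ 4) powr \<beta> - (N4 x + \<epsilon> n) powr \<beta>) - \<epsilon> n" for n x
  define \<phi> where "\<phi> n x = smooth_pos (\<epsilon> n) (Y n x)" for n x
  have pos: "0 < N4 x + \<epsilon> n" for n x using N4_nonneg[of x] \<epsilon>(1)[of n] by linarith
  have CY: "Ck k (Y n)" for k n
    unfolding Y_def[abs_def]
    by (intro Ck_diff Ck_cmult Ck_const Ck_powr Ck_add Ck_N4 pos)
  have Y_nonneg_imp: "x \<in> B" if "0 \<le> Y n x" for n x
  proof -
    have "0 < C * ((R ^ 4) powr \<beta> - (N4 x + \<epsilon> n) powr \<beta>)" using that \<epsilon>(1)[of n] by (simp add: Y_def)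
    then have "(N4 x + \<epsilon> n) powr \<beta> < (R ^ 4) powr \<beta>" using C_pos by (simp add: zero_less_mult_iff)
    then have "N4 x + \<epsilon> n < R ^ 4"
      using powr_mono2[of \<beta> "R ^ 4" "N4 x + \<epsilon> n"] \<beta>_gt R_pos by (simp add: not_le[symmetric])
        (metis less_eq_real_def linorder_not_le zero_le_even_power even_numeral not_less)
    then show ?thesis using \<epsilon>(1)[of n] by (simp add: mem_B)
  qed
  have test: "\<phi> n \<in> test_functions B" for n
  proof -
    have "closed {x. 0 \<le> Y n x}"
      by (intro closed_Collect_le Ck_imp_continuous[OF CY] continuous_on_const)
    moreover have "{x. \<phi> n x \<noteq> 0} \<subseteq> {x. 0 \<le> Y n x}"
      using smooth_pos_nonpos[OF \<epsilon>(1)[of n]] by (auto simp: \<phi>_def) (metis linorder_le_cases)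
    ultimately have "closure {x. \<phi> n x \<noteq> 0} \<subseteq> {x. 0 \<le> Y n x}" by (intro closure_minimal)
    also have "\<dots> \<subseteq> B" using Y_nonneg_imp by auto
    finally have sub: "closure {x. \<phi> n x \<noteq> 0} \<subseteq> B" .
    then have "bounded (closure {x. \<phi> n x \<noteq> 0})" by (rule bounded_subset[OF bounded_domain])
    then have "compact (closure {x. \<phi> n x \<noteq> 0})" by (simp add: compact_eq_bounded_closed)
    then show ?thesis
      using sub Ck_smooth_pos[OF CY] by (simp add: test_functions_def \<phi>_def[abs_def])
  qed
  have grad: "hgrad G (\<phi> n) x
      = - ((smooth_pos' (\<epsilon> n) (Y n x) * (\<kappa> * (N4 x + \<epsilon> n) powr (\<beta> - 1))) *\<^sub>R V x)" for n x
  proof -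
    have "((\<lambda>s. smooth_pos (\<epsilon> n) (C * ((R ^ 4) powr \<beta> - (s + \<epsilon> n) powr \<beta>) - \<epsilon> n)) has_real_derivative
       smooth_pos' (\<epsilon> n) (Y n x) * - (C * \<beta> * (N4 x + \<epsilon> n) powr (\<beta> - 1))) (at (N4 x))"
      unfolding Y_def
      by (rule DERIV_chain2[OF smooth_pos_has_real_derivative[OF \<epsilon>(1)] profile_has_real_derivative[OF pos]])
    from hgrad_compose_N4[OF this]
    show ?thesis by (simp add: \<phi>_def[abs_def] Y_def C_\<beta>[symmetric] mult_ac)
  qed
  \<comment> \<open>The first entry bounds the approximants, the second their gradients; the 1 in
    \<open>R ^ 4 + 1\<close> covers \<open>\<epsilon> n \<le> 1\<close>.\<close>
  define M where "M = max (C * (R ^ 4) powr \<beta>) (\<kappa> * (R ^ 4 + 1) powr (\<beta> - 1/4))"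
  show ?thesis
  proof (rule W0_bounded_limit[where \<phi> = \<phi> and M = M, OF test])
    fix n x
    have "\<bar>\<phi> n x\<bar> \<le> C * (R ^ 4) powr \<beta>"
      unfolding \<phi>_def
    proof (rule smooth_pos_bounds[OF \<epsilon>(1)])
      have "C * ((R ^ 4) powr \<beta> - (N4 x + \<epsilon> n) powr \<beta>) \<le> C * (R ^ 4) powr \<beta>"
        using C_pos by (intro mult_left_mono) auto
      then show "Y n x \<le> C * (R ^ 4) powr \<beta>" using \<epsilon>(1)[of n] by (simp add: Y_def)
    qed (use C_pos in simp)
    then show "\<bar>\<phi> n x\<bar> \<le> M" by (simp add: M_def)
    assume x: "x \<in> B"
    \<comment> \<open>The exponent 3/4 is 1/4 from |z| plus 1/2 from \<open>norm_V\<close>. Added to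
      \<beta> - 1 it gives \<beta> - 1/4, which is positive although \<beta> - 1 may be negative, so
      the gradients stay bounded near the identity.\<close>
    have V: "norm (V x) \<le> (N4 x + \<epsilon> n) powr (3/4)"
    proof -
      have "norm (zpart G x) = (norm (zpart G x) ^ 4) powr (1/4)"
        by (cases "zpart G x = 0") (simp_all add: powr_powr flip: powr_numeral)
      also have "\<dots> \<le> N4 x powr (1/4)" using zpart_le_N4[of x] by (intro powr_mono2) auto
      finally have "norm (V x) \<le> N4 x powr (1/4) * N4 x powr (1/2)"
        unfolding norm_V using N4_nonneg[of x] by (simp add: powr_half_sqrt mult_right_mono)
      also have "\<dots> = N4 x powr (3/4)" by (simp add: powr_add[symmetric])
      also have "\<dots> \<le> (N4 x + \<epsilon> n) powr (3/4)" using N4_nonneg[of x] \<epsilon>(1)[of n] by (intro powr_mono2) auto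
      finally show ?thesis .
    qed
    have "norm (hgrad G (\<phi> n) x) = \<bar>smooth_pos' (\<epsilon> n) (Y n x)\<bar> * (\<kappa> * (N4 x + \<epsilon> n) powr (\<beta> - 1)) * norm (V x)"
      using \<kappa>_pos by (simp add: grad abs_mult)
    also have "\<dots> \<le> 1 * (\<kappa> * (N4 x + \<epsilon> n) powr (\<beta> - 1)) * (N4 x + \<epsilon> n) powr (3/4)"
      using \<kappa>_pos V smooth_pos'_bounds[OF \<epsilon>(1)] by (intro mult_mono) auto
    also have "\<dots> = \<kappa> * (N4 x + \<epsilon> n) powr (\<beta> - 1/4)"
      using powr_add[of "N4 x + \<epsilon> n" "\<beta> - 1" "3/4"] by simp
    also have "\<dots> \<le> \<kappa> * (R ^ 4 + 1) powr (\<beta> - 1/4)"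
      using x \<epsilon>(2)[of n] \<kappa>_pos \<beta>_gt pos[of x n] by (intro mult_left_mono powr_mono2) (auto simp: mem_B)
    finally show "norm (hgrad G (\<phi> n) x) \<le> M" by (simp add: M_def)
  next
    fix x assume x: "x \<in> B"
    have limN: "(\<lambda>n. N4 x + \<epsilon> n) \<longlonglongrightarrow> N4 x"
      using tendsto_add[OF tendsto_const lim\<epsilon>] by simp
    have limp: "(\<lambda>n. (N4 x + \<epsilon> n) powr \<beta>) \<longlonglongrightarrow> N4 x powr \<beta>"
      using \<beta>_gt pos by (intro tendsto_powr'[OF limN tendsto_const]) (auto intro!: always_eventually less_imp_le simp: add_nonneg_pos N4_nonneg \<epsilon>(1))
    have "(\<lambda>n. Y n x) \<longlonglongrightarrow> C * ((R ^ 4) powr \<beta> - N4 x powr \<beta>) - 0"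
      unfolding Y_def by (intro tendsto_intros limp lim\<epsilon>)
    then have limY: "(\<lambda>n. Y n x) \<longlonglongrightarrow> sol x" by (simp add: sol_def)
    have "N4 x powr \<beta> < (R ^ 4) powr \<beta>"
      using x \<beta>_gt N4_nonneg by (intro powr_less_mono2) (auto simp: mem_B)
    then have "0 < sol x" using C_pos by (simp add: sol_def)
    note lim = smooth_pos_tendsto[OF \<epsilon>(1) lim\<epsilon> limY this]
    show "(\<lambda>n. \<phi> n x) \<longlonglongrightarrow> sol x" unfolding \<phi>_def by (rule lim(1))
    show "(\<lambda>n. hgrad G (\<phi> n) x) \<longlonglongrightarrow> sol_grad x"
    \<comment> \<open>If \<open>N4 x = 0\<close>, all the gradients are 0 together with
      \<open>V x\<close>; elsewhere the powers converge.\<close>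
    proof (cases "N4 x = 0")
      case True
      then show ?thesis by (simp add: grad sol_grad_def V_eq_0)
    next
      case False
      have "(\<lambda>n. hgrad G (\<phi> n) x) \<longlonglongrightarrow> - ((1 * (\<kappa> * N4 x powr (\<beta> - 1))) *\<^sub>R V x)"
        unfolding grad using False by (intro tendsto_intros lim(2) limN) auto
      then show ?thesis by (simp add: sol_grad_def)
    qed
  qed
qed

lemma norm_sol_grad: "norm (sol_grad x) = \<kappa> * N4 x powr (\<beta> - 1/2) * norm (zpart G x)"
proof -
  have "N4 x powr (\<beta> - 1) * sqrt (N4 x) = N4 x powr (\<beta> - 1/2)"
    using N4_nonneg[of x] powr_add[of "N4 x" "\<beta> - 1" "1/2"] by (simp add: powr_half_sqrt)
  then show ?thesis
    using \<kappa>_pos by (simp add: sol_grad_def norm_V abs_mult mult_ac)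
qed

lemma sol_flux:
  "norm (sol_grad x) powr (p - 2) *\<^sub>R sol_grad x
     = - ((1 / (Q + p) * norm (zpart G x) powr (p - 2)) *\<^sub>R V x)"
proof (cases "N4 x = 0")
  case True
  then show ?thesis by (simp add: sol_grad_def V_eq_0)
next
  case False
  then have N: "0 < N4 x" using N4_nonneg[of x] by simp
  have \<kappa>: "\<kappa> powr (p - 1) = 1 / (Q + p)"
  proof -
    have "\<kappa> powr (p - 1) = (Q + p) powr (- 1 / (p - 1) * (p - 1))"
      unfolding \<kappa>_def by (rule powr_powr)
    also have "- 1 / (p - 1) * (p - 1) = - 1" using p by simp
    finally show ?thesis using Qp_pos by (simp add: powr_minus_divide)
  qed
  \<comment> \<open>The equation that determines \<beta>: the factor
    \<open>norm (sol_grad x) powr (p - 2)\<close> contributes the first exponent of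
    \<open>N4\<close>, the gradient itself the second.\<close>
  have e: "(\<beta> - 1/2) * (p - 2) + (\<beta> - 1) = 0"
  proof -
    have "(\<beta> - 1/2) * (p - 2) + (\<beta> - 1) = \<beta> * (p - 1) - p / 2" by (simp add: field_simps)
    moreover have "\<beta> * (p - 1) = p / 2" using p by (simp add: \<beta>_def divide_simps)
    ultimately show ?thesis by simp
  qed
  have "norm (sol_grad x) powr (p - 2)
      = \<kappa> powr (p - 2) * N4 x powr ((\<beta> - 1/2) * (p - 2)) * norm (zpart G x) powr (p - 2)"
    unfolding norm_sol_grad using \<kappa>_pos by (simp add: powr_mult powr_powr)
  then have "norm (sol_grad x) powr (p - 2) * (\<kappa> * N4 x powr (\<beta> - 1))
      = (\<kappa> powr (p - 2) * \<kappa>) * (N4 x powr ((\<beta> - 1/2) * (p - 2)) * N4 x powr (\<beta> - 1)) * norm (zpart G x) powr (p - 2)"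
    by (simp add: mult_ac)
  also have "\<kappa> powr (p - 2) * \<kappa> = 1 / (Q + p)"
    using powr_minus_2_mult(1)[of \<kappa> p] \<kappa>_pos \<kappa> by simp
  also have "N4 x powr ((\<beta> - 1/2) * (p - 2)) * N4 x powr (\<beta> - 1) = 1"
    using N by (simp add: powr_add[symmetric] e)
  finally have "norm (sol_grad x) powr (p - 2) * (\<kappa> * N4 x powr (\<beta> - 1)) = 1 / (Q + p) * norm (zpart G x) powr (p - 2)"
    by simp
  moreover have "t *\<^sub>R sol_grad x = - ((t * (\<kappa> * N4 x powr (\<beta> - 1))) *\<^sub>R V x)" for t
    by (simp add: sol_grad_def)
  ultimately show ?thesis by simp
qed

lemma weak_solution_sol: "weak_solution G p B (\<lambda>x. norm (zpart G x) powr p) sol"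
  unfolding weak_solution_def
proof (intro exI conjI allI impI)
  show "W0 G p B sol sol_grad" by (rule W0_sol)
  fix \<phi> \<psi> assume w: "W0 G p B \<phi> \<psi>"
  \<comment> \<open>The flux of \<open>sol\<close> after the cancellation. It grows at most like
    |z|^(p-1), hence is bounded on the ball, which is what the passage from test functions to
    \<open>W0\<close> requires.\<close>
  define a where "a x = - ((1 / (Q + p) * norm (zpart G x) powr (p - 2)) *\<^sub>R V x)" for x
  have cz: "continuous_on UNIV (zpart G)"
    by (intro bounded_linear.continuous_on[OF bounded_linear_zpart] continuous_on_id)
  have [measurable]: "zpart G \<in> borel_measurable borel" "V \<in> borel_measurable borel"
    by (intro borel_measurable_continuous_onI cz continuous_V)+
  have zR: "norm (zpart G x) \<le> R" if "x \<in> B" for x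
    using that R_pos by (intro norm_zpart_le) (auto simp: mem_B)
  have "(\<integral>x. a x \<bullet> \<psi> x \<partial>lebesgue_on B) = (\<integral>x. norm (zpart G x) powr p * \<phi> x \<partial>lebesgue_on B)"
  proof (rule W0_integral_eq[OF w])
    show "a \<in> borel_measurable (lebesgue_on B)"
      unfolding a_def[abs_def] by (intro borel_measurable_lebesgue_on) measurable
    show "(\<lambda>x. norm (zpart G x) powr p) \<in> borel_measurable (lebesgue_on B)"
      by (intro borel_measurable_lebesgue_on) measurable
    show "norm (a x) \<le> 1 / (Q + p) * (R powr (p - 1) * R\<^sup>2)" if "x \<in> B" for x
    proof -
      have "norm (a x) = 1 / (Q + p) * (norm (zpart G x) powr (p - 2) * norm (V x))"
        using Qp_pos by (simp add: a_def)
      also have "\<dots> \<le> 1 / (Q + p) * (norm (zpart G x) powr (p - 2) * (norm (zpart G x) * R\<^sup>2))"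
        using Qp_pos norm_V_le[OF that] by (intro mult_left_mono) auto
      also have "\<dots> = 1 / (Q + p) * (norm (zpart G x) powr (p - 1) * R\<^sup>2)"
        using powr_minus_2_mult(1)[of "norm (zpart G x)" p] by (simp add: mult.assoc[symmetric])
      also have "\<dots> \<le> 1 / (Q + p) * (R powr (p - 1) * R\<^sup>2)"
        using Qp_pos p zR[OF that] by (intro mult_left_mono mult_right_mono powr_mono2) auto
      finally show ?thesis .
    qed
    show "\<bar>norm (zpart G x) powr p\<bar> \<le> R powr p" if "x \<in> B" for x
      using p zR[OF that] by (auto intro: powr_mono2)
    fix \<eta> assume \<eta>: "\<eta> \<in> test_functions B"
    have "(\<integral>x. a x \<bullet> hgrad G \<eta> x \<partial>lebesgue_on B)
        = (\<integral>x. - (1 / (Q + p)) * (norm (zpart G x) powr (p - 2) * (V x \<bullet> hgrad G \<eta> x)) \<partial>lebesgue_on B)"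
      by (simp add: a_def)
    also have "\<dots> = 1 / (Q + p) * (\<integral>x. \<eta> x * ((Q + p) * norm (zpart G x) powr p) \<partial>lebesgue_on B)"
      unfolding integral_mult_right_zero flux_test_function[OF \<eta>] by simp
    also have "(\<integral>x. \<eta> x * ((Q + p) * norm (zpart G x) powr p) \<partial>lebesgue_on B)
        = (\<integral>x. (Q + p) * (norm (zpart G x) powr p * \<eta> x) \<partial>lebesgue_on B)"
      by (simp add: mult_ac)
    also have "1 / (Q + p) * \<dots> = (\<integral>x. norm (zpart G x) powr p * \<eta> x \<partial>lebesgue_on B)"
      unfolding integral_mult_right_zero using Qp_pos by simp
    finally show "(\<integral>x. a x \<bullet> hgrad G \<eta> x \<partial>lebesgue_on B) = (\<integral>x. norm (zpart G x) powr p * \<eta> x \<partial>lebesgue_on B)" .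
  qed
  moreover have "norm (sol_grad x) powr (p - 2) * (sol_grad x \<bullet> \<psi> x) = a x \<bullet> \<psi> x" for x
    using sol_flux[of x] by (metis a_def inner_scaleR_left)
  ultimately show "(\<integral>x. norm (sol_grad x) powr (p - 2) * (sol_grad x \<bullet> \<psi> x) \<partial>lebesgue_on B)
      = (\<integral>x. norm (zpart G x) powr p * \<phi> x \<partial>lebesgue_on B)"
    by simp
qed

lemma sol_pos: "x \<in> B \<Longrightarrow> 0 < sol x"
  using powr_less_mono2[of \<beta> "N4 x" "R ^ 4"] \<beta>_gt C_pos N4_nonneg[of x] by (simp add: mem_B sol_def)

lemma sol_frontier: "x \<in> frontier B \<Longrightarrow> sol x = 0"
  using frontier_hom_ball[OF R_pos] by (simp add: sol_def)

text \<open>On the frontier \<open>N4\<close> equals \<open>R ^ 4\<close> and is positive, so the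
  profile can be differentiated classically. Differentiability is recorded because
  \<open>hgrad\<close> is built from Frechet derivatives and has no meaning without it.\<close>

lemma sol_gradient_frontier:
  assumes "x \<in> frontier B"
  shows "sol differentiable (at x)"
    and "norm (hgrad G sol x) = (R\<^sup>2 / (Q + p)) powr (1 / (p - 1)) * norm (zpart G x)"
proof -
  have N: "N4 x = R ^ 4" by (rule frontier_hom_ball[OF R_pos assms])
  have D: "((\<lambda>s. C * ((R ^ 4) powr \<beta> - s powr \<beta>)) has_real_derivative - (C * \<beta> * N4 x powr (\<beta> - 1))) (at (N4 x))"
    using profile_has_real_derivative[of "N4 x" 0 0] N R_pos by simp
  show "sol differentiable (at x)"
    unfolding sol_def[abs_def]
    using DERIV_compose_FDERIV[OF D N4_has_derivative] by (rule differentiableI)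
  have "hgrad G sol x = sol_grad x"
    using hgrad_compose_N4[OF D] by (simp add: sol_def[abs_def] sol_grad_def C_\<beta>[symmetric] mult_ac)
  then have "norm (hgrad G sol x) = \<kappa> * (R ^ 4) powr (\<beta> - 1/2) * norm (zpart G x)"
    by (simp add: norm_sol_grad N)
  also have "\<kappa> * (R ^ 4) powr (\<beta> - 1/2) = (R\<^sup>2 / (Q + p)) powr (1 / (p - 1))"
  proof -
    have "4 * (\<beta> - 1/2) = 2 * (1 / (p - 1))" using p by (simp add: \<beta>_def field_simps)
    moreover have "(R ^ 4) powr (\<beta> - 1/2) = R powr (4 * (\<beta> - 1/2))"
      using R_pos powr_powr[of R 4 "\<beta> - 1/2"] by simp
    moreover have "R powr (2 * (1 / (p - 1))) = (R\<^sup>2) powr (1 / (p - 1))"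
      using R_pos powr_powr[of R 2 "1 / (p - 1)"] by simp
    moreover have "\<kappa> = inverse ((Q + p) powr (1 / (p - 1)))"
      by (simp add: \<kappa>_def powr_minus)
    ultimately have "\<kappa> * (R ^ 4) powr (\<beta> - 1/2) = (R\<^sup>2) powr (1 / (p - 1)) / (Q + p) powr (1 / (p - 1))"
      by (simp only: divide_inverse mult.commute)
    then show ?thesis by (simp only: powr_divide)
  qed
  finally show "norm (hgrad G sol x) = (R\<^sup>2 / (Q + p)) powr (1 / (p - 1)) * norm (zpart G x)" .
qed

lemma sol_eq_hom_norm:
  "sol x = C * (R powr (2 * p / (p - 1)) - hom_norm G x powr (2 * p / (p - 1)))"
proof -
  have "4 * \<beta> = 2 * p / (p - 1)" "1/4 * (2 * p / (p - 1)) = \<beta>" using p by (simp_all add: \<beta>_def field_simps)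
  moreover have "(R ^ 4) powr \<beta> = R powr (4 * \<beta>)"
    using R_pos powr_powr[of R 4 \<beta>] by simp
  ultimately show ?thesis
    by (simp only: sol_def hom_norm_eq powr_powr)
qed

end

text \<open>A weak solution is seen only through integrals, so uniqueness can hold only up to null
  sets; the competitors \<open>u\<close> may have any sign.\<close>

theorem proposition1p1:
  fixes G :: "'g::euclidean_space htype" and p R Q c :: real
    and B :: "'g set" and f :: "'g \<Rightarrow> real"
  assumes G: "heisenberg_type G"
    and p: "1 < p" and R: "0 < R"
    and Q: "Q = real (homogeneous_dim G)"
    and B: "B = hom_ball G R"
    and f: "f = (\<lambda>x. (p - 1) / (2 * p * (Q + p) powr (1 / (p - 1))) *
                     (R powr (2 * p / (p - 1)) - hom_norm G x powr (2 * p / (p - 1))))"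
    and c: "c = (R\<^sup>2 / (Q + p)) powr (1 / (p - 1))"
  shows "weak_solution G p B (\<lambda>x. norm (zpart G x) powr p) f \<and>
         (\<forall>x\<in>frontier B. f x = 0) \<and>
         (\<forall>x\<in>B. 0 < f x) \<and>
         (\<forall>u. weak_solution G p B (\<lambda>x. norm (zpart G x) powr p) u \<longrightarrow>
              (AE x in lebesgue_on B. u x = f x)) \<and>
         (\<forall>x\<in>frontier B. f differentiable (at x) \<and>
              norm (hgrad G f x) = c * norm (zpart G x))"
proof -
  interpret heisenberg_ball G p R
    by standard (use G p R in auto)
  have f: "f = sol"
    unfolding f Q by (rule ext) (simp only: sol_eq_hom_norm C_def)
  show ?thesis
    unfolding f B c Q
    using weak_solution_sol sol_frontier sol_pos weak_solution_unique[OF _ weak_solution_sol]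
      sol_gradient_frontier
    by blast
qed

end
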